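(* Let $q$ be an integral nonsingular quadratic form in an odd number $m=2k+1\ge 3$ of variables with matrix $Q$, and let $p$ be a prime not dividing $\det q$. For $1\le d\le k$ put $b=m-2d$ and $D_p(d)=\mathrm{diag}(1_d,\,p1_b,\,p^21_d)$. Then for every $K\in\mathbb Z^m$ with $q(K)\equiv0\pmod{p^2}$, $$\mathcal S_{p^2}(q,D_p(d),K)=\alpha_p(d)\Big\{1+\big(\varepsilon_p\chi_p(q)p^{k-1}+\kappa_p(d)\big)\delta(p^{-1}K)+p^{m-2}\delta(p^{-2}K)\Big\},$$ where $$\alpha_p(d)=p^{1-d}\prod_{s=1}^{d-1}\frac{p^{2(k-s)}-1}{1-p^{-s}},\qquad \kappa_p(d)=\frac{p^{m-2}-p^{d-1}}{p^d-1}-1.$$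
   Context: $\Lambda^m=GL_m(\mathbb Z)$. For an integral form $q$ and $M\in\mathbb Z^m_m$, $q[M]$ is the form $Y\mapsto q(MY)$; "$q[M]\equiv0\pmod{p^2}$" means all its coefficients are divisible by $p^2$. $M\mid K$ means $K=ML$ for some $L\in\mathbb Z^m$. The isotropic sum is $$\mathcal S_{p^2}(q,D,K)=\#\{M\Lambda^m\in\Lambda^mD\Lambda^m/\Lambda^m:\ q[M]\equiv0 \ (\mathrm{mod}\ p^2),\ M\mid K\},$$ (the conditions depend only on the coset $M\Lambda^m$). $\chi_p(q)=\left(\frac{(-1)^k\det q}{p}\right)$, $\varepsilon_p=\left(\frac{2q(p^{-1}K)}{p}\right)$ (Legendre symbols; this factor only matters when $p^{-1}K$ is integral), and $\delta(X)=1$ if the matrix $X$ is integral, $0$ otherwise. *)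

theory Defs
  imports
    "HOL-Number_Theory.Quadratic_Reciprocity"
    "Jordan_Normal_Form.Determinant"
begin

section \<open>Integral quadratic forms\<close>

definition qform :: "nat \<Rightarrow> (nat \<Rightarrow> nat \<Rightarrow> int) \<Rightarrow> int vec \<Rightarrow> int" where
  "qform m c Y = (\<Sum>i<m. \<Sum>j=i..<m. c i j * (Y $ i) * (Y $ j))"

text \<open>
  The matrix of a form is its even integral Gram matrix, so that the form is
  \<open>q(Y) = 1/2 Y\<^sup>t Q Y\<close> (see \<open>qform_gram\<close>), and \<open>det q\<close> is \<open>det Q\<close>. For an odd number of
  variables \<open>det Q\<close> is even, so a prime not dividing it is odd.
\<close>

definition qform_matrix :: "nat \<Rightarrow> (nat \<Rightarrow> nat \<Rightarrow> int) \<Rightarrow> int mat" where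
  "qform_matrix m c = mat m m (\<lambda>(i, j).
     if i = j then 2 * c i i else if i < j then c i j else c j i)"

definition integral_form_with_matrix :: "nat \<Rightarrow> (int vec \<Rightarrow> int) \<Rightarrow> int mat \<Rightarrow> bool" where
  "integral_form_with_matrix m q Q \<longleftrightarrow>
     (\<exists>c. (\<forall>Y \<in> carrier_vec m. q Y = qform m c Y) \<and> Q = qform_matrix m c)"

definition form_subst :: "(int vec \<Rightarrow> int) \<Rightarrow> int mat \<Rightarrow> int vec \<Rightarrow> int" where
  "form_subst q M = (\<lambda>Y. q (M *\<^sub>v Y))"

text \<open>
  The coefficients \<open>c i j\<close> with \<open>i \<le> j < m\<close> are determined by the values of the form
  (see \<open>qform_coeff_unique\<close>), so the existential quantifier below only names them.
\<close>

definition form_cong_0 :: "nat \<Rightarrow> int \<Rightarrow> (int vec \<Rightarrow> int) \<Rightarrow> bool" where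
  "form_cong_0 m n f \<longleftrightarrow>
     (\<exists>c. (\<forall>Y \<in> carrier_vec m. f Y = qform m c Y) \<and> (\<forall>i j. i \<le> j \<and> j < m \<longrightarrow> n dvd c i j))"

lemma qform_coeff_unique:
  assumes eq: "\<And>Y. Y \<in> carrier_vec m \<Longrightarrow> qform m c Y = qform m c' Y"
    and ij: "i \<le> j" "j < m"
  shows "c i j = c' i j"
proof -
  have diag: "qform m b (unit_vec m r) = b r r" if "r < m" for b r
  proof -
    have "qform m b (unit_vec m r) =
        (\<Sum>i<m. if i = r then (\<Sum>j=i..<m. if j = r then b i j else 0) else 0)"
      unfolding qform_def by (intro sum.cong refl) (auto simp: unit_vec_def if_distrib cong: if_cong)
    also have "\<dots> = b r r" using that by simp
    finally show ?thesis .
  qed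
  have off: "qform m b (unit_vec m r + unit_vec m s) = b r r + b r s + b s s"
    if "r < s" "s < m" for b r s
  proof -
    have "qform m b (unit_vec m r + unit_vec m s) =
        (\<Sum>i<m. (if i = r then (\<Sum>j=i..<m. (if j = r then b i j else 0) + (if j = s then b i j else 0)) else 0)
           + (if i = s then (\<Sum>j=i..<m. (if j = s then b i j else 0) + (if j = r then b i j else 0)) else 0))"
      unfolding qform_def using that
      by (intro sum.cong refl) (auto simp: unit_vec_def if_distrib[of "(*) x" for x] intro!: sum.cong cong: if_cong)
    also have "\<dots> = b r r + b r s + b s s"
      using that by (simp add: sum.distrib)
    finally show ?thesis .
  qed
  show ?thesis
  proof (cases "i = j")
    case True
    then show ?thesis using diag ij eq[of "unit_vec m i"] by simp
  next
    case False
    then have "i < j" using ij by simp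
    then show ?thesis
      using ij off[of i j c] off[of i j c'] diag[of i c] diag[of i c'] diag[of j c] diag[of j c']
        eq[of "unit_vec m i"] eq[of "unit_vec m j"] eq[of "unit_vec m i + unit_vec m j"]
      by simp
  qed
qed

lemma qform_gram:
  assumes "Y \<in> carrier_vec m"
  shows "2 * qform m c Y = Y \<bullet> (qform_matrix m c *\<^sub>v Y)"
proof -
  let ?g = "\<lambda>i j. c i j * (Y $ i) * (Y $ j)"
  let ?u = "\<lambda>i j. if i \<le> j then ?g i j else 0"
  have q: "qform m c Y = (\<Sum>i<m. \<Sum>j<m. ?u i j)"
    unfolding qform_def
    by (intro sum.cong refl sum.mono_neutral_cong_left) auto
  have "Y \<bullet> (qform_matrix m c *\<^sub>v Y) = (\<Sum>i<m. \<Sum>j<m. ?u i j + ?u j i)"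
    using assms unfolding scalar_prod_def qform_matrix_def
    by (auto simp: scalar_prod_def sum_distrib_left atLeast0LessThan algebra_simps
        intro!: sum.cong)
  also have "\<dots> = (\<Sum>i<m. \<Sum>j<m. ?u i j) + (\<Sum>i<m. \<Sum>j<m. ?u j i)"
    by (simp add: sum.distrib)
  also have "(\<Sum>i<m. \<Sum>j<m. ?u j i) = (\<Sum>i<m. \<Sum>j<m. ?u i j)"
    by (rule sum.swap)
  finally show ?thesis using q by simp
qed

section \<open>Isotropic sums\<close>

definition Lam :: "nat \<Rightarrow> int mat set" where
  "Lam m = {U \<in> carrier_mat m m. invertible_mat U}"

definition left_coset :: "nat \<Rightarrow> int mat \<Rightarrow> int mat set" where
  "left_coset m M = {M * U | U. U \<in> Lam m}"

definition double_coset :: "nat \<Rightarrow> int mat \<Rightarrow> int mat set" where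
  "double_coset m D = {U * D * V | U V. U \<in> Lam m \<and> V \<in> Lam m}"

definition mat_divides_vec :: "nat \<Rightarrow> int mat \<Rightarrow> int vec \<Rightarrow> bool" where
  "mat_divides_vec m M K \<longleftrightarrow> (\<exists>L \<in> carrier_vec m. K = M *\<^sub>v L)"

definition isotropic_sum :: "nat \<Rightarrow> nat \<Rightarrow> (int vec \<Rightarrow> int) \<Rightarrow> int mat \<Rightarrow> int vec \<Rightarrow> nat" where
  "isotropic_sum m n q D K =
     card {left_coset m M | M. M \<in> double_coset m D \<and>
             form_cong_0 m (int n) (form_subst q M) \<and> mat_divides_vec m M K}"

section \<open>Quantities in the explicit formula\<close>

definition D_mat :: "nat \<Rightarrow> nat \<Rightarrow> nat \<Rightarrow> int mat" where
  "D_mat m p d = mat_diag m (\<lambda>i.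
     if i < d then 1 else if i < d + (m - 2 * d) then int p else int p ^ 2)"

definition chi :: "nat \<Rightarrow> nat \<Rightarrow> int mat \<Rightarrow> int" where
  "chi p k Q = Legendre ((- 1) ^ k * det Q) (int p)"

text \<open>
  Componentwise \<open>div\<close> yields \<open>p\<^sup>-\<^sup>1 K\<close> exactly when that vector is integral; otherwise the
  value of \<open>eps\<close> is irrelevant, being multiplied by \<open>delta (p\<^sup>-\<^sup>1 K) = 0\<close>.
\<close>

definition eps :: "nat \<Rightarrow> (int vec \<Rightarrow> int) \<Rightarrow> int vec \<Rightarrow> int" where
  "eps p q K = Legendre (2 * q (map_vec (\<lambda>x. x div int p) K)) (int p)"

definition delta :: "real vec \<Rightarrow> real" where
  "delta X = (if \<forall>i < dim_vec X. X $ i \<in> \<int> then 1 else 0)"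

definition alpha :: "nat \<Rightarrow> nat \<Rightarrow> nat \<Rightarrow> real" where
  "alpha p k d = real p powi (1 - int d) *
     (\<Prod>s = 1..d - 1. (real p ^ (2 * (k - s)) - 1) / (1 - real p powi (- int s)))"

definition kappa :: "nat \<Rightarrow> nat \<Rightarrow> nat \<Rightarrow> real" where
  "kappa p m d = (real p ^ (m - 2) - real p ^ (d - 1)) / (real p ^ d - 1) - 1"

end

theory Submission
  imports Defs
begin

text \<open>
  A coset \<open>M \<Lambda>\<^sup>m\<close> is the same as the lattice \<open>L = M \<int>\<^sup>m\<close>. If \<open>M\<close> lies in the double coset of \<open>D\<^sub>p(d)\<close> and
  \<open>q[M] \<equiv> 0\<close> modulo \<open>p\<^sup>2\<close>, then the image of \<open>L\<close> modulo \<open>p\<close> is a totally isotropic subspace \<open>X\<close> of dimension \<open>d\<close>,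
  and \<open>L\<close> consists of the \<open>y\<close> with \<open>y mod p \<in> X\<close> and \<open>B(y, x\<^sub>i) \<equiv> 0\<close> modulo \<open>p\<^sup>2\<close>, for any lifts
  \<open>x\<^sub>1, \<dots>, x\<^sub>d \<in> L\<close> of a basis of \<open>X\<close>. Such a frame \<open>x\<^sub>1, \<dots>, x\<^sub>d\<close> is isotropic and pairwise orthogonal modulo \<open>p\<^sup>2\<close>,
  and every such frame arises. The lattices are therefore counted by dividing the number of frames, which are built
  one vector at a time, by the number of frames in a single lattice.

  The condition \<open>K \<in> L\<close> is treated as follows. A primitive \<open>K\<close> can be taken as a member of the frame. For
  \<open>K = p u\<close> the condition says that \<open>u\<close> is orthogonal to \<open>X\<close>; for anisotropic \<open>u\<close> this leads to the number of
  isotropic vectors orthogonal to \<open>u\<close>, and hence to the quadratic characters \<open>\<epsilon>\<^sub>p\<close> and \<open>\<chi>\<^sub>p\<close>, while for isotropic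
  \<open>u\<close> the cases \<open>u \<in> X\<close> and \<open>u \<notin> X\<close> are counted separately. For \<open>K\<close> divisible by \<open>p\<^sup>2\<close> there is no condition.
\<close>

section \<open>Integer vectors, spans and residues\<close>

text \<open>Counting frames as a product requires extension numbers that depend only on the length
  reached. The conditions modulo \<open>p^2\<close> cause no trouble: over an admissible residue
  modulo p they are independent affine equations for the second digit, isotropy included, because p
  is odd and the new vector lies outside the span of the earlier ones. The obstacle is the condition
  that X be orthogonal to an isotropic u: as u lies in its own complement, the number of extensions
  depends on whether u is already in the span. So frames avoiding u are counted directly, and the
  subspaces through u by double counting over the lifts of u, since u is known only modulo p while a
  frame member is needed modulo \<open>p^2\<close>. The constants arise as follows.
  \<open>alpha\<close> is the number of lattices through a primitive isotropic vector, where the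
  first step of the frame is prescribed. Restoring that step brings in the factor p^(d-1)/(p^d-1).
  Finally \<open>1 + kappa\<close> is the count for isotropic u, nonzero modulo p, divided by
  \<open>alpha\<close>.\<close>

text \<open>
  Only the entries with index below the dimension of a vector are relevant.
\<close>

type_synonym ivec = "nat \<Rightarrow> int"

definition axpy :: "ivec \<Rightarrow> int \<Rightarrow> ivec \<Rightarrow> ivec" where
  "axpy x t y = (\<lambda>i. x i + t * y i)"

lemma axpy_apply [simp]: "axpy x t y i = x i + t * y i"
  by (simp add: axpy_def)

lemma axpy_0 [simp]: "axpy x 0 y = x"
  by (simp add: axpy_def)

text \<open>A unit \<open>a\<close> makes \<open>t * a\<close> run once through the residues. Being
  a sum of indicators equal to 1, it can be inserted into any other sum, which is how later counts
  are split.\<close>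

lemma sum_of_bool_residue:
  fixes p a b :: int
  assumes "prime p" "\<not> p dvd a"
  shows "(\<Sum>t\<in>{0..<p}. of_bool (p dvd b - t * a) :: real) = 1"
proof -
  have p: "p > 0" using assms(1) prime_gt_0_int by blast
  obtain a' where a': "[a * a' = 1] (mod p)"
    using assms by (metis cong_solve_coprime_int coprime_commute prime_imp_coprime)
  define t0 where "t0 = (b * a') mod p"
  have t0: "t0 \<in> {0..<p}" using p by (simp add: t0_def)
  have "[t0 * a = b * (a * a')] (mod p)"
    unfolding t0_def cong_def by (metis mod_mult_left_eq mult.assoc mult.commute)
  also have "[b * (a * a') = b * 1] (mod p)"
    using a' cong_scalar_left by blast
  finally have d0: "p dvd b - t0 * a"
    by (metis cong_iff_dvd_diff cong_sym_eq mult.right_neutral)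
  have "p dvd b - t * a \<longleftrightarrow> t = t0" if t: "t \<in> {0..<p}" for t
  proof
    assume "p dvd b - t * a"
    then have "p dvd (b - t0 * a) - (b - t * a)" using d0 dvd_diff by blast
    then have "p dvd (t - t0) * a" by (simp add: algebra_simps)
    then have "p dvd t - t0" using assms prime_dvd_mult_iff by blast
    then have "[t = t0] (mod p)" by (simp add: cong_iff_dvd_diff)
    then show "t = t0" using t t0 by (simp add: cong_def)
  qed (use d0 in simp)
  then have "(\<Sum>t\<in>{0..<p}. of_bool (p dvd b - t * a) :: real) = (\<Sum>t\<in>{0..<p}. if t = t0 then 1 else 0)"
    by (intro sum.cong) auto
  also have "\<dots> = 1" using t0 by simp
  finally show ?thesis .
qed

locale quad_space =
  fixes m :: nat and p :: int and Q :: "nat \<Rightarrow> nat \<Rightarrow> int"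
  assumes prime_p: "prime p" and p_gt_2: "p > 2"
    and Q_sym: "Q i j = Q j i"
    and nondegenerate: "\<not> p dvd det (mat m m (\<lambda>(i, j). Q i j))"
begin

lemma p_pos: "p > 0" and p2_pos: "p^2 > 0" and p_nz: "p \<noteq> 0"
  using p_gt_2 by auto

abbreviation rp :: real where "rp \<equiv> real_of_int p"

text \<open>
  The values of the form enter only through \<open>B x x = 2 q(x)\<close>, which suffices since \<open>p\<close> is odd.
\<close>

abbreviation detQ :: int where "detQ \<equiv> det (mat m m (\<lambda>(i, j). Q i j))"

definition B :: "ivec \<Rightarrow> ivec \<Rightarrow> int" where
  "B x y = (\<Sum>i<m. \<Sum>j<m. Q i j * x i * y j)"

text \<open>For \<open>n = 0\<close> this is equality of the entries below \<open>m\<close>, which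
  serves as equality of vectors.\<close>

definition vcong :: "int \<Rightarrow> ivec \<Rightarrow> ivec \<Rightarrow> bool" where
  "vcong n x y \<longleftrightarrow> (\<forall>i<m. n dvd x i - y i)"

text \<open>
  Membership in the span modulo \<open>n\<close>; for \<open>n = 0\<close> this is the span over the integers.
\<close>

primrec spn :: "int \<Rightarrow> ivec list \<Rightarrow> ivec \<Rightarrow> bool" where
  "spn n [] x \<longleftrightarrow> (\<forall>i<m. n dvd x i)"
| "spn n (y # ys) x \<longleftrightarrow> (\<exists>c. spn n ys (axpy x (- c) y))"

text \<open>Independence over the field with p elements. The recursion follows the head, where
  frames grow, so an extension adds a single condition.\<close>

primrec indep :: "ivec list \<Rightarrow> bool" where
  "indep [] \<longleftrightarrow> True"
| "indep (y # ys) \<longleftrightarrow> indep ys \<and> \<not> spn p ys y"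

lemma B_sym: "B x y = B y x"
  unfolding B_def by (subst sum.swap) (auto intro!: sum.cong simp: Q_sym mult_ac)

lemma B_axpy_left [simp]: "B (axpy x t y) z = B x z + t * B y z"
  unfolding B_def by (simp add: algebra_simps sum.distrib sum_distrib_left)

lemma B_axpy_right [simp]: "B z (axpy x t y) = B z x + t * B z y"
  using B_axpy_left B_sym by metis

lemma B_zero [simp]: "B (\<lambda>_. 0) y = 0" "B y (\<lambda>_. 0) = 0"
  unfolding B_def by auto

lemma vcong_refl [simp]: "vcong n x x"
  by (simp add: vcong_def)

lemma vcong_sym: "vcong n x y \<Longrightarrow> vcong n y x"
  unfolding vcong_def by (metis dvd_minus_iff minus_diff_eq)

lemma vcong_trans [trans]: "vcong n x y \<Longrightarrow> vcong n y z \<Longrightarrow> vcong n x z"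
  unfolding vcong_def by (metis (no_types, opaque_lifting) diff_add_cancel dvd_add add_diff_eq)

lemma vcong_axpy: "vcong n x x' \<Longrightarrow> vcong n y y' \<Longrightarrow> vcong n (axpy x t y) (axpy x' t y')"
  unfolding vcong_def
proof (intro allI impI)
  fix i assume h: "\<forall>i<m. n dvd x i - x' i" "\<forall>i<m. n dvd y i - y' i" "i < m"
  have "axpy x t y i - axpy x' t y' i = (x i - x' i) + t * (y i - y' i)" by (simp add: algebra_simps)
  moreover have "n dvd (x i - x' i) + t * (y i - y' i)" using h by (intro dvd_add dvd_mult) auto
  ultimately show "n dvd axpy x t y i - axpy x' t y' i" by metis
qed

lemma vcong_p2: "vcong (p^2) x y \<Longrightarrow> vcong p x y"
  unfolding vcong_def by (meson dvd_power dvd_trans zero_less_numeral)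

lemma vcong_decomp:
  assumes "vcong n x y"
  obtains u where "vcong 0 x (axpy y n u)"
proof -
  have "\<forall>i. \<exists>c. i < m \<longrightarrow> x i - y i = n * c" using assms by (auto simp: vcong_def dvd_def)
  then obtain u where "\<And>i. i < m \<Longrightarrow> x i - y i = n * u i" by metis
  then have "vcong 0 x (axpy y n u)" by (simp add: vcong_def algebra_simps)
  then show ?thesis by (rule that)
qed

lemma B_vcong: assumes "vcong n x x'" shows "n dvd B x y - B x' y"
proof -
  have "B x y - B x' y = (\<Sum>i<m. \<Sum>j<m. Q i j * (x i - x' i) * y j)"
    unfolding B_def by (simp add: algebra_simps sum_subtractf)
  also have "n dvd \<dots>" using assms by (intro dvd_sum) (auto simp: vcong_def)
  finally show ?thesis .
qed

lemma dvd_diff_iff: "(n::int) dvd a - b \<Longrightarrow> n dvd a + c \<longleftrightarrow> n dvd b + c"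
  using dvd_add_right_iff[of n "a - b" "b + c"] by simp

lemma B_vcong_dvd: assumes "vcong n x x'" "vcong n y y'" shows "n dvd B x y + c \<longleftrightarrow> n dvd B x' y' + c"
proof -
  have "n dvd B x y - B x' y" "n dvd B x' y - B x' y'"
    using B_vcong[OF assms(1)] B_vcong[OF assms(2), of x'] by (simp_all only: B_sym[of x'])
  then have "n dvd (B x y - B x' y) + (B x' y - B x' y')" by (rule dvd_add)
  then have "n dvd B x y - B x' y'" by simp
  then show ?thesis by (rule dvd_diff_iff)
qed

lemma B_vcong_dvd0: "vcong n x x' \<Longrightarrow> vcong n y y' \<Longrightarrow> n dvd B x y \<longleftrightarrow> n dvd B x' y'"
  using B_vcong_dvd[of n x x' y y' 0] by simp

lemma B_vcong_dvd_diff: "vcong n x x' \<Longrightarrow> vcong n y y' \<Longrightarrow> n dvd B x y - c \<longleftrightarrow> n dvd B x' y' - c"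
  using B_vcong_dvd[of n x x' y y' "-c"] by simp

lemma spn_axpy: "spn n ys x \<Longrightarrow> spn n ys y \<Longrightarrow> spn n ys (axpy x t y)"
proof (induction ys arbitrary: x y)
  case (Cons z zs)
  obtain c where "spn n zs (axpy x (- c) z)" using Cons.prems(1) by auto
  moreover obtain c' where "spn n zs (axpy y (- c') z)" using Cons.prems(2) by auto
  ultimately have "spn n zs (axpy (axpy x (- c) z) t (axpy y (- c') z))" by (rule Cons.IH)
  also have "axpy (axpy x (- c) z) t (axpy y (- c') z) = axpy (axpy x t y) (- (c + t * c')) z"
    by (auto simp: axpy_def algebra_simps)
  finally show ?case unfolding spn.simps by (rule exI)
next
  case Nil
  then show ?case unfolding spn.simps axpy_apply by (intro allI impI dvd_add dvd_mult) blast+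
qed

lemma spn_vcong: "vcong n x y \<Longrightarrow> spn n ys x \<longleftrightarrow> spn n ys y"
proof (induction ys arbitrary: x y)
  case Nil
  then have "n dvd x i \<longleftrightarrow> n dvd y i" if "i < m" for i
    using that dvd_diff_iff[of n "x i" "y i" 0] by (simp add: vcong_def)
  then show ?case by simp
next
  case (Cons a ys)
  have "spn n ys (axpy x (- c) a) \<longleftrightarrow> spn n ys (axpy y (- c) a)" for c
    using Cons.IH[OF vcong_axpy[OF Cons.prems vcong_refl]] .
  then show ?case by simp
qed

lemma spn_zero [simp]: "spn n ys (\<lambda>_. 0)"
proof (induction ys)
  case (Cons a ys)
  then have "spn n ys (axpy (\<lambda>_. 0) (- 0) a)" by simp
  then show ?case unfolding spn.simps by (rule exI)
qed simp

lemma spn_scale: "spn n ys x \<Longrightarrow> spn n ys (\<lambda>i. t * x i)"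
  using spn_axpy[of n ys "\<lambda>_. 0" x t] by (simp add: axpy_def)

lemma spn_Cons_self: "spn n ys x \<Longrightarrow> spn n (y # ys) x"
  unfolding spn.simps by (rule exI[of _ 0]) simp

lemma spn_mem: "y \<in> set ys \<Longrightarrow> spn n ys y"
proof (induction ys)
  case (Cons a ys)
  show ?case
  proof (cases "y = a")
    case True
    have "axpy a (- 1) a = (\<lambda>_. 0)" by (simp add: axpy_def)
    then have "spn n ys (axpy a (- 1) a)" by simp
    then show ?thesis unfolding True spn.simps by (rule exI)
  next
    case False then show ?thesis using Cons spn_Cons_self by auto
  qed
qed simp

lemma spn_small: "\<forall>i<m. n dvd x i \<Longrightarrow> spn n ys x"
  using spn_vcong[of n x "\<lambda>_. 0" ys] by (simp add: vcong_def)

lemma spn_mono: "(\<And>z. z \<in> set zs \<Longrightarrow> spn n ys z) \<Longrightarrow> spn n zs x \<Longrightarrow> spn n ys x"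
proof (induction zs arbitrary: x)
  case Nil
  then show ?case using spn_small by simp
next
  case (Cons a zs)
  obtain c where "spn n zs (axpy x (- c) a)" using Cons.prems(2) by auto
  then have "spn n ys (axpy x (- c) a)" using Cons.IH[OF Cons.prems(1)] by simp
  then have "spn n ys (axpy (axpy x (- c) a) c a)" using Cons.prems(1) by (rule spn_axpy) simp
  moreover have "axpy (axpy x (- c) a) c a = x" by (simp add: axpy_def)
  ultimately show ?case by metis
qed

lemma spn_subset: "set zs \<subseteq> set ys \<Longrightarrow> spn n zs x \<Longrightarrow> spn n ys x"
  using spn_mono spn_mem by blast

lemma spn_perp:
  assumes "spn n ys x" "\<And>y. y \<in> set ys \<Longrightarrow> n dvd B w y"
  shows "n dvd B w x"
  using assms
proof (induction ys arbitrary: x)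
  case Nil
  then have "vcong n x (\<lambda>_. 0)" by (simp add: vcong_def)
  then show ?case using B_vcong_dvd0[of n w w x "\<lambda>_. 0"] by simp
next
  case (Cons a ys)
  obtain c where "spn n ys (axpy x (- c) a)" using Cons.prems(1) by auto
  then have "n dvd B w (axpy x (- c) a)" by (rule Cons.IH) (simp add: Cons.prems(2))
  then have "n dvd B w x - c * B w a" by simp
  moreover have "n dvd c * B w a" using Cons.prems by simp
  ultimately show ?case using dvd_diff_iff[of n "B w x" "c * B w a" 0] by simp
qed

text \<open>
  The canonical representatives of the vectors modulo \<open>n\<close>; \<open>per n\<close> singles out the functions
  that are well defined on classes modulo \<open>n\<close>.
\<close>

definition box :: "int \<Rightarrow> ivec set" where
  "box n = {x. (\<forall>i<m. 0 \<le> x i \<and> x i < n) \<and> (\<forall>i\<ge>m. x i = 0)}"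

definition red :: "int \<Rightarrow> ivec \<Rightarrow> nat \<Rightarrow> int" where
  "red n x = (\<lambda>i. if i < m then x i mod n else 0)"

definition per :: "int \<Rightarrow> (ivec \<Rightarrow> 'a) \<Rightarrow> bool" where
  "per n f \<longleftrightarrow> (\<forall>x y. vcong n x y \<longrightarrow> f x = f y)"

lemma perI: "(\<And>x y. vcong n x y \<Longrightarrow> f x = f y) \<Longrightarrow> per n f"
  by (simp add: per_def)

lemma perD: "per n f \<Longrightarrow> vcong n x y \<Longrightarrow> f x = f y"
  by (auto simp: per_def)

lemma box_bij: "bij_betw (\<lambda>f i. if i < m then f i else 0) ({..<m} \<rightarrow>\<^sub>E {0..<n}) (box n)"
proof (rule bij_betw_byWitness[where f' = "\<lambda>x. restrict x {..<m}"])
  show "\<forall>x\<in>box n. (\<lambda>i. if i < m then restrict x {..<m} i else 0) = x"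
    by (auto simp: box_def restrict_def)
  show "\<forall>f\<in>{..<m} \<rightarrow>\<^sub>E {0..<n}. restrict (\<lambda>i. if i < m then f i else 0) {..<m} = f"
    by (auto simp: PiE_def extensional_def restrict_def)
  show "(\<lambda>x. restrict x {..<m}) ` box n \<subseteq> {..<m} \<rightarrow>\<^sub>E {0..<n}"
    by (intro image_subsetI PiE_I) (auto simp: box_def)
qed (auto simp: box_def PiE_def Pi_def)

lemma finite_box [simp]: "finite (box n)"
  using bij_betw_finite[OF box_bij] by (simp add: finite_PiE)

lemma card_box: "n \<ge> 0 \<Longrightarrow> real (card (box n)) = real_of_int n ^ m"
  using bij_betw_same_card[OF box_bij, of n, symmetric] by (simp add: card_PiE)

lemma red_in_box: "n > 0 \<Longrightarrow> red n x \<in> box n"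
  by (simp add: red_def box_def)

lemma red_vcong: "vcong n (red n x) x"
  by (simp add: red_def vcong_def mod_eq_dvd_iff[symmetric])

lemma box_vcong_eq: assumes "x \<in> box n" "y \<in> box n" "vcong n x y" shows "x = y"
proof
  fix i show "x i = y i"
  proof (cases "i < m")
    case True
    then have "x i mod n = y i mod n" using assms by (simp add: vcong_def mod_eq_dvd_iff)
    then show ?thesis using assms True by (simp add: box_def)
  next
    case False then show ?thesis using assms by (simp add: box_def)
  qed
qed

lemma sum_box_shift:
  assumes n: "n > 0" and f: "per n f"
  shows "(\<Sum>x\<in>box n. f (axpy x t v) :: real) = (\<Sum>x\<in>box n. f x)"
proof (rule sum.reindex_bij_witness[where i = "\<lambda>x. red n (axpy x (- t) v)" and j = "\<lambda>x. red n (axpy x t v)"])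
  have inv_shift: "red n (axpy (red n (axpy x s v)) (- s) v) = x" if "x \<in> box n" for x s
  proof (rule box_vcong_eq[OF red_in_box[OF n] that])
    have "vcong n (red n (axpy (red n (axpy x s v)) (- s) v)) (axpy (red n (axpy x s v)) (- s) v)"
      by (rule red_vcong)
    also have "vcong n (axpy (red n (axpy x s v)) (- s) v) (axpy (axpy x s v) (- s) v)"
      by (intro vcong_axpy red_vcong) simp
    also have "axpy (axpy x s v) (- s) v = x" by (simp add: axpy_def)
    finally show "vcong n (red n (axpy (red n (axpy x s v)) (- s) v)) x" .
  qed
  show "red n (axpy (red n (axpy x t v)) (- t) v) = x" if "x \<in> box n" for x using inv_shift that .
  show "red n (axpy (red n (axpy x (- t) v)) t v) = x" if "x \<in> box n" for x using inv_shift[OF that, of "-t"] by simp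
  show "f (red n (axpy x t v)) = f (axpy x t v)" for x
    using f red_vcong by (rule perD)
qed (use n red_in_box in auto)

lemma per_sys: "per p (\<lambda>x. \<forall>z\<in>set ys. p dvd B x z - c z)"
  by (rule perI) (metis B_vcong_dvd_diff vcong_refl)

text \<open>
  Every vector orthogonal to \<open>ys\<close> can be moved along \<open>w\<close>, in exactly one way modulo \<open>p\<close>, into the
  hyperplane cut out by \<open>y\<close>.
\<close>

lemma sum_split:
  fixes f :: "ivec \<Rightarrow> real"
  assumes w: "\<And>z. z \<in> set ys \<Longrightarrow> p dvd B w z" and a: "\<not> p dvd B w y" and f: "per p f"
  shows "(\<Sum>x\<in>box p. of_bool (\<forall>z\<in>set ys. p dvd B x z - c z) * f x) =
    (\<Sum>t\<in>{0..<p}. \<Sum>x\<in>box p. of_bool (\<forall>z\<in>set (y # ys). p dvd B x z - c z) * f (axpy x t w))"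
proof -
  let ?F = "\<lambda>t x. of_bool (p dvd B x y - c y - t * B w y) * (of_bool (\<forall>z\<in>set ys. p dvd B x z - c z) * f x)"
  \<comment> \<open>The inserted factor 1 attaches to each \<open>x\<close> the unique
    \<open>t\<close> for which \<open>x - t w\<close> satisfies the condition for
    \<open>y\<close>.\<close>
  have "(\<Sum>x\<in>box p. of_bool (\<forall>z\<in>set ys. p dvd B x z - c z) * f x) = (\<Sum>x\<in>box p. \<Sum>t\<in>{0..<p}. ?F t x)"
    using sum_of_bool_residue[OF prime_p a]
    by (intro sum.cong refl) (simp flip: sum_distrib_right)
  also have "\<dots> = (\<Sum>t\<in>{0..<p}. \<Sum>x\<in>box p. ?F t x)" by (rule sum.swap)
  also have "\<dots> = (\<Sum>t\<in>{0..<p}. \<Sum>x\<in>box p. ?F t (axpy x t w))"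
  proof (rule sum.cong[OF refl], rule sum_box_shift[symmetric, OF p_pos])
    fix t
    show "per p (?F t)"
    proof (rule perI)
      fix x x' assume xx: "vcong p x x'"
      have "p dvd B x y - (c y + t * B w y) \<longleftrightarrow> p dvd B x' y - (c y + t * B w y)"
        using B_vcong_dvd_diff[OF xx vcong_refl] .
      moreover have "f x = f x'" using f xx by (rule perD)
      moreover have "(\<forall>z\<in>set ys. p dvd B x z - c z) \<longleftrightarrow> (\<forall>z\<in>set ys. p dvd B x' z - c z)"
        using perD[OF per_sys xx] .
      ultimately show "?F t x = ?F t x'" by (simp add: algebra_simps)
    qed
  qed
  also have "\<dots> = (\<Sum>t\<in>{0..<p}. \<Sum>x\<in>box p. of_bool (\<forall>z\<in>set (y # ys). p dvd B x z - c z) * f (axpy x t w))"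
  proof (intro sum.cong refl)
    fix t x
    have "p dvd B x z + t * B w z - c z \<longleftrightarrow> p dvd B x z - c z" if "z \<in> set ys" for z
    proof -
      have "p dvd t * B w z" using w that by simp
      moreover have "B x z + t * B w z - c z = (B x z - c z) + t * B w z" by simp
      ultimately show ?thesis by (metis dvd_add_left_iff)
    qed
    then show "?F t (axpy x t w) = of_bool (\<forall>z\<in>set (y # ys). p dvd B x z - c z) * f (axpy x t w)"
      by (simp add: of_bool_def)
  qed
  finally show ?thesis .
qed

lemma inverse_mod_p: assumes "\<not> p dvd a" obtains a' where "p dvd a * a' - 1"
  using assms prime_p that by (metis cong_iff_dvd_diff cong_solve_coprime_int coprime_commute prime_imp_coprime)

lemma dvd_mult_p: "p dvd a * b \<longleftrightarrow> p dvd a \<or> p dvd b"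
  using prime_p by (simp add: prime_dvd_mult_iff)

text \<open>If every \<open>B w x\<close> were divisible by p, so would be the entries of
  \<open>Q x\<close>, and the adjugate turns this into p dividing \<open>det Q\<close> times each
  entry of \<open>x\<close>.\<close>

lemma dual_vector_Nil:
  assumes "\<not> (\<forall>i<m. p dvd x i)"
  shows "\<exists>w. \<not> p dvd B w x"
proof (rule ccontr)
  assume "\<not> ?thesis"
  then have h: "p dvd B w x" for w by auto
  let ?Q = "mat m m (\<lambda>(i, j). Q i j)" and ?x = "vec m x"
  have Qc: "?Q \<in> carrier_mat m m" by simp
  have 1: "p dvd (?Q *\<^sub>v ?x) $ i" if i: "i < m" for i
  proof -
    have "B (\<lambda>j. if j = i then 1 else 0) x = (\<Sum>j<m. if j = i then (\<Sum>l<m. Q j l * x l) else 0)"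
      unfolding B_def by (intro sum.cong) auto
    also have "\<dots> = (\<Sum>l<m. Q i l * x l)" using i by simp
    also have "\<dots> = (?Q *\<^sub>v ?x) $ i" using i by (simp add: scalar_prod_def atLeast0LessThan)
    finally show ?thesis using h by metis
  qed
  have "(adj_mat ?Q * ?Q) *\<^sub>v ?x = adj_mat ?Q *\<^sub>v (?Q *\<^sub>v ?x)"
    using adj_mat(1)[OF Qc] Qc by (intro assoc_mult_mat_vec) auto
  moreover have "(adj_mat ?Q * ?Q) *\<^sub>v ?x = det ?Q \<cdot>\<^sub>v ?x"
    unfolding adj_mat(3)[OF Qc]
  proof (intro eq_vecI)
    fix i assume "i < dim_vec (det ?Q \<cdot>\<^sub>v ?x)"
    then have i: "i < m" by simp
    have "((det ?Q \<cdot>\<^sub>m 1\<^sub>m m) *\<^sub>v ?x) $ i = (\<Sum>l<m. if l = i then det ?Q * x i else 0)"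
    proof -
      have "((det ?Q \<cdot>\<^sub>m 1\<^sub>m m) *\<^sub>v ?x) $ i = (\<Sum>l<m. det ?Q * (if l = i then 1 else 0) * x l)"
        using i by (simp add: scalar_prod_def atLeast0LessThan)
      also have "\<dots> = (\<Sum>l<m. if l = i then det ?Q * x i else 0)" by (intro sum.cong) auto
      finally show ?thesis .
    qed
    then show "((det ?Q \<cdot>\<^sub>m 1\<^sub>m m) *\<^sub>v ?x) $ i = (det ?Q \<cdot>\<^sub>v ?x) $ i" using i by simp
  qed simp
  ultimately have e: "det ?Q \<cdot>\<^sub>v ?x = adj_mat ?Q *\<^sub>v (?Q *\<^sub>v ?x)" by simp
  have "p dvd x i" if i: "i < m" for i
  proof -
    have "det ?Q * x i = (adj_mat ?Q *\<^sub>v (?Q *\<^sub>v ?x)) $ i" using arg_cong[OF e, of "\<lambda>v. v $ i"] i by simp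
    also have "\<dots> = (\<Sum>l<m. adj_mat ?Q $$ (i, l) * (?Q *\<^sub>v ?x) $ l)"
      using i adj_mat(1)[OF Qc] by (auto simp: scalar_prod_def atLeast0LessThan)
    also have "p dvd \<dots>" using 1 by (intro dvd_sum) auto
    finally have "p dvd det ?Q \<or> p dvd x i" by (simp only: dvd_mult_p)
    then show ?thesis using nondegenerate by simp
  qed
  then show False using assms by blast
qed

text \<open>Gaussian elimination: a vector \<open>w1\<close> dual to \<open>y\<close> corrects both
  \<open>x\<close> and the vector \<open>w2\<close> obtained for the shorter list.\<close>

lemma dual_vector:
  assumes "indep ys" "\<not> spn p ys x"
  shows "\<exists>w. (\<forall>y\<in>set ys. p dvd B w y) \<and> \<not> p dvd B w x"
  using assms
proof (induction ys arbitrary: x)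
  case Nil
  then show ?case using dual_vector_Nil by simp
next
  case (Cons y ys)
  obtain w1 where w1: "\<forall>z\<in>set ys. p dvd B w1 z" "\<not> p dvd B w1 y"
    using Cons.IH[of y] Cons.prems by auto
  obtain r where r: "p dvd B w1 y * r - 1" using inverse_mod_p[OF w1(2)] .
  \<comment> \<open>\<open>x'\<close> is \<open>x\<close> modified along \<open>y\<close> so that
    \<open>w1\<close> annihilates it modulo p; multiples of \<open>w1\<close> can then be added to
    \<open>w2\<close> without changing its value at \<open>x'\<close> modulo p.\<close>
  define x' where "x' = axpy x (- (r * B w1 x)) y"
  have "\<not> spn p ys x'" using Cons.prems(2) unfolding x'_def by auto
  then obtain w2 where w2: "\<forall>z\<in>set ys. p dvd B w2 z" "\<not> p dvd B w2 x'"
    using Cons.IH[of x'] Cons.prems(1) by auto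
  define w where "w = axpy w2 (- (r * B w2 y)) w1"
  have "B w y = - (B w2 y * (B w1 y * r - 1))" unfolding w_def by (simp add: algebra_simps)
  then have wy: "p dvd B w y" using r by simp
  have "B w1 x' = - (B w1 x * (B w1 y * r - 1))" unfolding x'_def by (simp add: algebra_simps)
  then have "p dvd B w1 x'" using r by simp
  then have "\<not> p dvd B w x'" using w2(2) unfolding w_def
    by (metis B_axpy_left dvd_add_left_iff dvd_mult)
  moreover have "B w x' = B w x - (r * B w1 x) * B w y" unfolding x'_def by simp
  ultimately have "\<not> p dvd B w x" using wy by (metis dvd_diff dvd_mult)
  moreover have "p dvd B w z" if "z \<in> set ys" for z unfolding w_def using w1 w2 that by simp
  ultimately show ?case using wy by auto
qed

lemma not_p_dvd_1: "\<not> p dvd 1"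
  using p_gt_2 zdvd_imp_le by fastforce

section \<open>Counting solutions modulo a prime\<close>

abbreviation perp :: "int \<Rightarrow> ivec list \<Rightarrow> ivec \<Rightarrow> bool" where
  "perp n ys x \<equiv> \<forall>z\<in>set ys. n dvd B x z"

lemma zero_in_box: "n > 0 \<Longrightarrow> (\<lambda>_. 0) \<in> box n"
  by (simp add: box_def)

text \<open>A vector dual to \<open>y\<close> splits the solutions for \<open>ys\<close> into p
  translates of the solutions for \<open>y # ys\<close>, whatever the right-hand sides, so each
  independent equation divides the number by p.\<close>

lemma card_sys:
  assumes "indep ys"
  shows "(\<Sum>x\<in>box p. of_bool (\<forall>z\<in>set ys. p dvd B x z - c z) :: real) = rp ^ m / rp ^ length ys"
  using assms
proof (induction ys)
  case Nil
  then show ?case using card_box[of p] p_pos by simp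
next
  case (Cons y ys)
  let ?S = "\<lambda>ys. \<Sum>x\<in>box p. of_bool (\<forall>z\<in>set ys. p dvd B x z - c z) :: real"
  obtain w where w: "\<And>z. z \<in> set ys \<Longrightarrow> p dvd B w z" "\<not> p dvd B w y"
    using dual_vector[of ys y] Cons.prems by auto
  have "?S ys = (\<Sum>t\<in>{0..<p}. ?S (y # ys))"
    using sum_split[OF w, where f = "\<lambda>_. 1" and c = c] by (simp add: perI)
  also have "\<dots> = rp * ?S (y # ys)" using p_pos by simp
  finally show ?case using Cons p_pos by (simp add: field_simps)
qed

lemma spn_smult_cancel:
  assumes "spn p ys (\<lambda>i. t * y i)" "\<not> p dvd t"
  shows "spn p ys y"
proof -
  obtain t' where t': "p dvd t * t' - 1" using inverse_mod_p[OF assms(2)] .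
  have "vcong p (\<lambda>i. t' * (t * y i)) y"
    unfolding vcong_def
  proof (intro allI impI)
    fix i
    have "t' * (t * y i) - y i = (t * t' - 1) * y i" by (simp add: algebra_simps)
    then show "p dvd t' * (t * y i) - y i" using t' by simp
  qed
  then show ?thesis using spn_scale[OF assms(1), of t'] spn_vcong by blast
qed

text \<open>For \<open>y\<close> outside the span of \<open>ys\<close> the coefficient of
  \<open>y\<close> is unique modulo p, so each new vector multiplies the size by p.\<close>

lemma card_spn:
  assumes "indep ys"
  shows "(\<Sum>x\<in>box p. of_bool (spn p ys x) :: real) = rp ^ length ys"
  using assms
proof (induction ys)
  case Nil
  have "of_bool (spn p [] x) = (if x = (\<lambda>_. 0) then 1 else (0::real))" if "x \<in> box p" for x
  proof -
    have "spn p [] x \<longleftrightarrow> vcong p x (\<lambda>_. 0)" by (simp add: vcong_def)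
    also have "\<dots> \<longleftrightarrow> x = (\<lambda>_. 0)"
      using box_vcong_eq[OF that, of "\<lambda>_. 0"] p_pos by (auto simp: box_def)
    finally show ?thesis by simp
  qed
  then have "(\<Sum>x\<in>box p. of_bool (spn p [] x) :: real) = (\<Sum>x\<in>box p. if x = (\<lambda>_. 0) then 1 else 0)"
    by (rule sum.cong[OF refl])
  also have "\<dots> = 1" using zero_in_box[OF p_pos] by simp
  finally show ?case by simp
next
  case (Cons y ys)
  have "of_bool (spn p (y # ys) x) = (\<Sum>c\<in>{0..<p}. of_bool (spn p ys (axpy x (- c) y)) :: real)" for x
  proof (cases "spn p (y # ys) x")
    case True
    then obtain c0 where c0: "spn p ys (axpy x (- c0) y)" by auto
    have "spn p ys (axpy x (- c) y) \<longleftrightarrow> p dvd c0 - c * 1" for c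
    proof
      assume "spn p ys (axpy x (- c) y)"
      from spn_axpy[OF this c0, of "-1"] have "spn p ys (\<lambda>i. (c0 - c) * y i)"
        by (simp add: axpy_def algebra_simps)
      then show "p dvd c0 - c * 1" using spn_smult_cancel Cons.prems by auto
    next
      assume "p dvd c0 - c * 1"
      then have "vcong p (axpy x (- c) y) (axpy x (- c0) y)"
        unfolding vcong_def by (auto simp flip: left_diff_distrib)
      then show "spn p ys (axpy x (- c) y)" using c0 spn_vcong by blast
    qed
    then have "(\<Sum>c\<in>{0..<p}. of_bool (spn p ys (axpy x (- c) y)) :: real) = (\<Sum>c\<in>{0..<p}. of_bool (p dvd c0 - c * 1))"
      by simp
    also have "\<dots> = 1" by (rule sum_of_bool_residue[OF prime_p not_p_dvd_1])
    finally show ?thesis using True by simp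
  qed auto
  then have "(\<Sum>x\<in>box p. of_bool (spn p (y # ys) x) :: real) =
      (\<Sum>x\<in>box p. \<Sum>c\<in>{0..<p}. of_bool (spn p ys (axpy x (- c) y)))" by simp
  also have "\<dots> = (\<Sum>c\<in>{0..<p}. \<Sum>x\<in>box p. of_bool (spn p ys (axpy x (- c) y)))" by (rule sum.swap)
  also have "\<dots> = (\<Sum>c\<in>{0..<p}. \<Sum>x\<in>box p. of_bool (spn p ys x))"
    by (intro sum.cong refl sum_box_shift[OF p_pos]) (auto intro!: perI simp: spn_vcong)
  also have "\<dots> = rp ^ length (y # ys)" using Cons p_pos by simp
  finally show ?case .
qed

definition cone_count :: "ivec list \<Rightarrow> real" where
  "cone_count ys = (\<Sum>x\<in>box p. of_bool (perp p ys x) * of_bool (p dvd B x x))"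

lemma card_perp:
  assumes "indep ys"
  shows "(\<Sum>x\<in>box p. of_bool (perp p ys x) :: real) = rp ^ m / rp ^ length ys"
  using card_sys[OF assms, of "\<lambda>_. 0"] by simp

lemma per_perp: "per n (\<lambda>x. perp n ys x)"
  by (rule perI) (metis B_vcong_dvd0 vcong_refl)

lemma p_dvd_2: "p dvd 2 * a \<longleftrightarrow> p dvd a"
proof -
  have "\<not> p dvd 2" using p_gt_2 zdvd_imp_le[of p 2] by auto
  then show ?thesis by (simp add: dvd_mult_p)
qed

text \<open>
  Translation by \<open>t y\<close> changes \<open>B x x\<close> by \<open>2 t B x y\<close>: summing over \<open>t\<close>, a vector \<open>x\<close> that is not
  orthogonal to \<open>y\<close> becomes isotropic exactly once.
\<close>

lemma cone_count_Cons:
  assumes ind: "indep (y # ys)" and yy: "p dvd B y y" and yz: "\<And>z. z \<in> set ys \<Longrightarrow> p dvd B y z"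
  shows "cone_count (y # ys) = cone_count ys -
    (rp ^ m / rp ^ length ys - rp ^ m / rp ^ Suc (length ys)) / rp"
proof -
  let ?P = "\<lambda>x. perp p ys x"
  let ?f = "\<lambda>x. of_bool (?P x) * of_bool (p dvd B x x) :: real"
  have per: "per p ?f"
  proof (rule perI)
    fix x x' assume "vcong p x x'"
    then show "?f x = ?f x'" using perD[OF per_perp] B_vcong_dvd0 by simp
  qed
  have inner: "(\<Sum>t\<in>{0..<p}. ?f (axpy x t y)) =
      rp * (of_bool (perp p (y # ys) x) * of_bool (p dvd B x x)) +
      (of_bool (?P x) - of_bool (perp p (y # ys) x))" for x
  proof -
    have 1: "?P (axpy x t y) \<longleftrightarrow> ?P x" for t
    proof -
      have "p dvd B x z + t * B y z \<longleftrightarrow> p dvd B x z" if "z \<in> set ys" for z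
        using yz[OF that] by (intro dvd_add_left_iff) simp
      then show ?thesis by simp
    qed
    have 2: "p dvd B (axpy x t y) (axpy x t y) \<longleftrightarrow> p dvd B x x - t * (- 2 * B x y)" for t
    proof -
      have "B (axpy x t y) (axpy x t y) = (B x x - t * (- 2 * B x y)) + t * t * B y y"
        by (simp add: algebra_simps B_sym[of y x])
      then show ?thesis using yy by (metis dvd_add_left_iff dvd_mult)
    qed
    have "(\<Sum>t\<in>{0..<p}. ?f (axpy x t y)) = (\<Sum>t\<in>{0..<p}. of_bool (?P x) * of_bool (p dvd B x x - t * (- 2 * B x y)))"
      unfolding 1 2 ..
    also have "\<dots> = of_bool (?P x) * (\<Sum>t\<in>{0..<p}. of_bool (p dvd B x x - t * (- 2 * B x y)))"
      by (simp add: sum_distrib_left)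
    also have "(\<Sum>t\<in>{0..<p}. of_bool (p dvd B x x - t * (- 2 * B x y)) :: real) =
        (if p dvd B x y then rp * of_bool (p dvd B x x) else 1)"
    proof (cases "p dvd B x y")
      case True
      then have "p dvd t * (- 2 * B x y)" for t by simp
      then have "p dvd B x x - t * (- 2 * B x y) \<longleftrightarrow> p dvd B x x" for t
        by (metis add_diff_cancel_right' diff_add_cancel dvd_add_left_iff)
      then show ?thesis using True p_pos by simp
    next
      case False
      then have "\<not> p dvd - 2 * B x y" using p_dvd_2[of "B x y"] by simp
      from sum_of_bool_residue[OF prime_p this] show ?thesis using False by metis
    qed
    also have "of_bool (?P x) * (if p dvd B x y then rp * of_bool (p dvd B x x) else 1) =
        rp * (of_bool (perp p (y # ys) x) * of_bool (p dvd B x x)) +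
        (of_bool (?P x) - of_bool (perp p (y # ys) x))"
      by auto
    finally show ?thesis .
  qed
  have "rp * cone_count ys = (\<Sum>t\<in>{0..<p}. \<Sum>x\<in>box p. ?f x)"
    using p_pos by (simp add: cone_count_def)
  also have "\<dots> = (\<Sum>t\<in>{0..<p}. \<Sum>x\<in>box p. ?f (axpy x t y))"
    by (intro sum.cong refl sum_box_shift[symmetric] p_pos per)
  also have "\<dots> = (\<Sum>x\<in>box p. \<Sum>t\<in>{0..<p}. ?f (axpy x t y))" by (rule sum.swap)
  also have "\<dots> = rp * cone_count (y # ys) +
      ((\<Sum>x\<in>box p. of_bool (?P x)) - (\<Sum>x\<in>box p. of_bool (perp p (y # ys) x)))"
    unfolding inner cone_count_def sum.distrib sum_subtractf sum_distrib_left ..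
  also have "(\<Sum>x\<in>box p. of_bool (?P x) :: real) = rp ^ m / rp ^ length ys"
    using card_perp ind by simp
  also have "(\<Sum>x\<in>box p. of_bool (perp p (y # ys) x) :: real) = rp ^ m / rp ^ Suc (length ys)"
    using card_perp[OF ind] by simp
  finally show ?thesis using p_pos by (simp add: field_simps)
qed

section \<open>Legendre symbols and their sums\<close>

abbreviation leg :: "int \<Rightarrow> real" where "leg a \<equiv> real_of_int (Legendre a p)"

lemma leg_cong: "p dvd a - b \<Longrightarrow> leg a = leg b"
proof -
  assume "p dvd a - b"
  then have c: "[a = b] (mod p)" by (simp add: cong_iff_dvd_diff)
  then have "QuadRes p a = QuadRes p b" "[a = 0] (mod p) = [b = 0] (mod p)"
    unfolding QuadRes_def by (metis cong_trans cong_sym)+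
  then show ?thesis by (simp add: Legendre_def)
qed

lemma leg_0: "p dvd a \<Longrightarrow> leg a = 0"
  by (simp add: Legendre_def cong_0_iff)

lemma leg_euler: "[Legendre a p = a ^ ((nat p - 1) div 2)] (mod p)"
  using euler_criterion[of "nat p" a] prime_p p_gt_2 by (simp add: prime_nat_iff_prime)

text \<open>Euler's criterion gives the congruence; both sides lie in {-1, 0, 1}, so they differ by
  at most 2, which is less than p.\<close>

lemma leg_mult: "leg (a * b) = leg a * leg b"
proof -
  have "[Legendre (a * b) p = Legendre a p * Legendre b p] (mod p)"
    using leg_euler[of "a * b"] cong_mult[OF leg_euler[of a] leg_euler[of b]]
    by (metis cong_sym cong_trans power_mult_distrib)
  then have "p dvd Legendre (a * b) p - Legendre a p * Legendre b p" by (simp add: cong_iff_dvd_diff)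
  moreover have "\<bar>Legendre (a * b) p - Legendre a p * Legendre b p\<bar> < p"
    using p_gt_2 unfolding Legendre_def by auto
  ultimately have "Legendre (a * b) p - Legendre a p * Legendre b p = 0" using zdvd_imp_le[of p "\<bar>Legendre (a * b) p - Legendre a p * Legendre b p\<bar>"] by auto
  then show ?thesis by (simp flip: of_int_mult)
qed

lemma leg_square: "\<not> p dvd a \<Longrightarrow> leg (a * a) = 1"
proof -
  assume "\<not> p dvd a"
  moreover have "QuadRes p (a * a)" unfolding QuadRes_def power2_eq_square using cong_refl by blast
  ultimately show ?thesis by (simp add: Legendre_def cong_0_iff dvd_mult_p)
qed

text \<open>Multiplying by \<open>a\<close> turns the equation into \<open>(t * a)^2\<close>
  congruent to \<open>a * c\<close>: no root for a nonresidue, one for 0, and two distinct roots for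
  a nonzero square since p is odd.\<close>

lemma square_count:
  assumes a: "\<not> p dvd a"
  shows "(\<Sum>t\<in>{0..<p}. of_bool (p dvd c - t^2 * a) :: real) = 1 + leg (a * c)"
proof -
  have e: "p dvd c - t^2 * a \<longleftrightarrow> p dvd a * c - (t * a)^2" for t
  proof -
    have "a * c - (t * a)^2 = a * (c - t^2 * a)" by (simp add: algebra_simps power2_eq_square)
    then show ?thesis using a dvd_mult_p by simp
  qed
  show ?thesis
  proof (cases "\<exists>y. p dvd a * c - y^2")
    case False
    then have "\<not> p dvd a * c" by (metis diff_zero zero_power2)
    moreover have "\<not> QuadRes p (a * c)"
      using False by (metis QuadRes_def cong_iff_dvd_diff cong_sym)
    ultimately have "leg (a * c) = -1" by (simp add: Legendre_def cong_0_iff)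
    moreover have "\<not> p dvd c - t^2 * a" for t using e False by blast
    ultimately show ?thesis by simp
  next
    case True
    then obtain y where y: "p dvd a * c - y^2" by blast
    have e2: "p dvd c - t^2 * a \<longleftrightarrow> p dvd y - t * a \<or> p dvd - y - t * a" for t
    proof -
      have "p dvd a * c - (t * a)^2 \<longleftrightarrow> p dvd y^2 - (t * a)^2"
        using dvd_diff_iff[OF y, of "- ((t * a)^2)"] by simp
      also have "y^2 - (t * a)^2 = - ((y - t * a) * (- y - t * a))" by (simp add: algebra_simps power2_eq_square)
      finally show ?thesis unfolding e by (simp add: dvd_mult_p)
    qed
    show ?thesis
    proof (cases "p dvd y")
      case True
      then have "p dvd y^2" by (simp add: power2_eq_square)
      then have ac: "p dvd a * c" using y by (metis diff_add_cancel dvd_add)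
      have "p dvd c - t^2 * a \<longleftrightarrow> p dvd 0 - t * a" for t
        unfolding e2 using dvd_diff_iff[of p y 0 "- t * a"] dvd_diff_iff[of p "-y" 0 "- t * a"] True by simp
      with sum_of_bool_residue[OF prime_p a, of 0] leg_0[OF ac] show ?thesis by simp
    next
      case False
      have ex: "\<not> (p dvd y - t * a \<and> p dvd - y - t * a)" for t
      proof
        assume "p dvd y - t * a \<and> p dvd - y - t * a"
        then have "p dvd (y - t * a) - (- y - t * a)" by (elim conjE) (rule dvd_diff)
        then show False using False p_dvd_2[of y] by simp
      qed
      have "(\<Sum>t\<in>{0..<p}. of_bool (p dvd c - t^2 * a) :: real) =
          (\<Sum>t\<in>{0..<p}. of_bool (p dvd y - t * a) + of_bool (p dvd - y - t * a))"
        unfolding e2 using ex by (intro sum.cong) (auto simp: of_bool_def)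
      also have "\<dots> = 2" using sum_of_bool_residue[OF prime_p a] by (simp add: sum.distrib)
      also have "leg (a * c) = 1"
        using leg_cong[OF y] leg_square[OF False] by (simp add: power2_eq_square)
      then have "(2::real) = 1 + leg (a * c)" by simp
      finally show ?thesis .
    qed
  qed
qed

lemma sum_residue_affine:
  fixes g :: "int \<Rightarrow> real"
  assumes a: "\<not> p dvd a" and g: "\<And>x y. p dvd x - y \<Longrightarrow> g x = g y"
  shows "(\<Sum>s\<in>{0..<p}. g (a * s + b)) = (\<Sum>s\<in>{0..<p}. g s)"
proof -
  have "(\<Sum>s\<in>{0..<p}. g (a * s + b)) = (\<Sum>s\<in>{0..<p}. \<Sum>u\<in>{0..<p}. of_bool (p dvd (a * s + b) - u * 1) * g u)"
  proof (rule sum.cong[OF refl])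
    fix s
    have "(\<Sum>u\<in>{0..<p}. of_bool (p dvd (a * s + b) - u * 1) * g u) =
       (\<Sum>u\<in>{0..<p}. of_bool (p dvd (a * s + b) - u * 1) * g (a * s + b))"
      using g[of "a * s + b"] by (intro sum.cong) auto
    also have "\<dots> = g (a * s + b)"
      using sum_of_bool_residue[OF prime_p not_p_dvd_1] by (simp flip: sum_distrib_right)
    finally show "g (a * s + b) = (\<Sum>u\<in>{0..<p}. of_bool (p dvd (a * s + b) - u * 1) * g u)" by simp
  qed
  also have "\<dots> = (\<Sum>u\<in>{0..<p}. \<Sum>s\<in>{0..<p}. of_bool (p dvd (a * s + b) - u * 1) * g u)" by (rule sum.swap)
  also have "\<dots> = (\<Sum>u\<in>{0..<p}. g u)"
  proof (rule sum.cong[OF refl])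
    fix u
    have "p dvd (a * s + b) - u * 1 \<longleftrightarrow> p dvd (u - b) - s * a" for s
      using dvd_minus_iff[of p "(u - b) - s * a"] by (simp add: algebra_simps)
    then show "(\<Sum>s\<in>{0..<p}. of_bool (p dvd (a * s + b) - u * 1) * g u) = g u"
      using sum_of_bool_residue[OF prime_p a, of "u - b"] by (simp flip: sum_distrib_right)
  qed
  finally show ?thesis .
qed

text \<open>\<open>1 + leg s\<close> is the number of square roots of \<open>s\<close>, and every
  \<open>t\<close> is a root of exactly one residue.\<close>

lemma leg_sum: "(\<Sum>s\<in>{0..<p}. leg s) = 0"
proof -
  have "(\<Sum>s\<in>{0..<p}. 1 + leg s) = (\<Sum>s\<in>{0..<p}. \<Sum>t\<in>{0..<p}. of_bool (p dvd s - t^2 * 1))"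
    using square_count[OF not_p_dvd_1] by simp
  also have "\<dots> = (\<Sum>t\<in>{0..<p}. \<Sum>s\<in>{0..<p}. of_bool (p dvd s - t^2 * 1))" by (rule sum.swap)
  also have "\<dots> = (\<Sum>t\<in>{0..<p}. \<Sum>s\<in>{0..<p}. of_bool (p dvd t^2 - s * 1))"
  proof (intro sum.cong refl)
    fix s t
    show "of_bool (p dvd s - t^2 * 1) = (of_bool (p dvd t^2 - s * 1) :: real)"
      using dvd_minus_iff[of p "t^2 - s"] by (simp only: minus_diff_eq mult_1_right)
  qed
  also have "\<dots> = rp" using sum_of_bool_residue[OF prime_p not_p_dvd_1] p_pos by simp
  finally show ?thesis using p_pos by (simp add: sum.distrib)
qed

lemma leg_sum_affine: "\<not> p dvd a \<Longrightarrow> (\<Sum>s\<in>{0..<p}. leg (a * s + b)) = 0"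
  using sum_residue_affine[of a leg b] leg_cong leg_sum by simp

lemma sum_leg_square: "(\<Sum>s\<in>{0..<p}. leg (s * s)) = rp - 1"
proof -
  have "leg (s * s) = (if s = 0 then 0 else 1)" if "s \<in> {0..<p}" for s
    using that leg_square[of s] leg_0[of 0] zdvd_not_zless[of s p] by auto
  then have "(\<Sum>s\<in>{0..<p}. leg (s * s)) = (\<Sum>s\<in>{0..<p}. 1 - (if s = 0 then 1 else 0))"
    by (intro sum.cong) auto
  also have "\<dots> = rp - 1" using p_pos by (simp add: sum_subtractf)
  finally show ?thesis .
qed

text \<open>
  Scaling \<open>s\<close> shows that the sum is the same for all \<open>c\<close> prime to \<open>p\<close>, and its total over all \<open>c\<close>
  vanishes; hence its value at \<open>c = 0\<close> determines it.
\<close>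

lemma leg_sum_product:
  "(\<Sum>s\<in>{0..<p}. leg (s * (c - s))) = leg (- 1) * (rp * of_bool (p dvd c) - 1)"
proof -
  define T where "T c = (\<Sum>s\<in>{0..<p}. leg (s * (c - s)))" for c
  have T_cong: "T c = T c'" if "p dvd c - c'" for c c'
    unfolding T_def
  proof (intro sum.cong refl leg_cong)
    fix s
    have "s * (c - s) - s * (c' - s) = s * (c - c')" by (simp add: algebra_simps)
    then show "p dvd s * (c - s) - s * (c' - s)" using that by simp
  qed
  have T0: "T 0 = leg (- 1) * (rp - 1)"
  proof -
    have "T 0 = (\<Sum>s\<in>{0..<p}. leg (- 1) * leg (s * s))"
      unfolding T_def by (simp flip: leg_mult)
    then show ?thesis using sum_leg_square by (simp flip: sum_distrib_left)
  qed
  have T1: "T c = T 1" if c: "\<not> p dvd c" for c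
  proof -
    have "T c = (\<Sum>s\<in>{0..<p}. leg ((c * s + 0) * (c - (c * s + 0))))"
      unfolding T_def
    proof (rule sum_residue_affine[OF c, symmetric])
      fix x y assume d: "p dvd x - y"
      have "x * (c - x) - y * (c - y) = (x - y) * (c - x - y)" by (simp add: algebra_simps)
      then show "leg (x * (c - x)) = leg (y * (c - y))" using d by (intro leg_cong) simp
    qed
    also have "\<dots> = (\<Sum>s\<in>{0..<p}. leg (c * c) * leg (s * (1 - s)))"
      unfolding leg_mult[symmetric] by (intro sum.cong refl arg_cong[where f = leg]) (simp add: algebra_simps)
    finally show ?thesis using leg_square[OF c] by (simp add: T_def)
  qed
  have "(\<Sum>c\<in>{0..<p}. T c) = (\<Sum>s\<in>{0..<p}. \<Sum>c\<in>{0..<p}. leg (s * (c - s)))"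
    unfolding T_def by (rule sum.swap)
  also have "\<dots> = (\<Sum>s\<in>{0..<p}. leg s * (\<Sum>c\<in>{0..<p}. leg (1 * c + - s)))"
    by (simp add: leg_mult sum_distrib_left)
  also have "\<dots> = 0" unfolding leg_sum_affine[OF not_p_dvd_1] by simp
  finally have "(\<Sum>c\<in>{0..<p}. T c) = 0" .
  moreover have "T c = (if c = 0 then T 0 - T 1 else 0) + T 1" if "c \<in> {0..<p}" for c
    using that T1[of c] zdvd_not_zless[of c p] by auto
  then have "(\<Sum>c\<in>{0..<p}. T c) = (\<Sum>c\<in>{0..<p}. (if c = 0 then T 0 - T 1 else 0) + T 1)"
    by (rule sum.cong[OF refl])
  then have "(\<Sum>c\<in>{0..<p}. T c) = (T 0 - T 1) + rp * T 1"
    using p_pos by (simp add: sum.distrib)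
  ultimately have "(rp - 1) * T 1 = (rp - 1) * (- leg (- 1))"
    using T0 by (simp add: algebra_simps)
  moreover have "rp - 1 \<noteq> 0" using p_gt_2 by simp
  ultimately have "T 1 = - leg (- 1)" using mult_left_cancel by blast
  then have "T c = leg (- 1) * (rp * of_bool (p dvd c) - 1)"
    using T0 T1[of c] T_cong[of c 0] by (cases "p dvd c") auto
  then show ?thesis by (simp add: T_def)
qed

text \<open>Grouping by the value \<open>s\<close> of \<open>t^2 * a\<close>, taken
  \<open>1 + leg (a * s)\<close> times, gives a linear Legendre sum, which vanishes, and the sum of
  \<open>leg_sum_product\<close>.\<close>

lemma leg_sum_square:
  assumes a: "\<not> p dvd a"
  shows "(\<Sum>t\<in>{0..<p}. leg (c - t^2 * a)) = leg (- a) * (rp * of_bool (p dvd c) - 1)"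
proof -
  have "(\<Sum>t\<in>{0..<p}. leg (c - t^2 * a)) = (\<Sum>t\<in>{0..<p}. \<Sum>s\<in>{0..<p}. of_bool (p dvd t^2 * a - s * 1) * leg (c - s))"
  proof (rule sum.cong[OF refl])
    fix t
    have "of_bool (p dvd t^2 * a - s * 1) * leg (c - s) = of_bool (p dvd t^2 * a - s * 1) * leg (c - t^2 * a)" for s
    proof (cases "p dvd t^2 * a - s * 1")
      case True
      then have "leg (c - s) = leg (c - t^2 * a)" by (intro leg_cong) simp
      then show ?thesis by (simp only:)
    qed simp
    then have "(\<Sum>s\<in>{0..<p}. of_bool (p dvd t^2 * a - s * 1) * leg (c - s)) =
       (\<Sum>s\<in>{0..<p}. of_bool (p dvd t^2 * a - s * 1) * leg (c - t^2 * a))"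
      by (rule sum.cong[OF refl])
    also have "\<dots> = leg (c - t^2 * a)"
      using sum_of_bool_residue[OF prime_p not_p_dvd_1] by (simp flip: sum_distrib_right)
    finally show "leg (c - t^2 * a) = (\<Sum>s\<in>{0..<p}. of_bool (p dvd t^2 * a - s * 1) * leg (c - s))" by simp
  qed
  also have "\<dots> = (\<Sum>s\<in>{0..<p}. \<Sum>t\<in>{0..<p}. of_bool (p dvd t^2 * a - s * 1) * leg (c - s))" by (rule sum.swap)
  also have "\<dots> = (\<Sum>s\<in>{0..<p}. (1 + leg (a * s)) * leg (c - s))"
  proof (rule sum.cong[OF refl])
    fix s
    have "p dvd t^2 * a - s * 1 \<longleftrightarrow> p dvd s - t^2 * a" for t
      using dvd_minus_iff[of p "s - t^2 * a"] by (simp only: minus_diff_eq mult_1_right)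
    then show "(\<Sum>t\<in>{0..<p}. of_bool (p dvd t^2 * a - s * 1) * leg (c - s)) = (1 + leg (a * s)) * leg (c - s)"
      using square_count[OF a, of s] by (simp flip: sum_distrib_right)
  qed
  also have "\<dots> = (\<Sum>s\<in>{0..<p}. leg (- 1 * s + c)) + leg a * (\<Sum>s\<in>{0..<p}. leg (s * (c - s)))"
    unfolding leg_mult sum_distrib_left sum.distrib[symmetric]
    by (intro sum.cong refl) (simp add: distrib_right distrib_left mult_ac)
  also have "(\<Sum>s\<in>{0..<p}. leg (- 1 * s + c)) = 0"
    using leg_sum_affine[of "-1" c] not_p_dvd_1 by simp
  also have "leg a * (\<Sum>s\<in>{0..<p}. leg (s * (c - s))) = leg (- 1 * a) * (rp * of_bool (p dvd c) - 1)"
    using leg_sum_product[of c] leg_mult[of "- 1" a] by simp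
  finally show ?thesis by simp
qed

end

text \<open>By the Leibniz formula. It stands outside the locale because it is applied modulo p for
  the discriminant and modulo 2 for the parity of \<open>det Q\<close>.\<close>

lemma det_cong_dvd:
  fixes A A' :: "int mat"
  assumes A: "A \<in> carrier_mat n n" "A' \<in> carrier_mat n n"
    and c: "\<And>i j. i < n \<Longrightarrow> j < n \<Longrightarrow> k dvd A $$ (i, j) - A' $$ (i, j)"
  shows "k dvd det A - det A'"
proof -
  have "[det A = det A'] (mod k)"
    unfolding det_def'[OF A(1)] det_def'[OF A(2)]
  proof (intro cong_sum cong_mult cong_prod cong_refl)
    fix \<pi> i assume "\<pi> \<in> {\<pi>. \<pi> permutes {0..<n}}" "i \<in> {0..<n}"
    then have "\<pi> i < n" "i < n" by (auto simp: permutes_def dest: permutes_in_image)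
    then show "[A $$ (i, \<pi> i) = A' $$ (i, \<pi> i)] (mod k)" using c by (simp add: cong_iff_dvd_diff)
  qed
  then show ?thesis by (simp add: cong_iff_dvd_diff)
qed

context quad_space
begin

section \<open>Orthogonal bases modulo p and diagonal equations\<close>

primrec orth :: "ivec list \<Rightarrow> bool" where
  "orth [] \<longleftrightarrow> True"
| "orth (v # vs) \<longleftrightarrow> orth vs \<and> (perp p vs v) \<and> \<not> p dvd B v v"

lemma orth_indep: "orth vs \<Longrightarrow> indep vs"
proof (induction vs)
  case (Cons v vs)
  then have "\<not> spn p vs v" using spn_perp[of p vs v v] by auto
  then show ?case using Cons by simp
qed simp

text \<open>Pairing \<open>w\<close> with the head isolates the coefficient of the head, which must
  vanish because \<open>B v v\<close> is a unit: the form is nondegenerate on the span.\<close>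

lemma orth_perp_trivial:
  "orth vs \<Longrightarrow> spn p vs w \<Longrightarrow> (\<And>z. z \<in> set vs \<Longrightarrow> p dvd B w z) \<Longrightarrow> \<forall>i<m. p dvd w i"
proof (induction vs arbitrary: w)
  case (Cons v vs)
  obtain c where c: "spn p vs (axpy w (- c) v)" using Cons.prems(2) by auto
  have "p dvd B v (axpy w (- c) v)"
    using Cons.prems(1) by (intro spn_perp[OF c]) auto
  then have "p dvd B w v - c * B v v" by (simp add: B_sym[of v w])
  moreover have "p dvd B w v" using Cons.prems(3) by simp
  ultimately have "p dvd B w v - (B w v - c * B v v)" by (metis dvd_diff)
  then have "p dvd c" using Cons.prems(1) by (simp add: dvd_mult_p)
  then have "vcong p (axpy w (- c) v) w" by (simp add: vcong_def)
  then have "spn p vs w" using c spn_vcong by blast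
  then show ?case using Cons.IH[of w] Cons.prems by simp
qed simp

lemma exists_not_spn: assumes "indep vs" "length vs < m" shows "\<exists>x. \<not> spn p vs x"
proof (rule ccontr)
  assume "\<not> ?thesis"
  then have "(\<Sum>x\<in>box p. of_bool (spn p vs x) :: real) = rp ^ m"
    using card_box[of p] p_pos by simp
  then have "rp ^ m = rp ^ length vs" using card_spn[OF assms(1)] by simp
  then show False using assms(2) p_gt_2 by simp
qed

text \<open>Nondegeneracy on the span makes the complement nondegenerate too; it is nonzero by the
  length condition, so it contains an anisotropic vector.\<close>

lemma orth_extend:
  assumes o: "orth vs" and l: "length vs < m"
  shows "\<exists>w. orth (w # vs)"
proof -
  obtain x where "\<not> spn p vs x" using exists_not_spn[OF orth_indep[OF o] l] by blast
  then obtain w0 where w0: "\<And>z. z \<in> set vs \<Longrightarrow> p dvd B w0 z" "\<not> p dvd B w0 x"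
    using dual_vector[OF orth_indep[OF o]] by blast
  have "\<not> (\<forall>i<m. p dvd w0 i)"
  proof
    assume "\<forall>i<m. p dvd w0 i"
    then have "vcong p w0 (\<lambda>_. 0)" by (simp add: vcong_def)
    from B_vcong_dvd0[OF this vcong_refl, of x] show False using w0(2) by simp
  qed
  then have "\<not> spn p vs w0" using orth_perp_trivial[OF o _ w0(1)] by blast
  then obtain y where y: "\<And>z. z \<in> set vs \<Longrightarrow> p dvd B y z" "\<not> p dvd B y w0"
    using dual_vector[OF orth_indep[OF o]] by blast
  have 1: "orth (w # vs)" if "\<And>z. z \<in> set vs \<Longrightarrow> p dvd B w z" "\<not> p dvd B w w" for w
    using that o by simp
  \<comment> \<open>Polarization: as p is odd and \<open>B y w0\<close> is a unit, \<open>y\<close>,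
    \<open>w0\<close> and their sum cannot all be isotropic.\<close>
  have "B (axpy y 1 w0) (axpy y 1 w0) = B y y + (2 * B y w0 + B w0 w0)"
    by (simp add: B_sym[of w0 y])
  then have "\<not> (p dvd B y y \<and> p dvd B w0 w0 \<and> p dvd B (axpy y 1 w0) (axpy y 1 w0))"
    using y(2) p_dvd_2[of "B y w0"] by (metis dvd_add_left_iff dvd_add_right_iff)
  moreover have "p dvd B (axpy y 1 w0) z" if "z \<in> set vs" for z
    using y(1)[OF that] w0(1)[OF that] by simp
  ultimately show ?thesis using 1 w0(1) y(1) by blast
qed

text \<open>
  The number of solutions of \<open>a\<^sub>1 x\<^sub>1\<^sup>2 + \<dots> + a\<^sub>n x\<^sub>n\<^sup>2 = c\<close> modulo \<open>p\<close>, where \<open>D\<close> is the product of the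
  coefficients. The real quotients make the formula valid for \<open>n = 0\<close>, \<open>D = 1\<close> as well.
\<close>

definition gauss_val :: "nat \<Rightarrow> int \<Rightarrow> int \<Rightarrow> real" where
  "gauss_val n D c =
     (if even n then p ^ n / p + leg ((- 1) ^ (n div 2) * D) * (p ^ (n div 2) * of_bool (p dvd c) - p ^ (n div 2) / p)
      else p ^ (n - 1) + p ^ (n div 2) * leg ((- 1) ^ (n div 2) * c * D))"

text \<open>For even \<open>n\<close> the indicator in \<open>gauss_val\<close> sums by
  \<open>square_count\<close> and yields a Legendre symbol; for odd \<open>n\<close> the symbol sums
  by \<open>leg_sum_square\<close> and yields an indicator. This is why the two shapes alternate
  with the parity.\<close>

lemma gauss_val_Suc:
  assumes a: "\<not> p dvd a"
  shows "(\<Sum>t\<in>{0..<p}. gauss_val n D (c - t^2 * a)) = gauss_val (Suc n) (a * D) c"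
proof (cases "even n")
  case True
  then obtain r where r: "n = 2 * r" by blast
  define e where "e = leg ((- 1) ^ r * D)"
  define P where "P = rp"
  have P: "P > 0" using p_pos by (simp add: P_def)
  have "(\<Sum>t\<in>{0..<p}. gauss_val n D (c - t^2 * a)) =
      (\<Sum>t\<in>{0..<p}. (P ^ n / P - e * P ^ r / P) + e * P ^ r * of_bool (p dvd c - t^2 * a))"
    by (intro sum.cong refl) (simp add: gauss_val_def r flip: e_def P_def, simp add: algebra_simps diff_divide_distrib)
  also have "\<dots> = P * (P ^ n / P - e * P ^ r / P) + e * P ^ r * (1 + leg (a * c))"
    unfolding sum.distrib sum_distrib_left[symmetric] square_count[OF a] using p_pos by (simp add: P_def)
  also have "\<dots> = P ^ n + P ^ r * (e * leg (a * c))" using P by (simp add: field_simps)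
  also have "e * leg (a * c) = leg ((- 1) ^ r * c * (a * D))"
    unfolding e_def leg_mult[symmetric] by (simp add: mult_ac)
  finally show ?thesis by (simp add: gauss_val_def r P_def)
next
  case False
  then obtain r where r: "n = 2 * r + 1" by (elim oddE)
  define e where "e = leg ((- 1) ^ r * D)"
  define P where "P = rp"
  have P: "P > 0" using p_pos by (simp add: P_def)
  have "(\<Sum>t\<in>{0..<p}. gauss_val n D (c - t^2 * a)) =
      (\<Sum>t\<in>{0..<p}. P ^ (2 * r) + P ^ r * e * leg (c - t^2 * a))"
  proof (intro sum.cong refl)
    fix t
    have "leg ((- 1) ^ r * (c - t^2 * a) * D) = e * leg (c - t^2 * a)"
      unfolding e_def leg_mult[symmetric] by (simp add: mult_ac)
    then show "gauss_val n D (c - t^2 * a) = P ^ (2 * r) + P ^ r * e * leg (c - t^2 * a)"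
      by (simp add: gauss_val_def r P_def)
  qed
  also have "\<dots> = P * P ^ (2 * r) + P ^ r * (e * leg (- a)) * (P * of_bool (p dvd c) - 1)"
    unfolding sum.distrib sum_distrib_left[symmetric] leg_sum_square[OF a] using p_pos by (simp add: P_def)
  also have "e * leg (- a) = leg ((- 1) ^ Suc r * (a * D))"
    unfolding e_def leg_mult[symmetric] by (simp add: mult_ac)
  finally show ?thesis using P by (simp add: gauss_val_def r P_def algebra_simps)
qed

text \<open>Squares are split off along an orthogonal basis \<open>us\<close> of the complement of
  \<open>vs\<close>. The basis is kept so that its product can be compared with \<open>detQ\<close>,
  and it is chosen before \<open>c\<close> because the recursion evaluates the count at every
  \<open>c - t^2 * a\<close>.\<close>

lemma gauss_count:
  assumes "orth vs" "length vs + n = m"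
  shows "\<exists>us. length us = n \<and> orth (us @ vs) \<and>
    (\<forall>c. (\<Sum>x\<in>box p. of_bool (perp p vs x) * of_bool (p dvd B x x - c)) =
         gauss_val n (\<Prod>u\<leftarrow>us. B u u) c)"
  using assms
proof (induction n arbitrary: vs)
  case 0
  let ?f = "\<lambda>x. of_bool (perp p vs x) :: real"
  \<comment> \<open>The complement of a full orthogonal basis has exactly one residue, necessarily
    zero.\<close>
  have "(\<Sum>x\<in>box p. ?f x) = 1" using card_perp[OF orth_indep[OF 0(1)]] 0(2) p_pos by simp
  then have "1 = ?f (\<lambda>_. 0) + (\<Sum>x\<in>box p - {\<lambda>_. 0}. ?f x)"
    by (subst (asm) sum.remove[OF finite_box zero_in_box[OF p_pos]]) simp
  then have "(\<Sum>x\<in>box p - {\<lambda>_. 0}. ?f x) = 0" by simp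
  then have z: "?f x = 0" if "x \<in> box p - {\<lambda>_. 0}" for x
    using that by (subst (asm) sum_nonneg_eq_0_iff) auto
  have "(\<Sum>x\<in>box p. ?f x * of_bool (p dvd B x x - c)) = gauss_val 0 1 c" for c
  proof -
    have "(\<Sum>x\<in>box p. ?f x * of_bool (p dvd B x x - c)) = of_bool (p dvd c) + (\<Sum>x\<in>box p - {\<lambda>_. 0}. ?f x * of_bool (p dvd B x x - c))"
      by (subst sum.remove[OF finite_box zero_in_box[OF p_pos]]) simp
    also have "(\<Sum>x\<in>box p - {\<lambda>_. 0}. ?f x * of_bool (p dvd B x x - c)) = 0"
      using z by (intro sum.neutral) auto
    finally show ?thesis using leg_square[OF not_p_dvd_1] by (simp add: gauss_val_def)
  qed
  then show ?case using 0 by (intro exI[of _ "[]"]) simp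
next
  case (Suc n)
  obtain w where w: "orth (w # vs)" using orth_extend Suc.prems by fastforce
  define a where "a = B w w"
  have a: "\<not> p dvd a" and wv: "\<And>z. z \<in> set vs \<Longrightarrow> p dvd B w z" using w by (auto simp: a_def)
  obtain us where us: "length us = n" "orth (us @ w # vs)"
     "\<And>c. (\<Sum>x\<in>box p. of_bool (perp p (w # vs) x) * of_bool (p dvd B x x - c)) =
         gauss_val n (\<Prod>u\<leftarrow>us. B u u) c"
    using Suc.IH[OF w] Suc.prems by auto
  define D where "D = (\<Prod>u\<leftarrow>us. B u u)"
  have "(\<Sum>x\<in>box p. of_bool (perp p vs x) * of_bool (p dvd B x x - c)) = gauss_val (Suc n) (a * D) c" for c
  proof -
    let ?f = "\<lambda>x. of_bool (p dvd B x x - c) :: real"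
    have per: "per p ?f" by (rule perI) (simp add: B_vcong_dvd_diff)
    have "(\<Sum>x\<in>box p. of_bool (perp p vs x) * ?f x) =
       (\<Sum>t\<in>{0..<p}. \<Sum>x\<in>box p. of_bool (perp p (w # vs) x) * ?f (axpy x t w))"
      using sum_split[OF wv a[unfolded a_def] per, where c = "\<lambda>_. 0"] by (simp only: diff_zero)
    also have "\<dots> = (\<Sum>t\<in>{0..<p}. \<Sum>x\<in>box p. of_bool (perp p (w # vs) x) * of_bool (p dvd B x x - (c - t^2 * a)))"
    proof (intro sum.cong refl)
      fix t x
      show "of_bool (perp p (w # vs) x) * ?f (axpy x t w) =
         of_bool (perp p (w # vs) x) * of_bool (p dvd B x x - (c - t^2 * a))"
      proof (cases "p dvd B x w")
        case True
        have "B (axpy x t w) (axpy x t w) - c = (B x x - (c - t^2 * a)) + 2 * t * B x w"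
          by (simp add: B_sym[of w x] a_def power2_eq_square algebra_simps)
        then have "p dvd B (axpy x t w) (axpy x t w) - c \<longleftrightarrow> p dvd B x x - (c - t^2 * a)"
          using True by (metis dvd_add_left_iff dvd_mult)
        then show ?thesis by (simp only:)
      qed simp
    qed
    also have "\<dots> = (\<Sum>t\<in>{0..<p}. gauss_val n D (c - t^2 * a))" unfolding us(3) D_def ..
    also have "\<dots> = gauss_val (Suc n) (a * D) c" by (rule gauss_val_Suc[OF a])
    finally show ?thesis .
  qed
  moreover have "(\<Prod>u\<leftarrow>us @ [w]. B u u) = a * D" by (simp add: D_def a_def)
  ultimately show ?case using us(1,2) by (intro exI[of _ "us @ [w]"]) simp
qed

lemma orth_nth: "orth us \<Longrightarrow> i < length us \<Longrightarrow> j < length us \<Longrightarrow> i \<noteq> j \<Longrightarrow> p dvd B (us ! i) (us ! j)"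
proof (induction us arbitrary: i j)
  case (Cons u us)
  show ?case
  proof (cases i)
    case 0
    then obtain j' where "j = Suc j'" using Cons.prems(4) by (cases j) auto
    then show ?thesis using Cons.prems 0 by auto
  next
    case (Suc i')
    show ?thesis
    proof (cases j)
      case 0
      then show ?thesis using Cons.prems Suc by (auto simp: B_sym)
    next
      case (Suc j')
      then show ?thesis using Cons.prems \<open>i = Suc i'\<close> Cons.IH[of i' j'] by auto
    qed
  qed
qed simp

text \<open>Modulo p the product is the determinant of the Gram matrix \<open>A Q A^t\<close>, hence
  \<open>detQ\<close> times the square of a unit, which the symbol does not see. The factor
  \<open>e\<close> carries the sign \<open>(- 1) ^ k\<close>.\<close>

lemma orth_discriminant:
  assumes o: "orth us" and l: "length us = m"
  shows "leg (e * (\<Prod>u\<leftarrow>us. B u u)) = leg (e * detQ)"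
proof -
  define A where "A = mat m m (\<lambda>(i, j). (us ! i) j)"
  define Q' where "Q' = mat m m (\<lambda>(i, j). Q i j)"
  define D where "D = mat m m (\<lambda>(i, j). if i = j then B (us ! i) (us ! i) else 0)"
  have [simp]: "A \<in> carrier_mat m m" "Q' \<in> carrier_mat m m" "D \<in> carrier_mat m m" "dim_row A = m" "dim_col A = m"
     "dim_row Q' = m" "dim_col Q' = m"
    by (auto simp: A_def Q'_def D_def)
  have entry: "(A * Q' * transpose_mat A) $$ (i, j) = B (us ! i) (us ! j)" if "i < m" "j < m" for i j
  proof -
    have "(A * Q' * transpose_mat A) $$ (i, j) = (\<Sum>l<m. (A * Q') $$ (i, l) * (us ! j) l)"
      using that by (simp add: times_mat_def scalar_prod_def atLeast0LessThan A_def)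
    also have "\<dots> = (\<Sum>l<m. (\<Sum>r<m. (us ! i) r * Q r l) * (us ! j) l)"
      using that by (intro sum.cong refl) (simp add: times_mat_def scalar_prod_def atLeast0LessThan A_def Q'_def)
    also have "\<dots> = (\<Sum>l<m. \<Sum>r<m. Q r l * (us ! i) r * (us ! j) l)"
      unfolding sum_distrib_right by (intro sum.cong refl) (simp add: mult_ac)
    also have "\<dots> = B (us ! i) (us ! j)" unfolding B_def by (rule sum.swap)
    finally show ?thesis .
  qed
  have "p dvd det (A * Q' * transpose_mat A) - det D"
  proof (rule det_cong_dvd[of _ m])
    fix i j assume ij: "i < m" "j < m"
    show "p dvd (A * Q' * transpose_mat A) $$ (i, j) - D $$ (i, j)"
      unfolding entry[OF ij] using ij orth_nth[OF o, of i j] l by (simp add: D_def)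
  qed auto
  also have "det (A * Q' * transpose_mat A) = det A * det Q' * det A"
  proof -
    have "det (A * Q' * transpose_mat A) = det (A * Q') * det (transpose_mat A)"
      by (rule det_mult[of _ m]) (simp_all add: mult_carrier_mat[of A m m])
    moreover have "det (A * Q') = det A * det Q'" by (rule det_mult[of _ m]) simp_all
    moreover have "det (transpose_mat A) = det A" by (rule det_transpose[of _ m]) simp
    ultimately show ?thesis by simp
  qed
  also have "det D = (\<Prod>u\<leftarrow>us. B u u)"
  proof -
    have "det D = prod_list (diag_mat D)"
      by (rule det_upper_triangular[of _ m]) (auto simp: D_def)
    also have "diag_mat D = map (\<lambda>u. B u u) us"
      using l by (intro nth_equalityI) (auto simp: diag_mat_def D_def)
    finally show ?thesis by simp
  qed
  finally have d: "p dvd det A * det Q' * det A - (\<Prod>u\<leftarrow>us. B u u)" .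
  have "\<not> p dvd (\<Prod>u\<leftarrow>us. B u u)"
    using o
  proof (induction us)
    case Nil then show ?case using not_p_dvd_1 by simp
  next
    case (Cons a us) then show ?case by (simp add: dvd_mult_p)
  qed
  moreover have "p dvd (\<Prod>u\<leftarrow>us. B u u)" if "p dvd det A"
  proof -
    have "p dvd det A * det Q' * det A" using that by simp
    with d have "p dvd det A * det Q' * det A - (det A * det Q' * det A - (\<Prod>u\<leftarrow>us. B u u))"
      by (metis dvd_diff)
    then show ?thesis by simp
  qed
  ultimately have "\<not> p dvd det A" by blast
  then have "leg (e * (det A * det Q' * det A)) = leg (e * det Q')"
    using leg_square[of "det A"] by (simp add: leg_mult)
  moreover have "leg (e * (det A * det Q' * det A)) = leg (e * (\<Prod>u\<leftarrow>us. B u u))"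
    using dvd_mult[OF d, of e] by (intro leg_cong) (simp add: right_diff_distrib)
  ultimately show ?thesis by (simp add: Q'_def)
qed

lemma cone_count_Nil:
  assumes m: "m = 2 * k + 1"
  shows "cone_count [] = rp ^ (2 * k)"
proof -
  obtain us where "\<And>c. (\<Sum>x\<in>box p. of_bool (perp p [] x) * of_bool (p dvd B x x - c)) =
         gauss_val m (\<Prod>u\<leftarrow>us. B u u) c"
    using gauss_count[of "[]" m] by auto
  from this[of 0] have "cone_count [] = gauss_val m (\<Prod>u\<leftarrow>us. B u u) 0"
    by (simp only: cone_count_def diff_zero)
  then show ?thesis using leg_0[of 0] by (simp add: gauss_val_def m)
qed

text \<open>The complement of \<open>u\<close> has even dimension \<open>2 * k\<close> and
  discriminant \<open>B u u * detQ\<close> up to squares, which is where both characters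
  enter.\<close>

lemma cone_count_anisotropic:
  assumes m: "m = 2 * k + 1" and k: "k \<ge> 1" and u: "\<not> p dvd B u u"
  defines "\<eta> \<equiv> leg (B u u) * leg ((- 1) ^ k * detQ)"
  shows "cone_count [u] = rp ^ (2 * k - 1) + \<eta> * (rp ^ k - rp ^ (k - 1))"
proof -
  have "orth [u]" using u by simp
  then obtain us where us: "length us = 2 * k" "orth (us @ [u])"
     "\<And>c. (\<Sum>x\<in>box p. of_bool (perp p [u] x) * of_bool (p dvd B x x - c)) =
         gauss_val (2 * k) (\<Prod>u\<leftarrow>us. B u u) c"
    using gauss_count[of "[u]" "2 * k"] m by auto
  define D where "D = (\<Prod>u\<leftarrow>us. B u u)"
  have "leg ((- 1) ^ k * (\<Prod>u\<leftarrow>us @ [u]. B u u)) = leg ((- 1) ^ k * detQ)"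
    by (rule orth_discriminant[OF us(2)]) (simp add: us(1) m)
  then have "\<eta> = leg (B u u) * leg ((- 1) ^ k * (\<Prod>u\<leftarrow>us @ [u]. B u u))"
    by (simp only: \<eta>_def)
  also have "\<dots> = leg (B u u * B u u) * leg ((- 1) ^ k * D)"
    unfolding leg_mult[symmetric] by (simp add: D_def mult_ac)
  finally have "\<eta> = leg (B u u * B u u) * leg ((- 1) ^ k * D)" .
  then have eta: "\<eta> = leg ((- 1) ^ k * D)" using leg_square[OF u] by simp
  obtain k' where k': "k = Suc k'" using k by (cases k) auto
  have "cone_count [u] = gauss_val (2 * k) D 0"
    using us(3)[of 0] by (simp only: cone_count_def D_def diff_zero)
  then show ?thesis using eta p_pos by (simp add: gauss_val_def k')
qed

section \<open>Frames and their lattices\<close>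

lemma axpy_box: assumes "x \<in> box p" "u \<in> box p" shows "axpy x p u \<in> box (p^2)"
proof -
  have "0 \<le> x i + p * u i \<and> x i + p * u i < p^2" if "i < m" for i
  proof -
    have h: "0 \<le> x i" "x i < p" "0 \<le> u i" "u i \<le> p - 1" using assms that by (auto simp: box_def)
    have "p * u i \<le> p * (p - 1)" using h(4) p_pos by simp
    then have "x i + p * u i < p + p * (p - 1)" using h(2) by simp
    also have "\<dots> = p^2" by (simp add: power2_eq_square algebra_simps)
    finally show ?thesis using h p_pos by simp
  qed
  then show ?thesis using assms by (auto simp: box_def)
qed

text \<open>Base p expansion with two digits: the first is the residue modulo p, the second is the
  unknown of the lifting equations.\<close>

lemma sum_box_square:
  fixes f :: "ivec \<Rightarrow> real"
  shows "(\<Sum>x\<in>box (p^2). f x) = (\<Sum>x\<in>box p. \<Sum>u\<in>box p. f (axpy x p u))"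
proof -
  have "(\<Sum>x\<in>box (p^2). f x) = (\<Sum>(x, u)\<in>box p \<times> box p. f (axpy x p u))"
  proof (rule sum.reindex_bij_witness[where i = "\<lambda>(x, u). axpy x p u" and j = "\<lambda>x. (red p x, \<lambda>i. x i div p)"], goal_cases)
    case (1 x)
    then show ?case by (auto simp: axpy_def red_def box_def)
  next
    case (2 x)
    have "x i div p < p" if "i < m" for i
    proof -
      have "x i < p * p" using 2 that by (auto simp: box_def power2_eq_square)
      show ?thesis
      proof (rule ccontr)
        assume "\<not> x i div p < p"
        then have "p * p \<le> p * (x i div p)" using p_pos by simp
        also have "\<dots> \<le> x i"
          using mult_div_mod_eq[of p "x i"] pos_mod_sign[OF p_pos, of "x i"] by linarith
        finally show False using \<open>x i < p * p\<close> by simp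
      qed
    qed
    then show ?case using 2 p_pos red_in_box by (auto simp: box_def pos_imp_zdiv_nonneg_iff)
  next
    case (3 y)
    obtain x u where y: "y = (x, u)" "x \<in> box p" "u \<in> box p" using 3 by auto
    have "red p (axpy x p u) = x" using y by (auto simp: red_def box_def)
    moreover have "(\<lambda>i. axpy x p u i div p) = u"
    proof
      fix i show "axpy x p u i div p = u i"
        using y p_pos by (cases "i < m") (auto simp: box_def)
    qed
    ultimately show ?case using y by simp
  next
    case (4 y) then show ?case using axpy_box by auto
  next
    case (5 x)
    have "(case (red p x, \<lambda>i. x i div p) of (x, u) \<Rightarrow> axpy x p u) = x"
      using 5 by (auto simp: axpy_def red_def box_def)
    then show ?case by simp
  qed
  then show ?thesis by (simp add: sum.cartesian_product)
qed

lemma p2_dvd_p: "p^2 dvd a \<Longrightarrow> p dvd a"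
  by (meson dvd_power dvd_trans zero_less_numeral)

lemma p2_dvd_mult: "p^2 dvd p * a \<longleftrightarrow> p dvd a"
  using p_nz by (simp add: power2_eq_square)

lemma vcong_axpy_p: "vcong p (axpy x p u) x"
  by (simp add: vcong_def)

lemma p2_dvd_lift:
  "p^2 dvd B (axpy x p u) z \<Longrightarrow> p dvd B x z"
  "p^2 dvd B (axpy x p u) (axpy x p u) \<Longrightarrow> p dvd B x x"
  using p2_dvd_p[of "B (axpy x p u) z"] B_vcong_dvd0[OF vcong_axpy_p[of x u] vcong_refl[of p z]]
    p2_dvd_p[of "B (axpy x p u) (axpy x p u)"] B_vcong_dvd0[OF vcong_axpy_p[of x u] vcong_axpy_p[of x u]]
  by simp_all

lemma lift_linear:
  assumes "p dvd B x z"
  shows "p^2 dvd B (axpy x p u) z \<longleftrightarrow> p dvd B u z - (- (B x z div p))"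
proof -
  have "B (axpy x p u) z = p * (B u z - (- (B x z div p)))" using assms by (simp add: algebra_simps)
  then show ?thesis by (simp only: p2_dvd_mult)
qed

text \<open>
  The factor \<open>(p + 1) div 2\<close> is the inverse of 2 modulo \<open>p\<close>.
\<close>

lemma lift_square:
  assumes "p dvd B x x"
  shows "p^2 dvd B (axpy x p u) (axpy x p u) \<longleftrightarrow> p dvd B u x - (- ((p + 1) div 2 * (B x x div p)))"
proof -
  let ?a = "B x x div p"
  define h where "h = (p + 1) div 2"
  have "odd p" using prime_p p_gt_2 by (simp add: prime_odd_int)
  then have "2 dvd p + 1" by simp
  then have h: "p + 1 = 2 * h" unfolding h_def by (rule dvd_mult_div_cancel[symmetric])
  have "B (axpy x p u) (axpy x p u) = p * (?a + 2 * B u x + p * B u u)"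
    using assms by (simp add: algebra_simps B_sym[of x u])
  then have "p^2 dvd B (axpy x p u) (axpy x p u) \<longleftrightarrow> p dvd ?a + 2 * B u x + p * B u u"
    by (simp only: p2_dvd_mult)
  \<comment> \<open>Both \<open>p * B u u\<close> and \<open>p * ?a\<close> vanish modulo p;
    exchanging them makes the coefficient of \<open>?a\<close> equal to
    \<open>p + 1 = 2 * h\<close>, so that 2 can be cancelled.\<close>
  also have "\<dots> \<longleftrightarrow> p dvd (?a + 2 * B u x) + p * ?a" by (simp add: dvd_add_left_iff)
  also have "(?a + 2 * B u x) + p * ?a = 2 * B u x + (p + 1) * ?a" by (simp add: algebra_simps)
  also have "\<dots> = 2 * (B u x - (- (h * ?a)))" unfolding h by (simp add: algebra_simps)
  finally show ?thesis by (simp only: p_dvd_2 h_def)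
qed

text \<open>Over each admissible residue the conditions are an affine system for the second digit
  with independent equations from \<open>xs\<close>, so all such residues have equally many
  lifts.\<close>

lemma lift_count_perp:
  assumes xs: "indep xs" and P: "per p P"
  shows "(\<Sum>x\<in>box (p^2). of_bool (P x \<and> (perp (p^2) xs x)) :: real) =
    rp ^ m / rp ^ length xs * (\<Sum>x\<in>box p. of_bool (P x \<and> (perp p xs x)))"
proof -
  have "(\<Sum>u\<in>box p. of_bool (P (axpy x p u) \<and> (perp (p^2) xs (axpy x p u))) :: real) =
      rp ^ m / rp ^ length xs * of_bool (P x \<and> (perp p xs x))" for x
  proof -
    have Px: "P (axpy x p u) \<longleftrightarrow> P x" for u by (rule perD[OF P vcong_axpy_p])
    show ?thesis
    proof (cases "P x \<and> (perp p xs x)")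
      case True
      then have "P (axpy x p u) \<and> (perp (p^2) xs (axpy x p u)) \<longleftrightarrow>
          (\<forall>z\<in>set xs. p dvd B u z - (- (B x z div p)))" for u
        unfolding Px using lift_linear by blast
      moreover have "(P x \<and> (perp p xs x)) = True" using True by blast
      ultimately show ?thesis using card_sys[OF xs, of "\<lambda>z. - (B x z div p)"]
        by (simp only: of_bool_eq mult_1_right of_int_power)
    next
      case False
      have "(P (axpy x p u) \<and> (perp (p^2) xs (axpy x p u))) = False" for u
        using False unfolding Px using p2_dvd_lift(1)[of x u] by blast
      moreover have "(P x \<and> (perp p xs x)) = False" using False by blast
      ultimately show ?thesis by (simp only: of_bool_eq mult_zero_right sum.neutral_const)
    qed
  qed
  then show ?thesis unfolding sum_box_square sum_distrib_left by simp
qed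

text \<open>Isotropy adds one equation for the second digit, with coefficient vector
  \<open>x\<close> itself; \<open>Pn\<close> makes it independent of those from
  \<open>xs\<close>.\<close>

lemma lift_count_isotropic:
  assumes xs: "indep xs" and P: "per p P" and Pn: "\<And>x. P x \<Longrightarrow> \<not> spn p xs x"
  shows "(\<Sum>x\<in>box (p^2). of_bool (P x \<and> p^2 dvd B x x \<and> (perp (p^2) xs x)) :: real) =
    rp ^ m / rp ^ Suc (length xs) * (\<Sum>x\<in>box p. of_bool (P x \<and> p dvd B x x \<and> (perp p xs x)))"
proof -
  have "(\<Sum>u\<in>box p. of_bool (P (axpy x p u) \<and> p^2 dvd B (axpy x p u) (axpy x p u) \<and>
        (perp (p^2) xs (axpy x p u))) :: real) =
      rp ^ m / rp ^ Suc (length xs) * of_bool (P x \<and> p dvd B x x \<and> (perp p xs x))" for x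
  proof -
    have Px: "P (axpy x p u) \<longleftrightarrow> P x" for u by (rule perD[OF P vcong_axpy_p])
    show ?thesis
    proof (cases "P x \<and> p dvd B x x \<and> (perp p xs x)")
      case True
      \<comment> \<open>Right-hand sides are indexed by vectors, so the case split requires that
        \<open>x\<close> is no member of \<open>xs\<close>; this is \<open>ne\<close>.\<close>
      define c where "c z = (if z = x then - ((p + 1) div 2 * (B x x div p)) else - (B x z div p))" for z
      have ns: "\<not> spn p xs x" using True Pn by blast
      then have ne: "z \<noteq> x" if "z \<in> set xs" for z using that spn_mem by blast
      have "P (axpy x p u) \<and> p^2 dvd B (axpy x p u) (axpy x p u) \<and> (perp (p^2) xs (axpy x p u)) \<longleftrightarrow>
          (\<forall>z\<in>set (x # xs). p dvd B u z - c z)" for u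
      proof -
        have "p^2 dvd B (axpy x p u) (axpy x p u) \<longleftrightarrow> p dvd B u x - c x"
          using lift_square[of x u] True by (simp only: c_def if_True refl)
        moreover have "p^2 dvd B (axpy x p u) z \<longleftrightarrow> p dvd B u z - c z" if "z \<in> set xs" for z
          using lift_linear[of x z u] True that ne[OF that] by (simp only: c_def if_False)
        ultimately show ?thesis unfolding Px using True by (simp only: list.set ball_simps) blast
      qed
      moreover have "indep (x # xs)" using xs ns by simp
      from card_sys[OF this, of c]
      have "(\<Sum>u\<in>box p. of_bool (\<forall>z\<in>set (x # xs). p dvd B u z - c z) :: real) = rp ^ m / rp ^ Suc (length xs)"
        by (simp only: list.size(4) One_nat_def add_Suc_right add_0_right of_int_power)
      moreover have "(P x \<and> p dvd B x x \<and> (perp p xs x)) = True" using True by blast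
      ultimately show ?thesis by (simp only: of_bool_eq mult_1_right of_int_power)
    next
      case False
      have "(P (axpy x p u) \<and> p^2 dvd B (axpy x p u) (axpy x p u) \<and>
          (perp (p^2) xs (axpy x p u))) = False" for u
        using False unfolding Px using p2_dvd_lift(1)[of x u] p2_dvd_lift(2)[of x u] by blast
      moreover have "(P x \<and> p dvd B x x \<and> (perp p xs x)) = False" using False by blast
      ultimately show ?thesis by (simp only: of_bool_eq mult_zero_right sum.neutral_const)
    qed
  qed
  then show ?thesis unfolding sum_box_square sum_distrib_left by simp
qed

text \<open>
  The lists \<open>ws\<close> and \<open>vs\<close> carry the condition imposed by \<open>K\<close>: both are empty unless \<open>K = p u\<close>, when \<open>ws = [u]\<close>,
  and also \<open>vs = [u]\<close> in the case that \<open>u\<close> is isotropic and outside the span of the frame.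
\<close>

primrec frame :: "ivec list \<Rightarrow> ivec list \<Rightarrow> ivec list \<Rightarrow> bool" where
  "frame ws vs [] \<longleftrightarrow> True"
| "frame ws vs (x # xs) \<longleftrightarrow> frame ws vs xs \<and> x \<in> box (p^2) \<and>
    (\<not> spn p (xs @ vs) x \<and> (perp p ws x)) \<and>
    p^2 dvd B x x \<and> (perp (p^2) xs x)"

lemma frame_indep: "frame ws vs xs \<Longrightarrow> indep vs \<Longrightarrow> indep (xs @ vs)"
  by (induction xs) auto

lemma frame_pairwise: "frame ws vs xs \<Longrightarrow> x \<in> set xs \<Longrightarrow> y \<in> set xs \<Longrightarrow> p^2 dvd B x y"
  by (induction xs) (auto simp: B_sym)

lemma frame_box: "frame ws vs xs \<Longrightarrow> x \<in> set xs \<Longrightarrow> x \<in> box (p^2)"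
  by (induction xs) auto

lemma frame_perp: "frame ws vs xs \<Longrightarrow> x \<in> set xs \<Longrightarrow> w \<in> set ws \<Longrightarrow> p dvd B x w"
  by (induction xs) auto

lemma indep_append: "indep (xs @ ys) \<Longrightarrow> indep xs"
proof (induction xs)
  case (Cons x xs)
  have "spn p (xs @ ys) x" if "spn p xs x" using that by (rule spn_subset[rotated]) simp
  then show ?case using Cons by auto
qed simp

text \<open>The decrements of \<open>cone_count_Cons\<close> telescope. The list \<open>ws\<close>
  stays at the end, since its members may be anisotropic.\<close>

lemma cone_count_frame:
  assumes "frame ws vs ys" "indep (ys @ ws)"
  shows "cone_count (ys @ ws) = cone_count ws - (rp ^ m / rp ^ length ws - rp ^ m / rp ^ (length ys + length ws)) / rp"
  using assms
proof (induction ys)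
  case (Cons y ys)
  have "cone_count (y # ys @ ws) = cone_count (ys @ ws) -
    (rp ^ m / rp ^ length (ys @ ws) - rp ^ m / rp ^ Suc (length (ys @ ws))) / rp"
  proof (rule cone_count_Cons)
    show "indep (y # ys @ ws)" using Cons.prems(2) by simp
    show "p dvd B y y" using Cons.prems(1) p2_dvd_p by auto
    show "p dvd B y z" if "z \<in> set (ys @ ws)" for z using that Cons.prems(1) p2_dvd_p by auto
  qed
  then show ?case using Cons by (simp add: diff_divide_distrib)
qed simp

text \<open>The factor in front counts second digits: one equation for isotropy and \<open>l\<close>
  for orthogonality to the frame. The bracket counts residues: the isotropic vectors orthogonal to
  the frame and to \<open>ws\<close>, minus the span of the frame and \<open>vs\<close>.\<close>

definition frame_step :: "ivec list \<Rightarrow> ivec list \<Rightarrow> nat \<Rightarrow> real" where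
  "frame_step ws vs l = rp ^ m / rp ^ Suc l *
     (cone_count ws - (rp ^ m / rp ^ length ws - rp ^ m / rp ^ (l + length ws)) / rp - rp ^ (l + length vs))"

text \<open>By \<open>sub\<close> and \<open>perp\<close> every vector in the span of
  \<open>ys @ vs\<close> is isotropic and orthogonal to \<open>ys @ ws\<close> modulo p. The
  excluded span therefore lies inside the counted cone, and its size can be subtracted.\<close>

lemma card_frame_step:
  assumes f: "frame ws vs ys" and i: "indep (ys @ ws)" and iv: "indep vs"
    and sub: "set vs \<subseteq> set ws" and perp: "\<And>v w. v \<in> set vs \<Longrightarrow> w \<in> set ws \<Longrightarrow> p dvd B v w"
  shows "finite {x. frame ws vs (x # ys)}"
    and "real (card {x. frame ws vs (x # ys)}) = frame_step ws vs (length ys)"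
proof -
  let ?P = "\<lambda>x. \<not> spn p (ys @ vs) x \<and> (perp p ws x)"
  let ?C = "\<lambda>x. ?P x \<and> p^2 dvd B x x \<and> (perp (p^2) ys x)"
  have e: "{x. frame ws vs (x # ys)} = {x \<in> box (p^2). ?C x}" using f by auto
  show "finite {x. frame ws vs (x # ys)}" unfolding e by simp
  have orth: "p dvd B v z" if "v \<in> set (ys @ vs)" "z \<in> set (ys @ ws)" for v z
  proof (cases "v \<in> set ys")
    case True
    show ?thesis
    proof (cases "z \<in> set ys")
      case True then show ?thesis using frame_pairwise[OF f \<open>v \<in> set ys\<close>] p2_dvd_p by blast
    next
      case False then show ?thesis using frame_perp[OF f True] that by auto
    qed
  next
    case False
    then have v: "v \<in> set vs" using that by auto
    show ?thesis
    proof (cases "z \<in> set ys")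
      case True then show ?thesis using frame_perp[OF f True, of v] v sub B_sym by auto
    next
      case False then show ?thesis using perp[OF v] that by auto
    qed
  qed
  have sp: "(perp p (ys @ ws) x) \<and> p dvd B x x" if x: "spn p (ys @ vs) x" for x
  proof -
    have 1: "p dvd B x z" if "z \<in> set (ys @ ws)" for z
      using spn_perp[OF x, of z] orth[OF _ that] B_sym by metis
    have "p dvd B x x" by (rule spn_perp[OF x]) (use 1 sub in auto)
    then show ?thesis using 1 by blast
  qed
  have "real (card {x \<in> box (p^2). ?C x}) = (\<Sum>x\<in>box (p^2). of_bool (?C x))"
    by (simp add: of_bool_def sum.If_cases Int_def)
  also have "\<dots> = rp ^ m / rp ^ Suc (length ys) * (\<Sum>x\<in>box p. of_bool (?P x \<and> p dvd B x x \<and> (perp p ys x)))"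
  proof (rule lift_count_isotropic)
    show "indep ys" using indep_append i by blast
    show "per p ?P"
    proof (rule perI)
      fix x x' assume xx: "vcong p x x'"
      show "?P x = ?P x'" using perD[OF per_perp xx] spn_vcong[OF xx] by blast
    qed
    show "\<not> spn p ys x" if "?P x" for x
      using that spn_subset[of ys "ys @ vs" p x] by auto
  qed
  also have "(\<Sum>x\<in>box p. of_bool (?P x \<and> p dvd B x x \<and> (perp p ys x)) :: real) =
     (\<Sum>x\<in>box p. of_bool (perp p (ys @ ws) x) * of_bool (p dvd B x x) - of_bool (spn p (ys @ vs) x))"
  proof (intro sum.cong refl)
    fix x
    show "of_bool (?P x \<and> p dvd B x x \<and> (perp p ys x)) =
      (of_bool (perp p (ys @ ws) x) * of_bool (p dvd B x x) - of_bool (spn p (ys @ vs) x) :: real)"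
      using sp[of x] by (auto simp: of_bool_def)
  qed
  also have "\<dots> = cone_count (ys @ ws) - rp ^ (length ys + length vs)"
    unfolding sum_subtractf cone_count_def[symmetric] using card_spn[OF frame_indep[OF f iv]] by simp
  finally show "real (card {x. frame ws vs (x # ys)}) = frame_step ws vs (length ys)"
    unfolding e frame_step_def cone_count_frame[OF f i] .
qed

lemma card_list_extensions:
  fixes G :: "'a list \<Rightarrow> bool" and N :: "nat \<Rightarrow> real"
  assumes G0: "G []" and G1: "\<And>x xs. G (x # xs) \<Longrightarrow> G xs"
    and step: "\<And>xs. length xs < n \<Longrightarrow> G xs \<Longrightarrow> finite {x. G (x # xs)} \<and> real (card {x. G (x # xs)}) = N (length xs)"
  shows "finite {xs. length xs = n \<and> G xs} \<and> real (card {xs. length xs = n \<and> G xs}) = (\<Prod>i<n. N i)"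
  using step
proof (induction n)
  case 0
  have "{xs. length xs = 0 \<and> G xs} = {[]}" using G0 by auto
  then show ?case by simp
next
  case (Suc n)
  let ?S = "{xs. length xs = n \<and> G xs}"
  have IH: "finite ?S" "real (card ?S) = (\<Prod>i<n. N i)" using Suc by auto
  have e: "{xs. length xs = Suc n \<and> G xs} = (\<lambda>(xs, x). x # xs) ` (SIGMA xs:?S. {x. G (x # xs)})"
    by (auto simp: length_Suc_conv image_iff G1)
  have inj: "inj_on (\<lambda>(xs, x). x # xs) (SIGMA xs:?S. {x. G (x # xs)})" by (auto simp: inj_on_def)
  have fin: "finite {x. G (x # xs)}" if "xs \<in> ?S" for xs using Suc.prems[of xs] that by auto
  have "real (card {xs. length xs = Suc n \<and> G xs}) = (\<Sum>xs\<in>?S. real (card {x. G (x # xs)}))"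
    unfolding e card_image[OF inj] using IH(1) fin by (subst card_SigmaI) auto
  also have "\<dots> = (\<Sum>xs\<in>?S. N n)" using Suc.prems by (intro sum.cong) auto
  also have "\<dots> = (\<Prod>i<Suc n. N i)" using IH(2) by simp
  finally show ?case unfolding e using IH(1) fin by (auto intro!: finite_SigmaI)
qed

text \<open>The tail \<open>zs\<close> is kept fixed so that a prescribed vector can be the first
  member of the frame.\<close>

lemma card_frames:
  assumes i: "\<And>ys. frame ws vs ys \<Longrightarrow> indep (ys @ ws)" and iv: "indep vs"
    and sub: "set vs \<subseteq> set ws" and perp: "\<And>v w. v \<in> set vs \<Longrightarrow> w \<in> set ws \<Longrightarrow> p dvd B v w"
    and zs: "frame ws vs zs"
  shows "finite {xs. length xs = n \<and> frame ws vs (xs @ zs)}"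
    "real (card {xs. length xs = n \<and> frame ws vs (xs @ zs)}) = (\<Prod>j<n. frame_step ws vs (j + length zs))"
proof -
  have "finite {xs. length xs = n \<and> frame ws vs (xs @ zs)} \<and>
    real (card {xs. length xs = n \<and> frame ws vs (xs @ zs)}) = (\<Prod>j<n. frame_step ws vs (j + length zs))"
  proof (rule card_list_extensions)
    fix xs assume "frame ws vs (xs @ zs)"
    from card_frame_step[OF this i[OF this] iv sub perp]
    show "finite {x. frame ws vs ((x # xs) @ zs)} \<and> real (card {x. frame ws vs ((x # xs) @ zs)}) = frame_step ws vs (length xs + length zs)"
      by simp
  qed (use zs in auto)
  then show "finite {xs. length xs = n \<and> frame ws vs (xs @ zs)}"
    "real (card {xs. length xs = n \<and> frame ws vs (xs @ zs)}) = (\<Prod>j<n. frame_step ws vs (j + length zs))" by auto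
qed

text \<open>
  The lattice \<open>M \<int>\<^sup>m\<close> of a matrix with \<open>q[M] \<equiv> 0\<close> modulo \<open>p\<^sup>2\<close>, recovered from a frame inside it.
\<close>

definition Lt :: "ivec list \<Rightarrow> ivec set" where
  "Lt xs = {y. spn p xs y \<and> (perp (p^2) xs y)}"

lemma spn_dvd: "n dvd k \<Longrightarrow> spn k xs x \<Longrightarrow> spn n xs x"
proof (induction xs arbitrary: x)
  case Nil
  then show ?case using dvd_trans by auto
next
  case (Cons a xs)
  obtain c where "spn k xs (axpy x (- c) a)" using Cons.prems(2) by auto
  then have "spn n xs (axpy x (- c) a)" by (rule Cons.IH[OF Cons.prems(1)])
  then show ?case unfolding spn.simps by (rule exI)
qed

lemma spn_lift: "spn n xs x \<Longrightarrow> \<exists>x'. spn 0 xs x' \<and> vcong n x x'"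
proof (induction xs arbitrary: x)
  case Nil
  then show ?case by (intro exI[of _ "\<lambda>_. 0"]) (simp add: vcong_def)
next
  case (Cons a xs)
  obtain c where "spn n xs (axpy x (- c) a)" using Cons.prems by auto
  then obtain x' where x': "spn 0 xs x'" "vcong n (axpy x (- c) a) x'" using Cons.IH by blast
  have "spn 0 (a # xs) (axpy x' c a)"
    using spn_axpy[OF spn_Cons_self[OF x'(1)] spn_mem] by simp
  moreover have "vcong n (axpy (axpy x (- c) a) c a) (axpy x' c a)"
    using vcong_axpy[OF x'(2) vcong_refl] .
  moreover have "axpy (axpy x (- c) a) c a = x" by (simp add: axpy_def)
  ultimately show ?case by metis
qed

text \<open>Write \<open>y = a + p u\<close> with \<open>a\<close> in the integral span of
  \<open>xs\<close>. Then \<open>z\<close> is orthogonal to \<open>a\<close> modulo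
  \<open>p^2\<close>. Moreover \<open>u\<close> is orthogonal to \<open>xs\<close> modulo p, because
  \<open>y\<close> and \<open>a\<close> are so modulo \<open>p^2\<close>, and \<open>z\<close> lies
  in the span of \<open>xs\<close> modulo p.\<close>

lemma Lt_pair:
  assumes f: "frame ws vs xs" and y: "y \<in> Lt xs" and z: "z \<in> Lt xs"
  shows "p^2 dvd B y z"
proof -
  have "spn p xs y" using y by (simp add: Lt_def)
  from spn_lift[OF this] obtain a where a: "spn 0 xs a" "vcong p y a" by blast
  obtain u where u: "vcong 0 y (axpy a p u)" using vcong_decomp[OF a(2)] .
  have yy: "B y w = B a w + p * B u w" for w
    using B_vcong[OF u, of w] by simp
  have a2: "spn (p^2) xs a" using spn_dvd[OF _ a(1)] by simp
  have "p^2 dvd B z a" using spn_perp[OF a2, of z] z by (simp add: Lt_def)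
  moreover have "p dvd B u x" if x: "x \<in> set xs" for x
  proof -
    have "p^2 dvd B x a" using spn_perp[OF a2, of x] frame_pairwise[OF f x] by blast
    moreover have "p^2 dvd B y x" using y x by (simp add: Lt_def)
    ultimately have "p^2 dvd p * B u x" unfolding yy by (simp add: B_sym[of x a] dvd_add_right_iff)
    then show ?thesis by (simp only: p2_dvd_mult)
  qed
  then have "p dvd B u z" using spn_perp[of p xs z u] z by (simp add: Lt_def)
  then have "p^2 dvd p * B u z" by (simp only: p2_dvd_mult)
  ultimately show ?thesis unfolding yy by (simp add: B_sym[of a z])
qed

lemma Lt_axpy: "x \<in> Lt xs \<Longrightarrow> y \<in> Lt xs \<Longrightarrow> axpy x t y \<in> Lt xs"
  by (simp add: Lt_def spn_axpy)

lemma Lt_vcong: "vcong (p^2) x y \<Longrightarrow> x \<in> Lt xs \<longleftrightarrow> y \<in> Lt xs"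
  unfolding Lt_def mem_Collect_eq
  using spn_vcong[OF vcong_p2, of x y xs] B_vcong_dvd0[of "p^2" x y _ _, OF _ vcong_refl] by blast

lemma frame_subset_Lt: "frame ws vs xs \<Longrightarrow> set xs \<subseteq> Lt xs"
  using frame_pairwise spn_mem by (auto simp: Lt_def)

lemma card_spn_box: "indep ys \<Longrightarrow> real (card {x \<in> box p. spn p ys x}) = rp ^ length ys"
  using card_spn[of ys] by (simp add: of_bool_def sum.If_cases Int_def)

lemma spn_eq:
  assumes i: "indep zs" "indep xs" "length zs = length xs" and s: "\<And>x. spn p zs x \<Longrightarrow> spn p xs x"
  shows "spn p zs x \<longleftrightarrow> spn p xs x"
proof -
  have "{x \<in> box p. spn p zs x} = {x \<in> box p. spn p xs x}"
  proof (rule card_subset_eq)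
    show "{x \<in> box p. spn p zs x} \<subseteq> {x \<in> box p. spn p xs x}" using s by auto
    have "real (card {x \<in> box p. spn p zs x}) = real (card {x \<in> box p. spn p xs x})"
      using card_spn_box i by simp
    then show "card {x \<in> box p. spn p zs x} = card {x \<in> box p. spn p xs x}" by simp
  qed simp
  then have "spn p zs (red p x) \<longleftrightarrow> spn p xs (red p x)" using red_in_box[OF p_pos] by auto
  then show ?thesis using spn_vcong[OF red_vcong] by blast
qed

lemma frame_indep_Nil: "frame ws [] xs \<Longrightarrow> indep xs"
  using frame_indep[of ws "[]" xs] by simp

text \<open>Equal length forces equal spans modulo p, and \<open>Lt_pair\<close> transfers
  orthogonality from one frame to the other. So any full frame inside a lattice determines
  it.\<close>

lemma Lt_eq:
  assumes x: "frame [] [] xs" and z: "frame [] [] zs" and l: "length zs = length xs" and s: "set zs \<subseteq> Lt xs"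
  shows "Lt zs = Lt xs"
proof -
  have sub: "Lt xs \<subseteq> Lt zs"
    if x: "frame [] [] xs" and z: "frame [] [] zs" and l: "length zs = length xs" and s: "set zs \<subseteq> Lt xs" for xs zs
  proof
    fix y assume y: "y \<in> Lt xs"
    have "spn p zs w \<Longrightarrow> spn p xs w" for w
      by (rule spn_mono[of zs]) (use s in \<open>auto simp: Lt_def\<close>)
    from spn_eq[OF frame_indep_Nil[OF z] frame_indep_Nil[OF x] l this]
    have "spn p zs y" using y by (auto simp: Lt_def)
    moreover have "p^2 dvd B y w" if "w \<in> set zs" for w using Lt_pair[OF x y] s that by blast
    ultimately show "y \<in> Lt zs" by (simp add: Lt_def)
  qed
  have "Lt xs \<subseteq> Lt zs" using sub[OF x z l s] .
  moreover have "set xs \<subseteq> Lt zs" using calculation frame_subset_Lt[OF x] by blast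
  then have "Lt zs \<subseteq> Lt xs" using sub[OF z x l[symmetric]] by blast
  ultimately show ?thesis by blast
qed

text \<open>By \<open>Lt_pair\<close> isotropy and orthogonality hold throughout the lattice, so
  only independence and reducedness remain to be required.\<close>

lemma frame_Cons_in_Lt:
  assumes x: "frame [] [] xs" and y: "frame [] [] ys" "set ys \<subseteq> Lt xs"
  shows "frame [] [] (w # ys) \<and> w \<in> Lt xs \<longleftrightarrow> w \<in> box (p^2) \<and> w \<in> Lt xs \<and> \<not> spn p ys w"
  using y Lt_pair[OF x] by auto

text \<open>
  The number of vectors by which a frame of length \<open>l\<close> in a given lattice can be extended inside it.
\<close>

definition fibre_step :: "nat \<Rightarrow> nat \<Rightarrow> real" where
  "fibre_step d l = rp ^ m / rp ^ d * (rp ^ d - rp ^ l)"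

text \<open>Over a residue in the span of \<open>xs\<close> but not of \<open>ys\<close>, membership
  in the lattice amounts to \<open>length xs\<close> affine equations for the second digit.\<close>

lemma card_fibre_step:
  assumes x: "frame [] [] xs" and y: "frame [] [] ys" "set ys \<subseteq> Lt xs"
  shows "finite {w. frame [] [] (w # ys) \<and> w \<in> Lt xs}"
    "real (card {w. frame [] [] (w # ys) \<and> w \<in> Lt xs}) = fibre_step (length xs) (length ys)"
proof -
  let ?P = "\<lambda>w. spn p xs w \<and> \<not> spn p ys w"
  have e: "{w. frame [] [] (w # ys) \<and> w \<in> Lt xs} = {w \<in> box (p^2). ?P w \<and> (perp (p^2) xs w)}"
    unfolding frame_Cons_in_Lt[OF assms] by (auto simp: Lt_def)
  show "finite {w. frame [] [] (w # ys) \<and> w \<in> Lt xs}" unfolding e by simp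
  have sub: "spn p xs w" if "spn p ys w" for w
    by (rule spn_mono[OF _ that]) (use y in \<open>auto simp: Lt_def\<close>)
  have perp: "p dvd B w z" if "spn p xs w" "z \<in> set xs" for w z
  proof -
    have "p dvd B z w"
      by (rule spn_perp[OF that(1)]) (use frame_pairwise[OF x that(2)] p2_dvd_p in blast)
    then show ?thesis by (simp only: B_sym)
  qed
  have "real (card {w \<in> box (p^2). ?P w \<and> (perp (p^2) xs w)}) =
     (\<Sum>w\<in>box (p^2). of_bool (?P w \<and> (perp (p^2) xs w)))"
    by (simp add: of_bool_def sum.If_cases Int_def)
  also have "\<dots> = rp ^ m / rp ^ length xs * (\<Sum>w\<in>box p. of_bool (?P w \<and> (perp p xs w)))"
  proof (rule lift_count_perp[OF frame_indep_Nil[OF x]])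
    show "per p ?P"
    proof (rule perI)
      fix x x' assume xx: "vcong p x x'"
      show "?P x = ?P x'" using spn_vcong[OF xx] by blast
    qed
  qed
  also have "(\<Sum>w\<in>box p. of_bool (?P w \<and> (perp p xs w)) :: real) =
      (\<Sum>w\<in>box p. of_bool (spn p xs w) - of_bool (spn p ys w))"
  proof (intro sum.cong refl)
    fix w
    show "of_bool (?P w \<and> (perp p xs w)) = (of_bool (spn p xs w) - of_bool (spn p ys w) :: real)"
      using perp[of w] sub[of w] by (auto simp: of_bool_def)
  qed
  also have "\<dots> = rp ^ length xs - rp ^ length ys"
    unfolding sum_subtractf card_spn[OF frame_indep_Nil[OF x]] card_spn[OF frame_indep_Nil[OF y(1)]] ..
  finally show "real (card {w. frame [] [] (w # ys) \<and> w \<in> Lt xs}) = fibre_step (length xs) (length ys)"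
    unfolding e fibre_step_def .
qed

lemma card_fibre:
  assumes x: "frame [] [] xs" and z: "frame [] [] zs" "set zs \<subseteq> Lt xs"
  shows "finite {us. length us = n \<and> frame [] [] (us @ zs) \<and> set us \<subseteq> Lt xs}"
    "real (card {us. length us = n \<and> frame [] [] (us @ zs) \<and> set us \<subseteq> Lt xs}) =
      (\<Prod>j<n. fibre_step (length xs) (j + length zs))"
proof -
  have "finite {us. length us = n \<and> frame [] [] (us @ zs) \<and> set us \<subseteq> Lt xs} \<and>
    real (card {us. length us = n \<and> frame [] [] (us @ zs) \<and> set us \<subseteq> Lt xs}) =
      (\<Prod>j<n. fibre_step (length xs) (j + length zs))"
  proof (rule card_list_extensions)
    fix us assume u: "frame [] [] (us @ zs) \<and> set us \<subseteq> Lt xs"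
    then have "{w. frame [] [] ((w # us) @ zs) \<and> set (w # us) \<subseteq> Lt xs} =
        {w. frame [] [] (w # (us @ zs)) \<and> w \<in> Lt xs}" by auto
    then show "finite {w. frame [] [] ((w # us) @ zs) \<and> set (w # us) \<subseteq> Lt xs} \<and>
       real (card {w. frame [] [] ((w # us) @ zs) \<and> set (w # us) \<subseteq> Lt xs}) = fibre_step (length xs) (length us + length zs)"
      using card_fibre_step[OF x, of "us @ zs"] u z by simp
  qed (use z in auto)
  then show "finite {us. length us = n \<and> frame [] [] (us @ zs) \<and> set us \<subseteq> Lt xs}"
    "real (card {us. length us = n \<and> frame [] [] (us @ zs) \<and> set us \<subseteq> Lt xs}) =
      (\<Prod>j<n. fibre_step (length xs) (j + length zs))" by auto
qed

section \<open>Counting the lattices that contain a given vector\<close>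

definition lattices :: "nat \<Rightarrow> ivec set set" where
  "lattices d = Lt ` {xs. length xs = d \<and> frame [] [] xs}"

lemma finite_frames: "finite {xs. length xs = d \<and> frame [] [] (xs @ zs)}"
proof (rule finite_subset)
  show "{xs. length xs = d \<and> frame [] [] (xs @ zs)} \<subseteq> {xs. set xs \<subseteq> box (p^2) \<and> length xs = d}"
    using frame_box by fastforce
qed (simp add: finite_lists_length_eq)

lemma finite_lattices: "finite (lattices d)"
  using finite_frames[of d "[]"] by (simp add: lattices_def)

text \<open>Double counting: by \<open>Lt_eq\<close> the fibre over a lattice containing
  \<open>zs\<close> consists of the frames inside it that extend \<open>zs\<close>. The condition
  \<open>C\<close> depends on the lattice only, hence is constant on fibres.\<close>

lemma card_lattices_frames:
  assumes z: "frame [] [] zs" and n: "d = n + length zs"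
  shows "real (card {us. length us = n \<and> frame [] [] (us @ zs) \<and> C (Lt (us @ zs))}) =
    real (card {L \<in> lattices d. set zs \<subseteq> L \<and> C L}) * (\<Prod>j<n. fibre_step d (j + length zs))"
proof -
  let ?S = "{us. length us = n \<and> frame [] [] (us @ zs) \<and> C (Lt (us @ zs))}"
  let ?T = "{L \<in> lattices d. set zs \<subseteq> L \<and> C L}"
  have fS: "finite ?S" using finite_frames[of n zs] by (rule rev_finite_subset) auto
  have fT: "finite ?T" using finite_lattices by simp
  have im: "(\<lambda>us. Lt (us @ zs)) ` ?S \<subseteq> ?T"
  proof (intro image_subsetI)
    fix us assume u: "us \<in> ?S"
    then have "set (us @ zs) \<subseteq> Lt (us @ zs)" using frame_subset_Lt by blast
    moreover have "Lt (us @ zs) \<in> lattices d" unfolding lattices_def using u n by (intro imageI) simp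
    ultimately show "Lt (us @ zs) \<in> ?T" using u by simp
  qed
  have fib: "real (card {us \<in> ?S. Lt (us @ zs) = L}) = (\<Prod>j<n. fibre_step d (j + length zs))" if L: "L \<in> ?T" for L
  proof -
    obtain xs where xs: "length xs = d" "frame [] [] xs" "L = Lt xs" using L by (auto simp: lattices_def)
    have "{us \<in> ?S. Lt (us @ zs) = L} = {us. length us = n \<and> frame [] [] (us @ zs) \<and> set us \<subseteq> Lt xs}"
    proof (intro equalityI subsetI)
      fix us assume "us \<in> {us \<in> ?S. Lt (us @ zs) = L}"
      then show "us \<in> {us. length us = n \<and> frame [] [] (us @ zs) \<and> set us \<subseteq> Lt xs}"
        using frame_subset_Lt[of "[]" "[]" "us @ zs"] xs(3) by auto
    next
      fix us assume u: "us \<in> {us. length us = n \<and> frame [] [] (us @ zs) \<and> set us \<subseteq> Lt xs}"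
      then have "Lt (us @ zs) = Lt xs" using xs L n by (intro Lt_eq) auto
      then show "us \<in> {us \<in> ?S. Lt (us @ zs) = L}" using u xs(3) L by simp
    qed
    then show ?thesis using card_fibre[OF xs(2) z, of n] L xs by simp
  qed
  have "real (card ?S) = (\<Sum>us\<in>?S. 1)" by simp
  also have "\<dots> = (\<Sum>L\<in>?T. \<Sum>us | us \<in> ?S \<and> Lt (us @ zs) = L. 1)"
    by (rule sum.group[OF fS fT im, symmetric])
  also have "\<dots> = (\<Sum>L\<in>?T. real (card {us \<in> ?S. Lt (us @ zs) = L}))" by simp
  also have "\<dots> = real (card ?T) * (\<Prod>j<n. fibre_step d (j + length zs))"
    using fib by simp
  finally show ?thesis .
qed

lemma card_lattices_all:
  "real (card (lattices d)) * (\<Prod>j<d. fibre_step d j) = (\<Prod>j<d. frame_step [] [] j)"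
  using card_lattices_frames[of "[]" d d "\<lambda>_. True"] card_frames(2)[of "[]" "[]" "[]" d] frame_indep_Nil by simp

lemma frame_single:
  assumes "\<not> (\<forall>i<m. p dvd K i)" "p^2 dvd B K K"
  shows "frame [] [] [red (p^2) K]"
proof -
  have v: "vcong (p^2) (red (p^2) K) K" by (rule red_vcong)
  have "\<not> spn p [] (red (p^2) K)" using spn_vcong[OF vcong_p2[OF v], of "[]"] assms(1) by simp
  moreover have "p^2 dvd B (red (p^2) K) (red (p^2) K)" using B_vcong_dvd0[OF v v] assms(2) by simp
  ultimately show ?thesis using red_in_box[OF p2_pos] by simp
qed

lemma lattices_vcong: "L \<in> lattices d \<Longrightarrow> vcong (p^2) x y \<Longrightarrow> x \<in> L \<longleftrightarrow> y \<in> L"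
  using Lt_vcong by (auto simp: lattices_def)

lemma card_lattices_primitive:
  assumes K: "\<not> (\<forall>i<m. p dvd K i)" "p^2 dvd B K K" and d: "d = Suc n"
  shows "real (card {L \<in> lattices d. K \<in> L}) * (\<Prod>j<n. fibre_step d (Suc j)) = (\<Prod>j<n. frame_step [] [] (Suc j))"
proof -
  have "{L \<in> lattices d. set [red (p^2) K] \<subseteq> L \<and> True} = {L \<in> lattices d. K \<in> L}"
    using lattices_vcong[OF _ red_vcong] by auto
  then show ?thesis
    using card_lattices_frames[OF frame_single[OF K], of d n "\<lambda>_. True"]
      card_frames(2)[of "[]" "[]" "[red (p^2) K]" n] frame_single[OF K] frame_indep_Nil d by simp
qed

lemma scaled_in_Lt: "(\<lambda>i. p * u i) \<in> Lt xs \<longleftrightarrow> (\<forall>x\<in>set xs. p dvd B x u)"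
proof -
  have "(\<lambda>i. p * u i) = axpy (\<lambda>_. 0) p u" by (simp add: axpy_def)
  then have "B (\<lambda>i. p * u i) x = p * B x u" for x by (simp add: B_sym[of u])
  moreover have "spn p xs (\<lambda>i. p * u i)" by (rule spn_small) simp
  ultimately show ?thesis by (simp add: Lt_def p2_dvd_mult)
qed

lemma frame_perp_iff: "frame [u] [] xs \<longleftrightarrow> frame [] [] xs \<and> (\<lambda>i. p * u i) \<in> Lt xs"
  unfolding scaled_in_Lt by (induction xs) auto

lemma spn_snoc: "spn n (ys @ [u]) x \<longleftrightarrow> spn n (u # ys) x"
  using spn_subset[of "ys @ [u]" "u # ys" n x] spn_subset[of "u # ys" "ys @ [u]" n x] by auto

lemma spn_exchange:
  assumes "spn p (a # ys) b" "\<not> spn p ys b"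
  shows "spn p (b # ys) a"
proof -
  obtain c where c: "spn p ys (axpy b (- c) a)" using assms(1) by auto
  have "\<not> p dvd c"
  proof
    assume "p dvd c"
    then have "vcong p (axpy b (- c) a) b" by (simp add: vcong_def)
    then show False using c assms(2) spn_vcong by blast
  qed
  moreover have "spn p (b # ys) (axpy b (- 1) (axpy b (- c) a))"
    by (rule spn_axpy[OF spn_mem spn_Cons_self[OF c]]) simp
  moreover have "axpy b (- 1) (axpy b (- c) a) = (\<lambda>i. c * a i)" by (simp add: axpy_def)
  ultimately show ?thesis using spn_smult_cancel by metis
qed

lemma indep_snoc: "indep (us @ [u]) \<longleftrightarrow> indep us \<and> \<not> spn p us u"
proof (induction us)
  case (Cons x us)
  have "\<not> spn p (u # us) x \<and> \<not> spn p us u \<longleftrightarrow> \<not> spn p us x \<and> \<not> spn p (x # us) u"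
    using spn_exchange spn_Cons_self by blast
  then show ?case using Cons by (simp only: append_Cons indep.simps spn_snoc) blast
qed simp

text \<open>On the left each new vector avoids the span of the earlier ones and \<open>u\<close>; on
  the right \<open>u\<close> avoids the span of all of them. The exchange property makes the two
  agree step by step.\<close>

lemma frame_perp_indep_iff:
  assumes "\<not> (\<forall>i<m. p dvd u i)"
  shows "frame [u] [u] xs \<longleftrightarrow> frame [] [] xs \<and> (\<lambda>i. p * u i) \<in> Lt xs \<and> \<not> spn p xs u"
  unfolding scaled_in_Lt
proof (induction xs)
  case Nil
  then show ?case using assms by simp
next
  case (Cons x xs)
  have "\<not> spn p (xs @ [u]) x \<and> \<not> spn p xs u \<longleftrightarrow> \<not> spn p xs x \<and> \<not> spn p (x # xs) u"
    unfolding spn_snoc using spn_exchange spn_Cons_self by blast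
  then show ?case using Cons.IH by (simp only: frame.simps list.set append_Nil2 ball_simps) blast
qed

text \<open>An anisotropic \<open>u\<close> never lies in the span of vectors orthogonal to it, so
  independence of \<open>ys @ [u]\<close> is automatic and \<open>vs\<close> can be empty.\<close>

lemma card_lattices_anisotropic:
  assumes u: "\<not> p dvd B u u"
  shows "real (card {L \<in> lattices d. (\<lambda>i. p * u i) \<in> L}) * (\<Prod>j<d. fibre_step d j) = (\<Prod>j<d. frame_step [u] [] j)"
proof -
  have "indep (ys @ [u])" if f: "frame [u] [] ys" for ys
  proof -
    have "p dvd B u y" if "y \<in> set ys" for y using frame_perp[OF f that] B_sym by simp
    then have "\<not> spn p ys u" using spn_perp u by blast
    then show ?thesis using frame_indep_Nil[OF f] by (simp add: indep_snoc)
  qed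
  from card_frames(2)[OF this, where vs = "[]" and zs = "[]" and n = d]
  have "real (card {xs. length xs = d \<and> frame [u] [] xs}) = (\<Prod>j<d. frame_step [u] [] j)" by simp
  moreover have "real (card {xs. length xs = d \<and> frame [] [] xs \<and> (\<lambda>i. p * u i) \<in> Lt xs}) =
     real (card {L \<in> lattices d. (\<lambda>i. p * u i) \<in> L}) * (\<Prod>j<d. fibre_step d j)"
    using card_lattices_frames[of "[]" d d "\<lambda>L. (\<lambda>i. p * u i) \<in> L"] by simp
  ultimately show ?thesis unfolding frame_perp_iff by simp
qed

lemma card_lifts_in_Lt:
  assumes f: "frame [] [] xs" and u: "spn p xs u"
  shows "real (card {z \<in> box (p^2). vcong p z u \<and> z \<in> Lt xs}) = rp ^ m / rp ^ length xs"
proof -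
  have "spn p xs z" if "vcong p z u" for z using that u spn_vcong by blast
  then have "{z \<in> box (p^2). vcong p z u \<and> z \<in> Lt xs} = {z \<in> box (p^2). vcong p z u \<and> (perp (p^2) xs z)}"
    by (auto simp: Lt_def)
  then have "real (card {z \<in> box (p^2). vcong p z u \<and> z \<in> Lt xs}) =
      (\<Sum>z\<in>box (p^2). of_bool (vcong p z u \<and> (perp (p^2) xs z)))"
    by (simp add: of_bool_def sum.If_cases Int_def)
  also have "\<dots> = rp ^ m / rp ^ length xs * (\<Sum>z\<in>box p. of_bool (vcong p z u \<and> (perp p xs z)))"
    by (rule lift_count_perp[OF frame_indep_Nil[OF f]]) (auto intro!: perI dest: vcong_trans vcong_sym)
  also have "(\<Sum>z\<in>box p. of_bool (vcong p z u \<and> (perp p xs z)) :: real) =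
      (\<Sum>z\<in>box p. if z = red p u then 1 else 0)"
  proof (intro sum.cong refl)
    fix z assume z: "z \<in> box p"
    have "p dvd B z x" if zu: "vcong p z u" and x: "x \<in> set xs" for x
    proof -
      have "p dvd B x u" using frame_pairwise[OF f x] p2_dvd_p by (intro spn_perp[OF u]) blast
      then show ?thesis using B_vcong_dvd0[OF zu vcong_refl, of x] by (simp add: B_sym)
    qed
    moreover have "vcong p z u \<longleftrightarrow> z = red p u"
      using box_vcong_eq[OF z red_in_box[OF p_pos]] red_vcong vcong_trans vcong_sym by blast
    ultimately show "of_bool (vcong p z u \<and> (perp p xs z)) = (if z = red p u then 1 else (0::real))"
      by auto
  qed
  also have "\<dots> = 1" using red_in_box[OF p_pos] by simp
  finally show ?thesis by simp
qed

text \<open>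
  For \<open>L = Lt xs\<close> this says that \<open>u\<close> lies in the isotropic subspace spanned by \<open>xs\<close> modulo \<open>p\<close>.
\<close>

definition meets :: "ivec \<Rightarrow> ivec set \<Rightarrow> bool" where
  "meets u L \<longleftrightarrow> (\<exists>y\<in>L. vcong p y u)"

text \<open>A residue in the span lifts into the lattice because the number of its lifts, given by
  \<open>card_lifts_in_Lt\<close>, is positive.\<close>

lemma meets_Lt: assumes f: "frame [] [] xs" shows "meets u (Lt xs) \<longleftrightarrow> spn p xs u"
proof
  assume "meets u (Lt xs)"
  then show "spn p xs u" using spn_vcong by (auto simp: meets_def Lt_def)
next
  assume u: "spn p xs u"
  have "real (card {z \<in> box (p^2). vcong p z u \<and> z \<in> Lt xs}) > 0"
    unfolding card_lifts_in_Lt[OF f u] using p_pos by simp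
  then have "{z \<in> box (p^2). vcong p z u \<and> z \<in> Lt xs} \<noteq> {}" by (metis card.empty of_nat_0 less_irrefl)
  then show "meets u (Lt xs)" by (auto simp: meets_def)
qed

lemma card_lattices_not_meeting:
  assumes u: "\<not> (\<forall>i<m. p dvd u i)" "p dvd B u u"
  shows "real (card {L \<in> lattices d. (\<lambda>i. p * u i) \<in> L \<and> \<not> meets u L}) * (\<Prod>j<d. fibre_step d j) =
    (\<Prod>j<d. frame_step [u] [u] j)"
proof -
  have iu: "indep [u]" using u by simp
  have "indep (ys @ [u])" if f: "frame [u] [u] ys" for ys by (rule frame_indep[OF f iu])
  from card_frames(2)[OF this iu, of "[]" d] u(2)
  have "real (card {xs. length xs = d \<and> frame [u] [u] xs}) = (\<Prod>j<d. frame_step [u] [u] j)" by simp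
  moreover have "real (card {xs. length xs = d \<and> frame [] [] xs \<and> ((\<lambda>i. p * u i) \<in> Lt xs \<and> \<not> meets u (Lt xs))}) =
     real (card {L \<in> lattices d. (\<lambda>i. p * u i) \<in> L \<and> \<not> meets u L}) * (\<Prod>j<d. fibre_step d j)"
    using card_lattices_frames[of "[]" d d "\<lambda>L. (\<lambda>i. p * u i) \<in> L \<and> \<not> meets u L"] by simp
  moreover have "{xs. length xs = d \<and> frame [] [] xs \<and> ((\<lambda>i. p * u i) \<in> Lt xs \<and> \<not> meets u (Lt xs))} =
     {xs. length xs = d \<and> frame [u] [u] xs}"
    using frame_perp_indep_iff[OF u(1)] meets_Lt by auto
  ultimately show ?thesis by simp
qed

text \<open>
  Double counting of the pairs of a lattice \<open>L\<close> and an isotropic lift of \<open>u\<close> modulo \<open>p\<^sup>2\<close> lying in \<open>L\<close>.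
\<close>

lemma card_lattices_meeting:
  assumes u: "\<not> (\<forall>i<m. p dvd u i)" "p dvd B u u" and d: "d = Suc n"
  shows "real (card {L \<in> lattices d. meets u L}) * (rp ^ m / rp ^ d) * (\<Prod>j<n. fibre_step d (Suc j)) =
    rp ^ m / rp * (\<Prod>j<n. frame_step [] [] (Suc j))"
proof -
  let ?U = "{L \<in> lattices d. meets u L}"
  let ?T = "{z \<in> box (p^2). vcong p z u \<and> p^2 dvd B z z}"
  let ?\<Phi> = "\<Prod>j<n. fibre_step d (Suc j)"
  let ?F = "\<Prod>j<n. frame_step [] [] (Suc j)"
  have finU: "finite ?U" using finite_lattices by simp
  \<comment> \<open>Isotropy modulo \<open>p^2\<close> is one nondegenerate affine equation for the
    second digit of a lift, as \<open>u\<close> is nonzero modulo p.\<close>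
  have T: "real (card ?T) = rp ^ m / rp"
  proof -
    have "real (card ?T) = (\<Sum>z\<in>box (p^2). of_bool (vcong p z u \<and> p^2 dvd B z z \<and> (perp (p^2) [] z)))"
      by (simp add: of_bool_def sum.If_cases Int_def)
    also have "\<dots> = rp ^ m / rp ^ Suc (length ([] :: ivec list)) *
        (\<Sum>z\<in>box p. of_bool (vcong p z u \<and> p dvd B z z \<and> (perp p [] z)))"
    proof (rule lift_count_isotropic)
      show "\<not> spn p [] z" if "vcong p z u" for z
        using spn_vcong[OF that, of "[]"] u(1) by simp
    qed (auto intro!: perI dest: vcong_trans vcong_sym)
    also have "(\<Sum>z\<in>box p. of_bool (vcong p z u \<and> p dvd B z z \<and> (perp p [] z)) :: real) =
        (\<Sum>z\<in>box p. if z = red p u then 1 else 0)"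
    proof (intro sum.cong refl)
      fix z assume z: "z \<in> box p"
      have "vcong p z u \<longleftrightarrow> z = red p u"
        using box_vcong_eq[OF z red_in_box[OF p_pos]] red_vcong vcong_trans vcong_sym by blast
      moreover have "p dvd B z z" if "vcong p z u" using B_vcong_dvd0[OF that that] u(2) by simp
      ultimately show "of_bool (vcong p z u \<and> p dvd B z z \<and> (perp p [] z)) = (if z = red p u then 1 else (0::real))"
        by auto
    qed
    also have "\<dots> = 1" using red_in_box[OF p_pos] by simp
    finally show ?thesis by simp
  qed
  have per_T: "real (card {L \<in> lattices d. z \<in> L}) * ?\<Phi> = ?F" if z: "z \<in> ?T" for z
  proof -
    have "\<not> spn p [] z" using spn_vcong[of p z u "[]"] z u(1) by simp
    then show ?thesis using card_lattices_primitive[OF _ _ d, of z] z by simp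
  qed
  \<comment> \<open>Isotropy of \<open>z\<close> is automatic inside \<open>L\<close>, so only the
    \<open>d\<close> equations of the lattice remain.\<close>
  have per_L: "real (card {z \<in> ?T. z \<in> L}) = rp ^ m / rp ^ d" if L: "L \<in> ?U" for L
  proof -
    obtain xs where xs: "length xs = d" "frame [] [] xs" "L = Lt xs" using L by (auto simp: lattices_def)
    have "{z \<in> ?T. z \<in> L} = {z \<in> box (p^2). vcong p z u \<and> z \<in> Lt xs}"
      using Lt_pair[OF xs(2)] xs(3) by auto
    moreover have "spn p xs u" using L xs meets_Lt by auto
    ultimately show ?thesis using card_lifts_in_Lt[OF xs(2)] xs(1) by simp
  qed
  have "(\<Sum>z\<in>?T. \<Sum>L\<in>lattices d. of_bool (z \<in> L) :: real) * ?\<Phi> = (\<Sum>z\<in>?T. ?F)"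
  proof -
    have e: "(\<Sum>L\<in>lattices d. of_bool (z \<in> L) :: real) = real (card {L \<in> lattices d. z \<in> L})" for z
      using finite_lattices by (simp add: of_bool_def sum.If_cases Int_def)
    show ?thesis unfolding e sum_distrib_right using per_T by (intro sum.cong refl)
  qed
  then have 1: "(\<Sum>z\<in>?T. \<Sum>L\<in>lattices d. of_bool (z \<in> L) :: real) * ?\<Phi> = rp ^ m / rp * ?F"
    using T by simp
  have "(\<Sum>z\<in>?T. \<Sum>L\<in>lattices d. of_bool (z \<in> L) :: real) = (\<Sum>z\<in>?T. \<Sum>L\<in>?U. of_bool (z \<in> L))"
    by (intro sum.cong sum.mono_neutral_right refl finite_lattices) (auto simp: meets_def)
  also have "\<dots> = (\<Sum>L\<in>?U. \<Sum>z\<in>?T. of_bool (z \<in> L))" by (rule sum.swap)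
  also have "\<dots> = (\<Sum>L\<in>?U. rp ^ m / rp ^ d)"
  proof (rule sum.cong[OF refl])
    fix L assume L: "L \<in> ?U"
    have "(\<Sum>z\<in>?T. of_bool (z \<in> L) :: real) = real (card {z \<in> ?T. z \<in> L})"
      by (simp add: of_bool_def sum.If_cases Int_def)
    then show "(\<Sum>z\<in>?T. of_bool (z \<in> L) :: real) = rp ^ m / rp ^ d" using per_L[OF L] by simp
  qed
  finally show ?thesis using 1 by simp
qed

text \<open>If \<open>y\<close> in \<open>L\<close> lifts \<open>u\<close>, then \<open>p y\<close>
  lies in \<open>L\<close> and is congruent to \<open>p u\<close> modulo \<open>p^2\<close>; so
  every lattice that meets \<open>u\<close> contains \<open>p u\<close>.\<close>

lemma card_lattices_isotropic:
  "card {L \<in> lattices d. (\<lambda>i. p * u i) \<in> L} =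
   card {L \<in> lattices d. (\<lambda>i. p * u i) \<in> L \<and> \<not> meets u L} + card {L \<in> lattices d. meets u L}"
proof -
  have "(\<lambda>i. p * u i) \<in> L" if L: "L \<in> lattices d" and mt: "meets u L" for L
  proof -
    obtain xs where xs: "L = Lt xs" using L by (auto simp: lattices_def)
    obtain y where y: "y \<in> L" "vcong p y u" using mt by (auto simp: meets_def)
    \<comment> \<open>This vector is \<open>p y\<close>.\<close>
    have "axpy y (p - 1) y \<in> L" using Lt_axpy y(1) xs by blast
    moreover have "vcong (p^2) (axpy y (p - 1) y) (\<lambda>i. p * u i)"
      unfolding vcong_def
    proof (intro allI impI)
      fix i assume "i < m"
      then have "p^2 dvd p * (y i - u i)" using y(2) by (simp only: p2_dvd_mult vcong_def)
      then show "p^2 dvd axpy y (p - 1) y i - p * u i" by (simp add: algebra_simps)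
    qed
    ultimately show ?thesis using lattices_vcong[OF L] by blast
  qed
  then have "{L \<in> lattices d. (\<lambda>i. p * u i) \<in> L} =
     {L \<in> lattices d. (\<lambda>i. p * u i) \<in> L \<and> \<not> meets u L} \<union> {L \<in> lattices d. meets u L}" by auto
  then show ?thesis using finite_lattices by (simp add: card_Un_disjoint disjoint_iff)
qed

end

section \<open>The lattice counts\<close>

text \<open>Reversing the order of factors turns \<open>P ^ d - P ^ s\<close> into the denominators
  of \<open>alpha\<close>; the extra factor \<open>P\<close> in each of the \<open>d - 1\<close>
  terms accounts for \<open>P powi (1 - int d)\<close>.\<close>

lemma prod_frame_over_fibre:
  fixes P :: real
  assumes P: "P > 1" and d: "1 \<le> d" "d \<le> k"
  shows "(\<Prod>s=1..d-1. P ^ (2 * k) * (P ^ (2 * (k - s)) - 1)) =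
    P powi (1 - int d) * (\<Prod>s=1..d-1. (P ^ (2 * (k - s)) - 1) / (1 - P powi (- int s))) *
    (\<Prod>s=1..d-1. P ^ (2 * k + 1 - d) * (P ^ d - P ^ s))"
proof -
  let ?I = "{1..d-1}"
  have rev: "(\<Prod>s=1..d-1. 1 - P powi (- int s)) = (\<Prod>s=1..d-1. 1 - P powi (- int (d - s)))"
    using d by (subst prod.atLeastAtMost_rev) simp
  have fib: "P ^ (2 * k + 1 - d) * (P ^ d - P ^ s) = P ^ (2 * k) * (P * (1 - P powi (- int (d - s))))" if "s \<in> ?I" for s
  proof -
    have "s \<le> d" using that by auto
    then obtain e where e: "d = s + e" using le_Suc_ex by blast
    have "P ^ (2 * k) * P = P ^ (2 * k + 1 - d + d)" using d by simp
    then have 1: "P ^ (2 * k) * P = P ^ (2 * k + 1 - d) * P ^ d" by (simp only: power_add)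
    moreover have "P ^ d * (1 - P powi (- int (d - s))) = P ^ d - P ^ s"
      using P by (simp add: e power_int_minus algebra_simps power_add)
    ultimately show ?thesis using 1 by (metis mult.assoc)
  qed
  have nz: "1 - P powi (- int s) \<noteq> 0" if "s \<in> ?I" for s
  proof -
    have "P ^ s > 1" using P that by (intro one_less_power) auto
    then show ?thesis by (simp add: power_int_minus field_simps)
  qed
  have Pd: "P powi (1 - int d) * P ^ (d - 1) = 1"
  proof -
    have "1 - int d = - int (d - 1)" using d by simp
    moreover have "P powi (- int n) * P ^ n = 1" for n using P by (simp add: power_int_minus)
    ultimately show ?thesis by metis
  qed
  have "(\<Prod>s=1..d-1. P ^ (2 * k + 1 - d) * (P ^ d - P ^ s)) =
      (\<Prod>s=1..d-1. P ^ (2 * k) * (P * (1 - P powi (- int (d - s)))))"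
    by (rule prod.cong[OF refl fib])
  also have "\<dots> = (\<Prod>s\<in>?I. P ^ (2 * k)) * ((\<Prod>s\<in>?I. P) * (\<Prod>s=1..d-1. 1 - P powi (- int s)))"
    by (simp only: prod.distrib rev)
  also have "(\<Prod>s\<in>?I. P) = P ^ (d - 1)" by simp
  finally have fibre: "(\<Prod>s=1..d-1. P ^ (2 * k + 1 - d) * (P ^ d - P ^ s)) =
      (\<Prod>s\<in>?I. P ^ (2 * k)) * (P ^ (d - 1) * (\<Prod>s=1..d-1. 1 - P powi (- int s)))" .
  have Gnz: "(\<Prod>s=1..d-1. 1 - P powi (- int s)) \<noteq> 0" using nz by (simp add: prod_zero_iff)
  have alg: "C * N = w * (N / G) * (C * (z * G))" if "w * z = 1" "G \<noteq> 0" for C N G w z :: real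
  proof -
    have "w * (N / G) * (C * (z * G)) = (w * z) * C * (N / G * G)" by (simp only: mult_ac)
    then show ?thesis using that by simp
  qed
  have "(\<Prod>s=1..d-1. P ^ (2 * k) * (P ^ (2 * (k - s)) - 1)) = (\<Prod>s\<in>?I. P ^ (2 * k)) * (\<Prod>s=1..d-1. P ^ (2 * (k - s)) - 1)"
    by (simp only: prod.distrib)
  then show ?thesis unfolding fibre prod_dividef by (rule trans) (rule alg[OF Pd Gnz])
qed

text \<open>
  The first factor of index \<open>l\<close> and the second one of index \<open>l + 1\<close> multiply to \<open>P ^ (2 * (k - l - 1)) - 1\<close>.
\<close>

lemma prod_anisotropic_frames:
  fixes P \<eta> :: real
  assumes e: "\<eta> * \<eta> = 1" and d: "Suc n \<le> k"
  shows "(\<Prod>l<Suc n. P ^ (2 * k) * ((P ^ (k - l - 1) + \<eta>) * (P ^ (k - l) - \<eta>))) =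
    P ^ (2 * k) * ((P ^ k - \<eta>) * (P ^ (k - Suc n) + \<eta>)) * (\<Prod>s=1..n. P ^ (2 * k) * (P ^ (2 * (k - s)) - 1))"
  using d
proof (induction n)
  case 0
  then show ?case by simp
next
  case (Suc n)
  have "(P ^ x + \<eta>) * (P ^ x - \<eta>) = P ^ (2 * x) - 1" for x
    using e by (simp add: algebra_simps mult_2_right power_add)
  then have step: "P ^ (2 * k) * ((P ^ k - \<eta>) * (P ^ (k - Suc n) + \<eta>)) *
      (P ^ (2 * k) * ((P ^ (k - Suc n - 1) + \<eta>) * (P ^ (k - Suc n) - \<eta>))) =
      P ^ (2 * k) * ((P ^ k - \<eta>) * (P ^ (k - Suc (Suc n)) + \<eta>)) * (P ^ (2 * k) * (P ^ (2 * (k - Suc n)) - 1))"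
    by (simp add: mult_ac)
  have "(\<Prod>l<Suc (Suc n). P ^ (2 * k) * ((P ^ (k - l - 1) + \<eta>) * (P ^ (k - l) - \<eta>))) =
      P ^ (2 * k) * ((P ^ k - \<eta>) * (P ^ (k - Suc n) + \<eta>)) * (\<Prod>s=1..n. P ^ (2 * k) * (P ^ (2 * (k - s)) - 1)) *
      (P ^ (2 * k) * ((P ^ (k - Suc n - 1) + \<eta>) * (P ^ (k - Suc n) - \<eta>)))"
    unfolding prod.lessThan_Suc[of _ "Suc n"] using Suc by simp
  also have "\<dots> = (P ^ (2 * k) * ((P ^ k - \<eta>) * (P ^ (k - Suc n) + \<eta>)) *
      (P ^ (2 * k) * ((P ^ (k - Suc n - 1) + \<eta>) * (P ^ (k - Suc n) - \<eta>)))) * (\<Prod>s=1..n. P ^ (2 * k) * (P ^ (2 * (k - s)) - 1))"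
    by (simp only: mult_ac)
  also have "\<dots> = P ^ (2 * k) * ((P ^ k - \<eta>) * (P ^ (k - Suc (Suc n)) + \<eta>)) *
      ((\<Prod>s=1..n. P ^ (2 * k) * (P ^ (2 * (k - s)) - 1)) * (P ^ (2 * k) * (P ^ (2 * (k - Suc n)) - 1)))"
    unfolding step by (simp only: mult_ac)
  also have "(\<Prod>s=1..n. P ^ (2 * k) * (P ^ (2 * (k - s)) - 1)) * (P ^ (2 * k) * (P ^ (2 * (k - Suc n)) - 1)) =
      (\<Prod>s=1..Suc n. P ^ (2 * k) * (P ^ (2 * (k - s)) - 1))"
    by simp
  finally show ?case .
qed

context quad_space
begin

lemma prod_lessThan_Suc: "(\<Prod>j<d - 1. f (Suc j)) = (\<Prod>s=1..d - 1. f s :: real)"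
  by (rule prod.reindex_bij_witness[where i = "\<lambda>s. s - 1" and j = Suc]) auto

context
  fixes k d :: nat
  assumes m: "m = 2 * k + 1" and d: "1 \<le> d" "d \<le> k"
begin

lemma rp_gt: "rp > 1" using p_gt_2 by simp

lemma fibre_step_eq: "fibre_step d l = rp ^ (2 * k + 1 - d) * (rp ^ d - rp ^ l)"
  unfolding fibre_step_def using d rp_gt by (simp add: m power_diff)

lemma frame_step_eq: assumes "l \<le> k" shows "frame_step [] [] l = rp ^ (2 * k) * (rp ^ (2 * (k - l)) - 1)"
proof -
  obtain e where e: "k = l + e" using assms le_Suc_ex by blast
  have "cone_count [] = rp ^ (2 * k)" by (rule cone_count_Nil[OF m])
  then show ?thesis unfolding frame_step_def using rp_gt
    by (simp add: m e field_simps power_add power_mult power2_eq_square mult_2)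
qed

text \<open>Modulo p an isotropic \<open>u\<close> acts as one more member of the frame, so the
  residues are those of a frame of length \<open>Suc l\<close>. Orthogonality to \<open>u\<close> is
  required only modulo p, which is one equation fewer for the second digit and gives the factor
  p.\<close>

lemma frame_step_isotropic_eq:
  assumes u: "\<not> (\<forall>i<m. p dvd u i)" "p dvd B u u" and l: "l < k"
  shows "frame_step [u] [u] l = rp * frame_step [] [] (Suc l)"
proof -
  have "Suc l \<le> k" using l by simp
  then obtain e where e: "k = Suc l + e" using le_Suc_ex by blast
  have "cone_count [u] = rp ^ (2 * k) - (rp ^ m - rp ^ m / rp) / rp"
    using cone_count_Cons[of u "[]"] u cone_count_Nil[OF m] by simp
  moreover have "frame_step [] [] (Suc l) = rp ^ (2 * k) * (rp ^ (2 * (k - Suc l)) - 1)"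
    using frame_step_eq l by simp
  \<comment> \<open>In terms of \<open>rp\<close>, \<open>x\<close> and \<open>y\<close> all powers
    become monomials, and the claim is a rational identity.\<close>
  moreover define x y where "x = rp ^ l" and "y = rp ^ e"
  have pw: "rp ^ m = x * x * y * y * rp * rp * rp" "rp ^ (2 * k) = x * x * y * y * rp * rp"
    "rp ^ Suc l = x * rp" "rp ^ (l + length [u]) = x * rp" "rp ^ (2 * (k - Suc l)) = y * y" "rp ^ length [u] = rp"
    by (simp_all add: m e x_def y_def power_add mult_2)
  have "x > 0" "y > 0" "rp > 0" using rp_gt by (simp_all add: x_def y_def)
  ultimately show ?thesis unfolding frame_step_def[of "[u]" "[u]"]
    by (simp only: pw) (simp add: field_simps)
qed

text \<open>After the terms \<open>rp ^ (2 * k - 1)\<close> cancel, the bracket of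
  \<open>frame_step\<close> factors because \<open>\<eta>\<close> has square 1.\<close>

lemma frame_step_anisotropic_eq:
  assumes u: "\<not> p dvd B u u" and l: "l < k"
  defines "\<eta> \<equiv> leg (B u u) * leg ((- 1) ^ k * detQ)"
  assumes e: "\<eta> * \<eta> = 1"
  shows "frame_step [u] [] l = rp ^ (2 * k) * ((rp ^ (k - l - 1) + \<eta>) * (rp ^ (k - l) - \<eta>))"
proof -
  have "Suc l \<le> k" using l by simp
  then obtain e where e': "k = Suc l + e" using le_Suc_ex by blast
  have "cone_count [u] = rp ^ (2 * k - 1) + \<eta> * (rp ^ k - rp ^ (k - 1))"
    unfolding \<eta>_def using l by (intro cone_count_anisotropic[OF m _ u]) simp
  moreover have "(rp ^ (k - l - 1) + \<eta>) * (rp ^ (k - l) - \<eta>) =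
     rp ^ (k - l - 1) * rp ^ (k - l) + \<eta> * (rp ^ (k - l) - rp ^ (k - l - 1)) - 1"
    using e by (simp add: algebra_simps)
  moreover define x y where "x = rp ^ l" and "y = rp ^ e"
  have pw: "rp ^ m = x * x * y * y * rp * rp * rp" "rp ^ (2 * k) = x * x * y * y * rp * rp"
    "rp ^ (2 * k - 1) = x * x * y * y * rp" "rp ^ k = x * y * rp" "rp ^ (k - 1) = x * y"
    "rp ^ (k - l - 1) = y" "rp ^ (k - l) = y * rp"
    "rp ^ Suc l = x * rp" "rp ^ (l + length [u]) = x * rp" "rp ^ length [u] = rp" "rp ^ (l + length ([] :: ivec list)) = x"
    by (simp_all add: m e' x_def y_def power_add mult_2)
  have "x > 0" "y > 0" "rp > 0" using rp_gt by (simp_all add: x_def y_def)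
  ultimately show ?thesis unfolding frame_step_def
    by (simp only: pw) (simp add: field_simps)
qed

lemma real_nat_p: "real (nat p) = rp"
  using p_pos by simp

text \<open>The ratio of these products is the number of lattices through a primitive isotropic
  vector, whose frames have the step of index 0 prescribed; \<open>count_primitive\<close> reads it
  off.\<close>

lemma prod_frame_alpha:
  "(\<Prod>j<d - 1. frame_step [] [] (Suc j)) = alpha (nat p) k d * (\<Prod>j<d - 1. fibre_step d (Suc j))"
proof -
  have "(\<Prod>s=1..d-1. frame_step [] [] s) = (\<Prod>s=1..d-1. rp ^ (2 * k) * (rp ^ (2 * (k - s)) - 1))"
    using d by (intro prod.cong refl frame_step_eq) auto
  then show ?thesis
    unfolding prod_lessThan_Suc unfolding fibre_step_eq alpha_def real_nat_p
    by (rule trans) (rule prod_frame_over_fibre[OF rp_gt d])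
qed

lemma prod_fibre_nz: "(\<Prod>j<d - 1. fibre_step d (Suc j)) \<noteq> 0" "fibre_step d 0 \<noteq> 0"
proof -
  have "fibre_step d l \<noteq> 0" if "l < d" for l
    using power_strict_increasing[OF that rp_gt] rp_gt by (simp add: fibre_step_eq)
  then show "(\<Prod>j<d - 1. fibre_step d (Suc j)) \<noteq> 0" "fibre_step d 0 \<noteq> 0"
    using d by (auto simp: prod_zero_iff)
qed

lemma prod_lessThan_split: "(\<Prod>j<d. f j :: real) = f 0 * (\<Prod>j<d - 1. f (Suc j))"
  using prod.lessThan_Suc_shift[of f "d - 1"] d by simp

text \<open>The steps after the first contribute \<open>alpha\<close>, and \<open>X\<close> is what
  the frame count has beyond them. The remaining factor is
  \<open>rp ^ (2 * k) / fibre_step d 0 = rp ^ (d - 1) / (rp ^ d - 1)\<close>.\<close>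

lemma count_from_frames:
  assumes N: "N * (\<Prod>j<d. fibre_step d j) = rp ^ (2 * k) * X * (\<Prod>j<d - 1. frame_step [] [] (Suc j))"
  shows "N = alpha (nat p) k d * (rp ^ (d - 1) * X / (rp ^ d - 1))"
proof -
  let ?\<Phi> = "\<Prod>j<d - 1. fibre_step d (Suc j)"
  have "N * (fibre_step d 0 * ?\<Phi>) = rp ^ (2 * k) * X * (alpha (nat p) k d * ?\<Phi>)"
    using N unfolding prod_lessThan_split prod_frame_alpha .
  then have 1: "N * fibre_step d 0 = rp ^ (2 * k) * X * alpha (nat p) k d"
    using prod_fibre_nz(1) by simp
  have "rp ^ (2 * k + 1 - d) * rp ^ (d - 1) = rp ^ (2 * k)" using d by (simp flip: power_add)
  then have 2: "fibre_step d 0 * rp ^ (d - 1) = rp ^ (2 * k) * (rp ^ d - 1)"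
    by (simp add: fibre_step_eq mult_ac)
  have "rp ^ (2 * k) * (N * (rp ^ d - 1)) = (N * fibre_step d 0) * rp ^ (d - 1)"
    using 2 by (simp only: mult_ac)
  also have "\<dots> = rp ^ (2 * k) * (alpha (nat p) k d * (rp ^ (d - 1) * X))"
    unfolding 1 by (simp only: mult_ac)
  finally have "N * (rp ^ d - 1) = alpha (nat p) k d * (rp ^ (d - 1) * X)"
    using rp_gt by simp
  moreover have "rp ^ d - 1 \<noteq> 0" using one_less_power[OF rp_gt, of d] d by simp
  ultimately show ?thesis by (simp add: field_simps)
qed

lemma count_all:
  "real (card (lattices d)) = alpha (nat p) k d * (rp ^ (d - 1) * (rp ^ (2 * k) - 1) / (rp ^ d - 1))"
proof (rule count_from_frames)
  have "frame_step [] [] 0 = rp ^ (2 * k) * (rp ^ (2 * k) - 1)" using frame_step_eq[of 0] by simp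
  then show "real (card (lattices d)) * (\<Prod>j<d. fibre_step d j) =
      rp ^ (2 * k) * (rp ^ (2 * k) - 1) * (\<Prod>j<d - 1. frame_step [] [] (Suc j))"
    using card_lattices_all[of d] prod_lessThan_split[of "frame_step [] []"] by simp
qed

lemma count_primitive:
  assumes "\<not> (\<forall>i<m. p dvd K i)" "p^2 dvd B K K"
  shows "real (card {L \<in> lattices d. K \<in> L}) = alpha (nat p) k d"
proof -
  have "d = Suc (d - 1)" using d by simp
  from card_lattices_primitive[OF assms this] show ?thesis
    unfolding prod_frame_alpha using prod_fibre_nz(1) by simp
qed

lemma leg_prod_square:
  assumes "\<not> p dvd a" "\<not> p dvd b"
  shows "(leg a * leg b) * (leg a * leg b) = 1"
proof -
  have "(leg a * leg b) * (leg a * leg b) = (leg a * leg a) * (leg b * leg b)" by (simp only: mult_ac)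
  also have "\<dots> = 1"
    using leg_square[OF assms(1)] leg_square[OF assms(2)] by (simp only: leg_mult mult_1_left)
  finally show ?thesis .
qed

lemma count_anisotropic:
  assumes u: "\<not> p dvd B u u"
  defines "\<eta> \<equiv> leg (B u u) * leg ((- 1) ^ k * detQ)"
  shows "real (card {L \<in> lattices d. (\<lambda>i. p * u i) \<in> L}) =
    alpha (nat p) k d * (rp ^ (d - 1) * ((rp ^ k - \<eta>) * (rp ^ (k - d) + \<eta>)) / (rp ^ d - 1))"
proof (rule count_from_frames)
  have "\<not> p dvd (- 1) ^ k" using not_p_dvd_1 by (cases "even k") auto
  then have "\<not> p dvd (- 1) ^ k * detQ"
    using nondegenerate by (simp add: dvd_mult_p)
  from leg_prod_square[OF u this] have e: "\<eta> * \<eta> = 1" unfolding \<eta>_def .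
  have d1: "d = Suc (d - 1)" using d by simp
  have "real (card {L \<in> lattices d. (\<lambda>i. p * u i) \<in> L}) * (\<Prod>j<d. fibre_step d j) = (\<Prod>j<d. frame_step [u] [] j)"
    by (rule card_lattices_anisotropic[OF u])
  also have "\<dots> = (\<Prod>l<Suc (d - 1). rp ^ (2 * k) * ((rp ^ (k - l - 1) + \<eta>) * (rp ^ (k - l) - \<eta>)))"
    unfolding d1[symmetric] using d e unfolding \<eta>_def
    by (intro prod.cong refl frame_step_anisotropic_eq[OF u]) auto
  also have "\<dots> = rp ^ (2 * k) * ((rp ^ k - \<eta>) * (rp ^ (k - Suc (d - 1)) + \<eta>)) *
     (\<Prod>s=1..d-1. rp ^ (2 * k) * (rp ^ (2 * (k - s)) - 1))"
    using d by (intro prod_anisotropic_frames[OF e]) simp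
  also have "(\<Prod>s=1..d-1. rp ^ (2 * k) * (rp ^ (2 * (k - s)) - 1)) = (\<Prod>s=1..d-1. frame_step [] [] s)"
    using d by (intro prod.cong refl frame_step_eq[symmetric]) auto
  finally show "real (card {L \<in> lattices d. (\<lambda>i. p * u i) \<in> L}) * (\<Prod>j<d. fibre_step d j) =
      rp ^ (2 * k) * ((rp ^ k - \<eta>) * (rp ^ (k - d) + \<eta>)) * (\<Prod>j<d - 1. frame_step [] [] (Suc j))"
    unfolding prod_lessThan_Suc d1[symmetric] .
qed

lemma count_isotropic:
  assumes u: "\<not> (\<forall>i<m. p dvd u i)" "p dvd B u u"
  shows "real (card {L \<in> lattices d. (\<lambda>i. p * u i) \<in> L}) =
    alpha (nat p) k d * (rp ^ (d - 1) * (rp ^ d * (rp ^ (2 * (k - d)) - 1)) / (rp ^ d - 1)) + alpha (nat p) k d * rp ^ (d - 1)"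
proof -
  have d1: "d = Suc (d - 1)" using d by simp
  let ?\<Phi> = "\<Prod>j<d - 1. fibre_step d (Suc j)"
  have "real (card {L \<in> lattices d. (\<lambda>i. p * u i) \<in> L \<and> \<not> meets u L}) =
    alpha (nat p) k d * (rp ^ (d - 1) * (rp ^ d * (rp ^ (2 * (k - d)) - 1)) / (rp ^ d - 1))"
  proof (rule count_from_frames)
    have "real (card {L \<in> lattices d. (\<lambda>i. p * u i) \<in> L \<and> \<not> meets u L}) * (\<Prod>j<d. fibre_step d j) =
       (\<Prod>j<d. frame_step [u] [u] j)"
      by (rule card_lattices_not_meeting[OF u])
    also have "\<dots> = (\<Prod>j<d. rp * frame_step [] [] (Suc j))"
      using d by (intro prod.cong refl frame_step_isotropic_eq[OF u]) auto
    also have "\<dots> = rp ^ d * (\<Prod>j<d. frame_step [] [] (Suc j))" by (simp add: prod.distrib)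
    \<comment> \<open>The shifted product ends with the step of index \<open>d\<close>. It is 0 for
      \<open>d = k\<close>, in accordance with the fact that an isotropic vector orthogonal to a
      maximal isotropic subspace lies in it.\<close>
    also have "(\<Prod>j<d. frame_step [] [] (Suc j)) = (\<Prod>j<d - 1. frame_step [] [] (Suc j)) * frame_step [] [] d"
      using prod.lessThan_Suc[of "\<lambda>j. frame_step [] [] (Suc j)" "d - 1"] unfolding d1[symmetric] .
    also have "frame_step [] [] d = rp ^ (2 * k) * (rp ^ (2 * (k - d)) - 1)" using frame_step_eq d by simp
    finally show "real (card {L \<in> lattices d. (\<lambda>i. p * u i) \<in> L \<and> \<not> meets u L}) * (\<Prod>j<d. fibre_step d j) =
        rp ^ (2 * k) * (rp ^ d * (rp ^ (2 * (k - d)) - 1)) * (\<Prod>j<d - 1. frame_step [] [] (Suc j))"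
      by (simp only: mult_ac)
  qed
  moreover have "real (card {L \<in> lattices d. meets u L}) = alpha (nat p) k d * rp ^ (d - 1)"
  proof -
    let ?M = "real (card {L \<in> lattices d. meets u L})"
    have "?M * (rp ^ m / rp ^ d) * ?\<Phi> = rp ^ m / rp * (alpha (nat p) k d * ?\<Phi>)"
      using card_lattices_meeting[OF u d1] unfolding prod_frame_alpha .
    then have "(?M * (rp ^ m / rp ^ d)) * ?\<Phi> = (rp ^ m / rp * alpha (nat p) k d) * ?\<Phi>"
      by (simp only: mult.assoc)
    then have "?M * (rp ^ m / rp ^ d) = rp ^ m / rp * alpha (nat p) k d"
      using prod_fibre_nz(1) mult_right_cancel by blast
    moreover have "rp ^ d = rp * rp ^ (d - 1)" using power_Suc[of rp "d - 1"] unfolding d1[symmetric] .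
    ultimately show ?thesis using rp_gt by (simp add: field_simps)
  qed
  ultimately show ?thesis unfolding card_lattices_isotropic[where u = u and d = d] by simp
qed

text \<open>In units of \<open>alpha\<close> the count for \<open>K = p u\<close> is
  \<open>1 + kappa\<close> if \<open>u\<close> is isotropic and nonzero modulo p. Expanding
  \<open>(rp ^ k - \<eta>) * (rp ^ (k - d) + \<eta>)\<close> shows that an anisotropic
  \<open>u\<close> adds \<open>\<eta> * rp ^ (k - 1)\<close>. If \<open>u\<close> is zero modulo p,
  the symbol vanishes and the total number of lattices adds \<open>rp ^ (m - 2)\<close>.\<close>

lemma count_lattices:
  assumes K: "p^2 dvd B K K"
  defines "u \<equiv> \<lambda>i. K i div p"
  shows "real (card {L \<in> lattices d. K \<in> L}) = alpha (nat p) k d *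
    (1 + (leg (B u u) * leg ((- 1) ^ k * detQ) * rp ^ (k - 1) + kappa (nat p) m d) *
         of_bool (\<forall>i<m. p dvd K i) + rp ^ (m - 2) * of_bool (\<forall>i<m. p^2 dvd K i))"
proof (cases "\<forall>i<m. p dvd K i")
  case False
  then have F: "(\<forall>i<m. p^2 dvd K i) = False" "(\<forall>i<m. p dvd K i) = False" using p2_dvd_p by blast+
  show ?thesis unfolding count_primitive[OF False K] F by simp
next
  case True
  then have Ku: "vcong (p^2) K (\<lambda>i. p * u i)" by (simp add: vcong_def u_def)
  obtain e where e: "k = d + e" using le_Suc_ex[OF d(2)] by blast
  obtain c where c: "d = Suc c" using d by (cases d) auto
  define x y where "x = rp ^ c" and "y = rp ^ e"
  have pw: "rp ^ (m - 2) = x * x * y * y * rp" "rp ^ (d - 1) = x" "rp ^ d = x * rp" "rp ^ (2 * k) = x * x * y * y * rp * rp"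
    "rp ^ (k - 1) = x * y" "rp ^ k = x * y * rp" "rp ^ (k - d) = y" "rp ^ (2 * (k - d)) = y * y"
    by (simp_all add: m e c x_def y_def power_add mult_2)
  have nz: "x * rp - 1 \<noteq> 0" using one_less_power[OF rp_gt, of d] d unfolding pw by simp
  have kap: "kappa (nat p) m d = (x * x * y * y * rp - x) / (x * rp - 1) - 1"
    unfolding kappa_def real_nat_p pw ..
  have Lu: "{L \<in> lattices d. K \<in> L} = {L \<in> lattices d. (\<lambda>i. p * u i) \<in> L}"
    using lattices_vcong[OF _ Ku] by blast
  show ?thesis
  proof (cases "\<forall>i<m. p dvd u i")
    case u: True
    then have K2: "\<forall>i<m. p^2 dvd K i"
    proof (intro allI impI)
      fix i assume i: "i < m"
      then have "K i = p * u i" using True by (simp add: u_def)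
      then show "p^2 dvd K i" using u i by (simp add: p2_dvd_mult)
    qed
    have T1: "(\<forall>i<m. p dvd K i) = True" and T2: "(\<forall>i<m. p^2 dvd K i) = True" using True K2 by blast+
    have "vcong p u (\<lambda>_. 0)" using u by (simp add: vcong_def)
    from B_vcong_dvd0[OF this vcong_refl, of u] have "leg (B u u) = 0" by (intro leg_0) simp
    moreover have "K \<in> Lt xs" for xs
      using K2 Lt_vcong[of K "\<lambda>_. 0" xs] by (simp add: vcong_def Lt_def)
    then have "{L \<in> lattices d. K \<in> L} = lattices d" by (auto simp: lattices_def)
    moreover have "x * (x * x * y * y * rp * rp - 1) / (x * rp - 1) = 1 + kappa (nat p) m d + x * x * y * y * rp"
      unfolding kap using nz by (simp add: field_simps)
    ultimately show ?thesis using count_all T1 T2 unfolding pw by (simp only: of_bool_eq mult_1_right mult_zero_left add_0_left add.assoc)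
  next
    case u: False
    have K2: "\<not> (\<forall>i<m. p^2 dvd K i)"
    proof
      assume h: "\<forall>i<m. p^2 dvd K i"
      have "p dvd u i" if "i < m" for i
      proof -
        have "p * u i = K i" using True that by (simp add: u_def)
        then show ?thesis using h that p2_dvd_mult by metis
      qed
      then show False using u by blast
    qed
    have T1: "(\<forall>i<m. p dvd K i) = True" and T2: "(\<forall>i<m. p^2 dvd K i) = False" using True K2 by blast+
    show ?thesis
    proof (cases "p dvd B u u")
      case iso: True
      have "x * (x * rp * (y * y - 1)) / (x * rp - 1) + x = 1 + kappa (nat p) m d"
        unfolding kap using nz by (simp add: field_simps)
      moreover have "real (card {L \<in> lattices d. K \<in> L}) =
          alpha (nat p) k d * (x * (x * rp * (y * y - 1)) / (x * rp - 1) + x)"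
        unfolding Lu count_isotropic[OF u iso] pw by (simp only: distrib_left)
      ultimately show ?thesis using leg_0[OF iso] T1 T2
        by (simp only: of_bool_eq mult_1_right mult_zero_left mult_zero_right add_0_left add_0_right)
    next
      case an: False
      define \<eta> where "\<eta> = leg (B u u) * leg ((- 1) ^ k * detQ)"
      have "\<not> p dvd (- 1) ^ k" using not_p_dvd_1 by (cases "even k") auto
      then have "\<not> p dvd (- 1) ^ k * detQ"
        using nondegenerate by (simp add: dvd_mult_p)
      from leg_prod_square[OF an this] have ee: "\<eta> * \<eta> = 1" unfolding \<eta>_def .
      have "(x * y * rp - \<eta>) * (y + \<eta>) = x * y * y * rp + \<eta> * (x * y * rp - y) - 1"
        using ee by (simp add: algebra_simps)
      then have "x * ((x * y * rp - \<eta>) * (y + \<eta>)) / (x * rp - 1) = 1 + (\<eta> * (x * y) + kappa (nat p) m d)"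
        unfolding kap using nz by (simp add: field_simps)
      then show ?thesis unfolding Lu count_anisotropic[OF an] \<eta>_def[symmetric] pw T1 T2
        by (simp only: of_bool_eq mult_1_right mult_zero_right add_0_right)
    qed
  qed
qed

end

section \<open>Bases adapted to a frame\<close>

lemma spn_append: "spn n (as @ bs) x \<longleftrightarrow> (\<exists>u. spn n as u \<and> spn n bs (axpy x (- 1) u))"
proof (induction as arbitrary: x)
  case Nil
  show ?case
  proof
    assume "spn n ([] @ bs) x"
    then show "\<exists>u. spn n [] u \<and> spn n bs (axpy x (- 1) u)"
      by (intro exI[of _ "\<lambda>_. 0"]) (simp add: axpy_def)
  next
    assume "\<exists>u. spn n [] u \<and> spn n bs (axpy x (- 1) u)"
    then obtain u where "spn n [] u" "spn n bs (axpy x (- 1) u)" by blast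
    moreover from this(1) have "vcong n (axpy x (- 1) u) x" by (simp add: vcong_def)
    ultimately show "spn n ([] @ bs) x" using spn_vcong by simp
  qed
next
  case (Cons a as)
  show ?case
  proof
    assume "spn n ((a # as) @ bs) x"
    then obtain c where "spn n (as @ bs) (axpy x (- c) a)" by auto
    then obtain u where u: "spn n as u" "spn n bs (axpy (axpy x (- c) a) (- 1) u)" using Cons.IH by blast
    have "spn n (a # as) (axpy u c a)" using spn_axpy[OF spn_Cons_self[OF u(1)] spn_mem] by simp
    moreover have "axpy (axpy x (- c) a) (- 1) u = axpy x (- 1) (axpy u c a)"
      by (simp add: axpy_def algebra_simps)
    ultimately show "\<exists>u. spn n (a # as) u \<and> spn n bs (axpy x (- 1) u)" using u(2) by metis
  next
    assume "\<exists>u. spn n (a # as) u \<and> spn n bs (axpy x (- 1) u)"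
    then obtain u c where u: "spn n as (axpy u (- c) a)" "spn n bs (axpy x (- 1) u)" by auto
    have "axpy (axpy x (- c) a) (- 1) (axpy u (- c) a) = axpy x (- 1) u"
      by (simp add: axpy_def algebra_simps)
    then have "spn n (as @ bs) (axpy x (- c) a)" using Cons.IH u by metis
    then show "spn n ((a # as) @ bs) x" unfolding append_Cons spn.simps by (rule exI)
  qed
qed

lemma spn_0_iff:
  "spn 0 us x \<longleftrightarrow> (\<exists>t. \<forall>i<m. x i = (\<Sum>j<length us. t j * (us ! j) i))"
proof (induction us arbitrary: x)
  case Nil
  then show ?case by simp
next
  case (Cons u us)
  show ?case
  proof
    assume "spn 0 (u # us) x"
    then obtain c where "spn 0 us (axpy x (- c) u)" by auto
    then obtain t where t: "\<And>i. i < m \<Longrightarrow> axpy x (- c) u i = (\<Sum>j<length us. t j * (us ! j) i)" using Cons.IH by blast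
    have "x i = (\<Sum>j<length (u # us). (case j of 0 \<Rightarrow> c | Suc j \<Rightarrow> t j) * ((u # us) ! j) i)" if "i < m" for i
      using t[OF that] unfolding list.size(4) by (simp add: sum.lessThan_Suc_shift del: sum.lessThan_Suc)
    then show "\<exists>t. \<forall>i<m. x i = (\<Sum>j<length (u # us). t j * ((u # us) ! j) i)" by blast
  next
    assume "\<exists>t. \<forall>i<m. x i = (\<Sum>j<length (u # us). t j * ((u # us) ! j) i)"
    then obtain t where t: "\<And>i. i < m \<Longrightarrow> x i = (\<Sum>j<length (u # us). t j * ((u # us) ! j) i)" by blast
    have "axpy x (- t 0) u i = (\<Sum>j<length us. t (Suc j) * (us ! j) i)" if "i < m" for i
      using t[OF that] by (simp add: sum.lessThan_Suc_shift del: sum.lessThan_Suc)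
    then have "spn 0 us (axpy x (- t 0) u)" unfolding Cons.IH by (intro exI[of _ "\<lambda>j. t (Suc j)"]) blast
    then show "spn 0 (u # us) x" unfolding spn.simps by (rule exI)
  qed
qed

lemma indep_reduce:
  "\<exists>zs. indep zs \<and> length zs \<le> length ys \<and> (indep ys \<or> length zs < length ys) \<and> (\<forall>x. spn p ys x \<longrightarrow> spn p zs x)"
proof (induction ys)
  case Nil
  then show ?case by (intro exI[of _ "[]"]) simp
next
  case (Cons y ys)
  then obtain zs where z: "indep zs" "length zs \<le> length ys" "indep ys \<or> length zs < length ys"
    "\<And>x. spn p ys x \<Longrightarrow> spn p zs x" by blast
  show ?case
  proof (cases "spn p zs y")
    case True
    have "spn p zs x" if "spn p (y # ys) x" for x
      by (rule spn_mono[OF _ that]) (use True z(4) spn_mem in auto)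
    then show ?thesis using z(1,2) by (intro exI[of _ zs]) (simp del: spn.simps)
  next
    case False
    then show ?thesis using z by (intro exI[of _ "y # zs"]) auto
  qed
qed

text \<open>A list of \<open>m\<close> generators of the integral lattice is a basis of it; by
  \<open>Lam_spans\<close> and \<open>spans_Lam\<close> these lists are the columns of the matrices
  in \<open>Lam m\<close>.\<close>

definition spans :: "ivec list \<Rightarrow> bool" where
  "spans us \<longleftrightarrow> length us = m \<and> (\<forall>x. spn 0 us x)"

text \<open>A dependent list would leave fewer than \<open>m\<close> vectors spanning the whole
  space modulo p.\<close>

lemma spans_indep: assumes "spans us" shows "indep us"
proof (rule ccontr)
  assume "\<not> indep us"
  then obtain zs where z: "indep zs" "length zs < m" "\<And>x. spn p us x \<Longrightarrow> spn p zs x"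
    using indep_reduce[of us] assms by (auto simp: spans_def)
  obtain x where "\<not> spn p zs x" using exists_not_spn[OF z(1,2)] by blast
  then show False using z(3) assms spn_dvd[of p 0 us x] by (simp add: spans_def)
qed

lemma indep_append_disjoint:
  "indep (ys @ cs) \<Longrightarrow> spn p ys w \<Longrightarrow> spn p cs w \<Longrightarrow> \<forall>i<m. p dvd w i"
proof (induction ys arbitrary: w)
  case (Cons y ys)
  obtain c where c: "spn p ys (axpy w (- c) y)" using Cons.prems(2) by auto
  have "p dvd c"
  proof (rule ccontr)
    assume "\<not> p dvd c"
    moreover have "spn p (ys @ cs) (axpy w (- 1) (axpy w (- c) y))"
      by (rule spn_axpy; rule spn_subset[rotated]) (use c Cons.prems(3) in auto)
    moreover have "axpy w (- 1) (axpy w (- c) y) = (\<lambda>i. c * y i)" by (simp add: axpy_def)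
    ultimately have "spn p (ys @ cs) y" using spn_smult_cancel by metis
    then show False using Cons.prems(1) by simp
  qed
  then have "vcong p (axpy w (- c) y) w" by (simp add: vcong_def)
  then have "spn p ys w" using c spn_vcong by blast
  then show ?case using Cons.IH[of w] Cons.prems by simp
qed simp

text \<open>
  The lattice \<open>U D \<int>\<^sup>m\<close> for the matrix \<open>U\<close> with columns \<open>as @ bs @ cs\<close> and \<open>D = diag(1, p, p\<^sup>2)\<close> in blocks.
\<close>

definition Lat :: "ivec list \<Rightarrow> ivec list \<Rightarrow> ivec list \<Rightarrow> ivec set" where
  "Lat as bs cs = {x. \<exists>a b c. spn 0 as a \<and> spn 0 bs b \<and> spn 0 cs c \<and> (\<forall>i<m. x i = a i + p * b i + p^2 * c i)}"

lemma LatI: "spn 0 as a \<Longrightarrow> spn 0 bs b \<Longrightarrow> spn 0 cs c \<Longrightarrow> (\<And>i. i < m \<Longrightarrow> x i = a i + p * b i + p^2 * c i) \<Longrightarrow> x \<in> Lat as bs cs"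
  unfolding Lat_def by blast

lemma Lat_axpy: assumes "x \<in> Lat as bs cs" "y \<in> Lat as bs cs" shows "axpy x t y \<in> Lat as bs cs"
proof -
  obtain a b c where 1: "spn 0 as a" "spn 0 bs b" "spn 0 cs c" "\<And>i. i < m \<Longrightarrow> x i = a i + p * b i + p^2 * c i"
    using assms(1) unfolding Lat_def by blast
  obtain a' b' c' where 2: "spn 0 as a'" "spn 0 bs b'" "spn 0 cs c'" "\<And>i. i < m \<Longrightarrow> y i = a' i + p * b' i + p^2 * c' i"
    using assms(2) unfolding Lat_def by blast
  show ?thesis
    by (rule LatI[OF spn_axpy[OF 1(1) 2(1), of t] spn_axpy[OF 1(2) 2(2), of t] spn_axpy[OF 1(3) 2(3), of t]])
       (simp add: 1(4) 2(4) algebra_simps)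
qed

lemma p2_dvd_2: "p^2 dvd 2 * a \<Longrightarrow> p^2 dvd a"
proof -
  assume a: "p^2 dvd 2 * a"
  have "odd p" using prime_p p_gt_2 by (simp add: prime_odd_int)
  then have "coprime (p^2) 2" by (simp add: coprime_right_2_iff_odd)
  then show ?thesis using a coprime_dvd_mult_right_iff by blast
qed

text \<open>Polarization, with 2 invertible modulo \<open>p^2\<close>.\<close>

lemma Lat_pair:
  assumes iso: "\<And>y. y \<in> Lat as bs cs \<Longrightarrow> p^2 dvd B y y" and xy: "x \<in> Lat as bs cs" "y \<in> Lat as bs cs"
  shows "p^2 dvd B x y"
proof (rule p2_dvd_2)
  have "2 * B x y = B (axpy x 1 y) (axpy x 1 y) - B x x - B y y" by (simp add: B_sym[of y x])
  also have "p^2 dvd \<dots>" using iso[OF Lat_axpy[OF xy, of 1]] iso xy by (intro dvd_diff) auto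
  finally show "p^2 dvd 2 * B x y" .
qed

lemma spn_map_red: "spn p (map (red (p^2)) ys) x \<longleftrightarrow> spn p ys x"
proof
  assume "spn p (map (red (p^2)) ys) x"
  then show "spn p ys x"
  proof (rule spn_mono[rotated])
    fix z assume "z \<in> set (map (red (p^2)) ys)"
    then obtain y where "y \<in> set ys" "z = red (p^2) y" by auto
    then show "spn p ys z" using spn_mem spn_vcong[OF vcong_p2[OF red_vcong]] by blast
  qed
next
  assume "spn p ys x"
  then show "spn p (map (red (p^2)) ys) x"
  proof (rule spn_mono[rotated])
    fix y assume "y \<in> set ys"
    then have "spn p (map (red (p^2)) ys) (red (p^2) y)" by (intro spn_mem) simp
    then show "spn p (map (red (p^2)) ys) y" using spn_vcong[OF vcong_p2[OF red_vcong]] by blast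
  qed
qed

lemma frameI:
  assumes "indep ys" "\<And>y. y \<in> set ys \<Longrightarrow> y \<in> box (p^2)" "\<And>y z. y \<in> set ys \<Longrightarrow> z \<in> set ys \<Longrightarrow> p^2 dvd B y z"
  shows "frame [] [] ys"
  using assms by (induction ys) auto

lemma indep_map_red: "indep ys \<Longrightarrow> indep (map (red (p^2)) ys)"
proof (induction ys)
  case (Cons y ys)
  have "spn p ys (red (p^2) y) \<longleftrightarrow> spn p ys y" using spn_vcong[OF vcong_p2[OF red_vcong]] by blast
  then show ?case using Cons by (simp add: spn_map_red)
qed simp

text \<open>The span of \<open>ys\<close> is contained in the complement of \<open>xs\<close>, and
  both have \<open>p ^ length ys\<close> residues.\<close>

lemma perp_eq_spn:
  assumes i: "indep xs" "indep ys" "length xs + length ys = m"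
    and o: "\<And>x y. x \<in> set xs \<Longrightarrow> y \<in> set ys \<Longrightarrow> p dvd B y x"
    and w: "\<And>x. x \<in> set xs \<Longrightarrow> p dvd B w x"
  shows "spn p ys w"
proof -
  let ?S = "{x \<in> box p. spn p ys x}" and ?T = "{x \<in> box p. \<forall>z\<in>set xs. p dvd B x z}"
  have "?S = ?T"
  proof (rule card_subset_eq)
    show "?S \<subseteq> ?T"
    proof (intro subsetI CollectI conjI ballI)
      fix v z assume v: "v \<in> ?S" and z: "z \<in> set xs"
      have "p dvd B z v" by (rule spn_perp[of p ys]) (use v o[OF z] B_sym in auto)
      then show "p dvd B v z" by (simp only: B_sym)
    qed auto
    have "real (card ?T) = (\<Sum>x\<in>box p. of_bool (perp p xs x))"
      by (simp add: of_bool_def sum.If_cases Int_def)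
    also have "\<dots> = rp ^ m / rp ^ length xs" by (rule card_perp[OF i(1)])
    also have "\<dots> = rp ^ length ys" using p_pos by (simp flip: i(3) add: power_add)
    finally have "real (card ?S) = real (card ?T)" using card_spn_box[OF i(2)] by simp
    then show "card ?S = card ?T" by simp
  qed simp
  moreover have "red p w \<in> ?T"
    using red_in_box[OF p_pos] w B_vcong_dvd0[OF red_vcong vcong_refl] by simp
  ultimately have "spn p ys (red p w)" by blast
  then show ?thesis using spn_vcong[OF red_vcong] by blast
qed

text \<open>Isotropy gives one inclusion. For the other, subtracting a lattice element from
  \<open>y\<close> leaves \<open>p c\<close> with \<open>c\<close> in the span of \<open>cs\<close>
  and orthogonal to \<open>xs\<close> modulo p. That complement is the span of
  \<open>as @ bs\<close>, so \<open>c\<close> vanishes modulo p.\<close>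

lemma core_lattice:
  assumes s: "spans (as @ bs @ cs)" and l: "length as = length cs"
    and iso: "\<And>y. y \<in> Lat as bs cs \<Longrightarrow> p^2 dvd B y y"
  shows "frame [] [] (map (red (p^2)) as)" "Lat as bs cs = Lt (map (red (p^2)) as)"
proof -
  let ?L = "Lat as bs cs" and ?xs = "map (red (p^2)) as"
  have pair: "p^2 dvd B x y" if "x \<in> ?L" "y \<in> ?L" for x y using Lat_pair iso that by blast
  have asL: "a \<in> ?L" if "spn 0 as a" for a
    by (rule LatI[OF that, of _ "\<lambda>_. 0" _ "\<lambda>_. 0"]) auto
  have bsL: "(\<lambda>i. p * b i) \<in> ?L" if "spn 0 bs b" for b
    by (rule LatI[of _ "\<lambda>_. 0" _ b _ "\<lambda>_. 0"]) (use that in auto)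
  \<comment> \<open>The lattice contains all multiples of \<open>p^2\<close>, since 1, p and
    \<open>p^2\<close> all divide \<open>p^2\<close>.\<close>
  have p2L: "x \<in> ?L" if "\<forall>i<m. p^2 dvd x i" for x
  proof -
    have "vcong (p^2) x (\<lambda>_. 0)" using that by (simp add: vcong_def)
    then obtain u where u: "vcong 0 x (axpy (\<lambda>_. 0) (p^2) u)" by (rule vcong_decomp)
    have "spn 0 (as @ bs @ cs) u" using s by (simp add: spans_def)
    then obtain a b where "spn 0 as a" "spn 0 bs b" "spn 0 cs (axpy (axpy u (- 1) a) (- 1) b)"
      by (auto simp: spn_append)
    then show ?thesis
      by (intro LatI[of _ "\<lambda>i. p^2 * a i" _ "\<lambda>i. p * b i"] spn_scale) (use u in \<open>auto simp: vcong_def algebra_simps power2_eq_square\<close>)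
  qed
  have redL: "x \<in> ?L" if x: "x \<in> set ?xs" for x
  proof -
    obtain a where a: "a \<in> set as" "x = red (p^2) a" using x by auto
    have "axpy x (- 1) a \<in> ?L"
      using red_vcong[of "p^2" a] by (intro p2L) (simp add: vcong_def a(2))
    from Lat_axpy[OF this asL[OF spn_mem[OF a(1)]], of 1] show ?thesis by (simp add: axpy_def)
  qed
  have ind: "indep (as @ bs @ cs)" by (rule spans_indep[OF s])
  have ixs: "indep ?xs" using indep_append[OF ind] by (rule indep_map_red)
  show f: "frame [] [] ?xs"
    by (rule frameI[OF ixs]) (use redL pair red_in_box[OF p2_pos] in auto)
  show "?L = Lt ?xs"
  proof (intro equalityI subsetI)
    fix y assume y: "y \<in> ?L"
    then obtain a b c where abc: "spn 0 as a" "\<And>i. i < m \<Longrightarrow> y i = a i + p * b i + p^2 * c i"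
      unfolding Lat_def by blast
    have "vcong p y a" unfolding vcong_def using abc(2) by (auto simp: power2_eq_square)
    then have "spn p ?xs y" using spn_dvd[OF _ abc(1), of p] spn_vcong unfolding spn_map_red by simp
    then show "y \<in> Lt ?xs" using pair[OF y redL] by (simp add: Lt_def)
  next
    fix y assume y: "y \<in> Lt ?xs"
    then have "spn p as y" by (simp add: Lt_def spn_map_red)
    then obtain a where a: "spn 0 as a" "vcong p y a" using spn_lift by blast
    then obtain u where u: "vcong 0 y (axpy a p u)" using vcong_decomp by blast
    have "spn 0 (as @ bs @ cs) u" using s by (simp add: spans_def)
    then obtain a' b' where a': "spn 0 as a'" and b': "spn 0 bs b'" and c': "spn 0 cs (axpy (axpy u (- 1) a') (- 1) b')"
      by (auto simp: spn_append)
    define c where "c = axpy (axpy u (- 1) a') (- 1) b'"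
    define z where "z = axpy (axpy a p a') 1 (\<lambda>i. p * b' i)"
    have zL: "z \<in> ?L" unfolding z_def by (intro Lat_axpy asL bsL spn_axpy a(1) a' b')
    have yz: "B y w = B z w + p * B c w" for w
    proof -
      have "vcong 0 y (axpy z p c)" using u by (simp add: vcong_def z_def c_def algebra_simps)
      from B_vcong[OF this, of w] show ?thesis by simp
    qed
    have cx: "p dvd B c x" if x: "x \<in> set ?xs" for x
    proof -
      have "p^2 dvd B y x" using y x unfolding Lt_def by blast
      moreover have "p^2 dvd B z x" by (rule pair[OF zL redL[OF x]])
      ultimately have "p^2 dvd p * B c x" unfolding yz by (simp add: dvd_add_right_iff)
      then show ?thesis by (simp only: p2_dvd_mult)
    qed
    \<comment> \<open>Here \<open>length as = length cs\<close> matters: it makes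
      \<open>as @ bs\<close> long enough to fill the complement of \<open>xs\<close>.\<close>
    have "spn p (as @ bs) c"
    proof (rule perp_eq_spn[OF ixs])
      show "indep (as @ bs)" using indep_append[of "as @ bs" cs] ind by simp
      show "length ?xs + length (as @ bs) = m" using s l by (simp add: spans_def)
      show "p dvd B v x" if x: "x \<in> set ?xs" and v: "v \<in> set (as @ bs)" for x v
      proof (cases "v \<in> set as")
        case True
        then show ?thesis using pair[OF asL[OF spn_mem] redL[OF x]] p2_dvd_p by blast
      next
        case False
        then have "(\<lambda>i. p * v i) \<in> ?L" using v by (intro bsL spn_mem) auto
        from pair[OF this redL[OF x]] have "p^2 dvd B (axpy (\<lambda>_. 0) p v) x" by (simp add: axpy_def)
        then show ?thesis by (simp add: p2_dvd_mult)
      qed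
    qed (rule cx)
    moreover have "spn p cs c" using c' spn_dvd[of p 0] by (simp add: c_def)
    ultimately have "\<forall>i<m. p dvd c i" using indep_append_disjoint[of "as @ bs" cs c] ind by simp
    then have "(\<lambda>i. p * c i) \<in> ?L" by (intro p2L) (simp add: p2_dvd_mult)
    then have "axpy z 1 (\<lambda>i. p * c i) \<in> ?L" using Lat_axpy zL by blast
    moreover have "\<forall>i<m. y i = axpy z 1 (\<lambda>i. p * c i) i" using u by (simp add: vcong_def z_def c_def algebra_simps)
    ultimately show "y \<in> ?L" unfolding Lat_def by auto
  qed
qed

text \<open>As \<open>y\<close> is outside the span of \<open>as\<close>, some \<open>w\<close> in
  \<open>fs\<close> enters it with a unit coefficient; \<open>c\<close> is the inverse of that
  coefficient modulo p, so that \<open>w\<close> has coefficient 1 in \<open>c y\<close>.\<close>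

lemma spn_exchange_middle:
  "spn p (as @ fs) y \<Longrightarrow> \<not> spn p as y \<Longrightarrow>
    \<exists>f1 w f2 c. fs = f1 @ w # f2 \<and> \<not> p dvd c \<and> spn p (as @ f1 @ f2) (axpy (\<lambda>i. c * y i) (- 1) w)"
proof (induction fs)
  case (Cons w fs)
  have "spn p (w # as @ fs) y" using Cons.prems(1) by (rule spn_subset[rotated]) auto
  then obtain e where e: "spn p (as @ fs) (axpy y (- e) w)" by auto
  show ?case
  proof (cases "p dvd e")
    case True
    then have "vcong p (axpy y (- e) w) y" by (simp add: vcong_def)
    then have "spn p (as @ fs) y" using e spn_vcong by blast
    then obtain f1 w' f2 c where h: "fs = f1 @ w' # f2" "\<not> p dvd c" "spn p (as @ f1 @ f2) (axpy (\<lambda>i. c * y i) (- 1) w')"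
      using Cons.IH Cons.prems(2) by blast
    have h': "spn p (as @ (w # f1) @ f2) (axpy (\<lambda>i. c * y i) (- 1) w')"
      using h(3) by (rule spn_subset[rotated]) auto
    show ?thesis
      by (rule exI[of _ "w # f1"], rule exI[of _ w'], rule exI[of _ f2], rule exI[of _ c])
        (intro conjI, simp add: h(1), rule h(2), rule h')
  next
    case False
    obtain c where c: "p dvd e * c - 1" using inverse_mod_p[OF False] .
    have "vcong p (\<lambda>i. c * axpy y (- e) w i) (axpy (\<lambda>i. c * y i) (- 1) w)"
      unfolding vcong_def
    proof (intro allI impI)
      fix i
      have "c * axpy y (- e) w i - axpy (\<lambda>i. c * y i) (- 1) w i = - ((e * c - 1) * w i)"
        by (simp add: algebra_simps)
      then show "p dvd c * axpy y (- e) w i - axpy (\<lambda>i. c * y i) (- 1) w i" using c by simp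
    qed
    then have h': "spn p (as @ [] @ fs) (axpy (\<lambda>i. c * y i) (- 1) w)" using spn_scale[OF e, of c] spn_vcong by simp
    have h: "\<not> p dvd c"
    proof
      assume "p dvd c"
      then have "p dvd e * c" by simp
      from dvd_diff[OF this c] have "p dvd e * c - (e * c - 1)" .
      then show False using not_p_dvd_1 by simp
    qed
    show ?thesis
      by (rule exI[of _ "[]"], rule exI[of _ w], rule exI[of _ fs], rule exI[of _ c])
        (intro conjI, simp, rule h, rule h')
  qed
qed simp

text \<open>A unimodular matrix has determinant 1 or -1 modulo p, so arbitrary bases modulo p do not
  lift. Vectors are lifted up to unit factors and earlier members, and therefore only the spans are
  prescribed.\<close>

lemma basis_extend:
  assumes s: "spans (es @ fs)" and e: "\<And>x. spn p es x \<longleftrightarrow> spn p xs x" and i: "indep (zs @ xs)"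
  shows "\<exists>gs fs'. length gs = length zs \<and> spans (gs @ es @ fs') \<and> (\<forall>x. spn p (gs @ es) x \<longleftrightarrow> spn p (zs @ xs) x)"
  using i
proof (induction zs)
  case Nil
  then show ?case using s e by (intro exI[of _ "[]"] exI[of _ fs]) simp
next
  case (Cons y zs)
  then obtain gs fs' where g: "length gs = length zs" "spans (gs @ es @ fs')" "\<And>x. spn p (gs @ es) x \<longleftrightarrow> spn p (zs @ xs) x"
    by auto
  let ?A = "gs @ es"
  have "spn p (?A @ fs') y" using g(2) spn_dvd[of p 0 "?A @ fs'" y] by (simp add: spans_def)
  moreover have "\<not> spn p ?A y" using g(3) Cons.prems by simp
  ultimately obtain f1 w f2 c where h: "fs' = f1 @ w # f2" "\<not> p dvd c" "spn p (?A @ f1 @ f2) (axpy (\<lambda>i. c * y i) (- 1) w)"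
    using spn_exchange_middle by blast
  obtain x' where x': "spn 0 (?A @ f1 @ f2) x'" "vcong p (axpy (\<lambda>i. c * y i) (- 1) w) x'"
    using spn_lift[OF h(3)] by blast
  \<comment> \<open>\<open>z\<close> is \<open>w\<close> plus an integral combination of the other
    basis vectors, so replacing \<open>w\<close> by it keeps a basis, and it is congruent to
    \<open>c y\<close> modulo p.\<close>
  define z where "z = axpy w 1 x'"
  have zc: "vcong p z (\<lambda>i. c * y i)"
    unfolding vcong_def
  proof (intro allI impI)
    fix i assume "i < m"
    then have "p dvd axpy (\<lambda>i. c * y i) (- 1) w i - x' i" using x'(2) by (simp only: vcong_def)
    moreover have "z i - c * y i = - (axpy (\<lambda>i. c * y i) (- 1) w i - x' i)" by (simp add: z_def)
    ultimately show "p dvd z i - c * y i" by (simp only: dvd_minus_iff)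
  qed
  have "spn 0 ((z # gs) @ es @ f1 @ f2) x" for x
  proof (rule spn_mono)
    show "spn 0 (?A @ f1 @ w # f2) x" using g(2) h(1) by (simp add: spans_def)
    fix v assume v: "v \<in> set (?A @ f1 @ w # f2)"
    show "spn 0 ((z # gs) @ es @ f1 @ f2) v"
    proof (cases "v = w")
      case True
      have "spn 0 ((z # gs) @ es @ f1 @ f2) x'" using x'(1) by (rule spn_subset[rotated]) auto
      moreover have "spn 0 ((z # gs) @ es @ f1 @ f2) z" by (rule spn_mem) simp
      ultimately have "spn 0 ((z # gs) @ es @ f1 @ f2) (axpy z (- 1) x')" by (intro spn_axpy)
      moreover have "axpy z (- 1) x' = w" by (simp add: z_def axpy_def)
      ultimately show ?thesis using True by simp
    next
      case False then show ?thesis using v by (intro spn_mem) auto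
    qed
  qed
  then have sp: "spans ((z # gs) @ es @ f1 @ f2)" using g(2) h(1) by (simp add: spans_def)
  have "spn p (z # ?A) x \<longleftrightarrow> spn p (y # ?A) x" for x
  proof
    assume "spn p (z # ?A) x"
    then show "spn p (y # ?A) x"
    proof (rule spn_mono[rotated])
      fix v assume "v \<in> set (z # ?A)"
      moreover have "spn p (y # ?A) (\<lambda>i. c * y i)" by (rule spn_scale, rule spn_mem) simp
      then have "spn p (y # ?A) z" using spn_vcong[OF zc] by blast
      moreover have "spn p (y # ?A) v" if "v \<in> set ?A" using that by (intro spn_mem) auto
      ultimately show "spn p (y # ?A) v" by (auto simp del: spn.simps)
    qed
  next
    assume "spn p (y # ?A) x"
    then show "spn p (z # ?A) x"
    proof (rule spn_mono[rotated])
      fix v assume "v \<in> set (y # ?A)"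
      moreover have "spn p (z # ?A) (\<lambda>i. c * y i)" using spn_vcong[OF zc] spn_mem[of z "z # ?A" p] by (simp del: spn.simps)
      then have "spn p (z # ?A) y" by (rule spn_smult_cancel[OF _ h(2)])
      moreover have "spn p (z # ?A) v" if "v \<in> set ?A" using that by (intro spn_mem) auto
      ultimately show "spn p (z # ?A) v" by (auto simp del: spn.simps)
    qed
  qed
  then have "spn p ((z # gs) @ es) x \<longleftrightarrow> spn p ((y # zs) @ xs) x" for x
    using g(3) by simp
  moreover have "length (z # gs) = length (y # zs)" using g(1) by simp
  ultimately show ?case using sp by blast
qed

lemma spans_standard: "\<exists>fs. spans fs"
proof
  let ?fs = "map (\<lambda>j i. if i = j then 1 else 0) [0..<m] :: ivec list"
  have "spn 0 ?fs x" for x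
    unfolding spn_0_iff
  proof (intro exI[of _ x] allI impI)
    fix i assume i: "i < m"
    have "(\<Sum>j<length ?fs. x j * (?fs ! j) i) = (\<Sum>j<m. if j = i then x i else 0)"
      by (rule sum.cong) auto
    then show "x i = (\<Sum>j<length ?fs. x j * (?fs ! j) i)" using i by simp
  qed
  then show "spans ?fs" by (simp add: spans_def)
qed

text \<open>The complement of \<open>xs\<close> has \<open>p ^ (m - length xs)\<close> residues,
  more than the span of \<open>zs @ xs\<close> as long as that list is shorter than
  \<open>m - length xs\<close>.\<close>

lemma perp_extend:
  assumes i: "indep xs" and o: "\<And>x y. x \<in> set xs \<Longrightarrow> y \<in> set xs \<Longrightarrow> p dvd B x y"
  shows "n + 2 * length xs \<le> m \<Longrightarrow> \<exists>zs. length zs = n \<and> indep (zs @ xs) \<and> (\<forall>z\<in>set zs. perp p xs z)"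
proof (induction n)
  case 0
  then show ?case using i by simp
next
  case (Suc n)
  then obtain zs where z: "length zs = n" "indep (zs @ xs)" "\<forall>z\<in>set zs. perp p xs z" by auto
  have "\<exists>w. (perp p xs w) \<and> \<not> spn p (zs @ xs) w"
  proof (rule ccontr)
    assume "\<not> ?thesis"
    then have "(\<Sum>x\<in>box p. of_bool (perp p xs x) :: real) \<le> (\<Sum>x\<in>box p. of_bool (spn p (zs @ xs) x))"
      by (intro sum_mono) auto
    then have "rp ^ m / rp ^ length xs \<le> rp ^ (n + length xs)"
      using card_perp[OF i] card_spn[OF z(2)] z(1) by simp
    then have "rp ^ m \<le> rp ^ (n + 2 * length xs)" using p_pos by (simp add: field_simps power_add mult_2_right)
    then show False using Suc.prems p_gt_2 by simp
  qed
  then obtain w where "perp p xs w" "\<not> spn p (zs @ xs) w" by blast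
  then show ?case using z by (intro exI[of _ "w # zs"]) simp
qed

lemma spn_in_Lt: "spn 0 as a \<Longrightarrow> set as \<subseteq> Lt xs \<Longrightarrow> a \<in> Lt xs"
proof (induction as arbitrary: a)
  case Nil
  then have "vcong (p^2) a (\<lambda>_. 0)" by (simp add: vcong_def)
  then show ?case using Lt_vcong by (simp add: Lt_def)
next
  case (Cons v as)
  obtain c where "spn 0 as (axpy a (- c) v)" using Cons.prems(1) by auto
  then have "axpy a (- c) v \<in> Lt xs" using Cons.IH Cons.prems(2) by simp
  then have "axpy (axpy a (- c) v) c v \<in> Lt xs" using Lt_axpy Cons.prems(2) by simp
  moreover have "axpy (axpy a (- c) v) c v = a" by (simp add: axpy_def)
  ultimately show ?case by simp
qed

text \<open>
  A basis of \<open>\<int>\<^sup>m\<close> that induces the flag of the span of \<open>xs\<close> and its orthogonal complement modulo \<open>p\<close> is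
  corrected by multiples of \<open>p\<close> so that its first vectors lie in the lattice of \<open>xs\<close>.
\<close>

lemma exists_basis:
  assumes f: "frame [] [] xs" and d: "length xs = d" "2 * d \<le> m"
  shows "\<exists>as bs cs. length as = d \<and> length bs = m - 2 * d \<and> length cs = d \<and> spans (as @ bs @ cs) \<and>
    Lat as bs cs = Lt xs"
proof -
  have ix: "indep xs" by (rule frame_indep_Nil[OF f])
  have ox: "p dvd B x y" if "x \<in> set xs" "y \<in> set xs" for x y
    using frame_pairwise[OF f that] p2_dvd_p by blast
  obtain zs where z: "length zs = m - 2 * d" "indep (zs @ xs)" "\<And>z x. z \<in> set zs \<Longrightarrow> x \<in> set xs \<Longrightarrow> p dvd B z x"
    using perp_extend[OF ix ox, of "m - 2 * d"] d by auto
  obtain fs0 where "spans ([] @ fs0)" using spans_standard by auto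
  from basis_extend[OF this, of "[]" xs] ix
  obtain es fs where e: "length es = d" "spans (es @ fs)" "\<And>x. spn p es x \<longleftrightarrow> spn p xs x" using d by auto
  from basis_extend[OF e(2,3) z(2)]
  obtain bs cs where b: "length bs = m - 2 * d" "spans (bs @ es @ cs)" "\<And>x. spn p (bs @ es) x \<longleftrightarrow> spn p (zs @ xs) x"
    using z(1) by auto
  have "length bs + (length es + length cs) = m" using b(2) by (simp add: spans_def)
  then have lc: "length cs = d" using b(1) e(1) d(2) by linarith
  have perp: "p dvd B w x" if w: "spn p (bs @ es) w" and x: "x \<in> set xs" for w x
  proof -
    have "spn p (zs @ xs) w" using b(3) w by simp
    then have "p dvd B x w" by (rule spn_perp) (use z(3)[OF _ x] ox[OF x] B_sym in auto)
    then show ?thesis by (simp only: B_sym)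
  qed
  have lift: "\<exists>v. spn 0 cs v \<and> axpy a p v \<in> Lt xs" if a: "a \<in> set es" for a
  proof -
    have sa: "spn p xs a" using e(3) spn_mem[OF a, of p] by simp
    have pa: "p dvd B a x" if "x \<in> set xs" for x
      by (rule perp[OF _ that]) (use a in \<open>auto intro: spn_mem\<close>)
    \<comment> \<open>Solvability of the lifting equations is read off from the number of
      solutions.\<close>
    have pos: "(\<Sum>x\<in>box p. of_bool (\<forall>z\<in>set xs. p dvd B x z - (- (B a z div p))) :: real) > 0"
      unfolding card_sys[OF ix] using p_pos by simp
    have "\<exists>u. \<forall>z\<in>set xs. p dvd B u z - (- (B a z div p))"
    proof (rule ccontr)
      assume "\<not> ?thesis"
      then have "(\<forall>z\<in>set xs. p dvd B x z - (- (B a z div p))) = False" for x by blast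
      then show False using pos by (simp only: of_bool_eq sum.neutral_const)
    qed
    then obtain u where u: "\<forall>z\<in>set xs. p dvd B u z - (- (B a z div p))" by blast
    \<comment> \<open>The component of \<open>u\<close> along \<open>bs @ es\<close> is orthogonal
      to \<open>xs\<close> modulo p and does not affect the equations. Dropping it leaves a
      correction along \<open>cs\<close>, which keeps the whole list a basis.\<close>
    have "spn 0 ((bs @ es) @ cs) u" using b(2) by (simp add: spans_def)
    then obtain u1 where u1: "spn 0 (bs @ es) u1" "spn 0 cs (axpy u (- 1) u1)" unfolding spn_append[of 0 "bs @ es"] by blast
    define v where "v = axpy u (- 1) u1"
    have "p^2 dvd B (axpy a p v) x" if x: "x \<in> set xs" for x
    proof -
      have "p dvd B u1 x" by (rule perp[OF spn_dvd[OF _ u1(1)] x]) simp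
      moreover have "B v x - (- (B a x div p)) = (B u x - (- (B a x div p))) - B u1 x" by (simp add: v_def)
      ultimately have "p dvd B v x - (- (B a x div p))" using u x by (metis dvd_diff)
      then show ?thesis using lift_linear[OF pa[OF x]] by blast
    qed
    moreover have "spn p xs (axpy a p v)" using sa spn_vcong[OF vcong_axpy_p] by blast
    ultimately show ?thesis using u1(2) by (intro exI[of _ v]) (simp add: Lt_def v_def)
  qed
  then obtain g where g: "\<And>a. a \<in> set es \<Longrightarrow> spn 0 cs (g a) \<and> axpy a p (g a) \<in> Lt xs" by metis
  define as where "as = map (\<lambda>a. axpy a p (g a)) es"
  have la: "length as = d" by (simp add: as_def e(1))
  have "spn 0 (as @ bs @ cs) x" for x
  proof (rule spn_mono)
    show "spn 0 (bs @ es @ cs) x" using b(2) by (simp add: spans_def)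
    fix v assume v: "v \<in> set (bs @ es @ cs)"
    show "spn 0 (as @ bs @ cs) v"
    proof (cases "v \<in> set es")
      case True
      have "spn 0 (as @ bs @ cs) (axpy v p (g v))" using True by (intro spn_mem) (simp add: as_def)
      moreover have "spn 0 (as @ bs @ cs) (g v)" using g[OF True] by (auto intro: spn_subset[rotated])
      ultimately have "spn 0 (as @ bs @ cs) (axpy (axpy v p (g v)) (- p) (g v))" by (rule spn_axpy)
      moreover have "axpy (axpy v p (g v)) (- p) (g v) = v" by (simp add: axpy_def)
      ultimately show ?thesis by simp
    next
      case False then show ?thesis using v by (intro spn_mem) auto
    qed
  qed
  then have s: "spans (as @ bs @ cs)" using la b(1) lc d by (simp add: spans_def)
  have asL: "set as \<subseteq> Lt xs" using g by (auto simp: as_def)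
  have sub: "Lat as bs cs \<subseteq> Lt xs"
  proof
    fix x assume "x \<in> Lat as bs cs"
    then obtain a b' c where abc: "spn 0 as a" "spn 0 bs b'" "spn 0 cs c" "\<And>i. i < m \<Longrightarrow> x i = a i + p * b' i + p^2 * c i"
      unfolding Lat_def by blast
    have "a \<in> Lt xs" by (rule spn_in_Lt[OF abc(1) asL])
    moreover have "(\<lambda>i. p * b' i) \<in> Lt xs"
    proof -
      have "spn p (bs @ es) b'" using spn_dvd[OF _ abc(2), of p] by (auto intro: spn_subset[rotated])
      then have "p dvd B x b'" if "x \<in> set xs" for x using perp[OF _ that] B_sym by simp
      then show ?thesis by (simp add: scaled_in_Lt)
    qed
    ultimately have "axpy a 1 (\<lambda>i. p * b' i) \<in> Lt xs" by (rule Lt_axpy)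
    moreover have "vcong (p^2) x (axpy a 1 (\<lambda>i. p * b' i))" by (simp add: vcong_def abc(4))
    ultimately show "x \<in> Lt xs" using Lt_vcong by blast
  qed
  have iso: "p^2 dvd B y y" if "y \<in> Lat as bs cs" for y using Lt_pair[OF f] sub that by blast
  have "length as = length cs" using la lc by simp
  note core = core_lattice[OF s this iso]
  \<comment> \<open>Only one inclusion has been checked; a frame of full length inside
    \<open>Lt xs\<close> forces equality.\<close>
  have "Lt (map (red (p^2)) as) = Lt xs"
  proof (rule Lt_eq[OF f core(1)])
    have "set (map (red (p^2)) as) \<subseteq> Lt (map (red (p^2)) as)" by (rule frame_subset_Lt[OF core(1)])
    then show "set (map (red (p^2)) as) \<subseteq> Lt xs" using core(2) sub by blast
    have "length as = length xs" using la d(1) by (rule trans[OF _ sym])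
    then show "length (map (red (p^2)) as) = length xs" unfolding length_map .
  qed
  then have "Lat as bs cs = Lt xs" using core(2) by simp
  then show ?thesis using la b(1) lc s by blast
qed

end

section \<open>Cosets of matrices and lattices\<close>

text \<open>
  Modulo 2 the matrix of the form is skew-symmetric.
\<close>

lemma det_even_of_odd_dim:
  assumes "odd m"
  shows "even (det (qform_matrix m c))"
proof -
  define A where "A = mat m m (\<lambda>(i, j). if i = j then 0 else if i < j then c i j else - c j i :: int)"
  have A: "A \<in> carrier_mat m m" by (simp add: A_def)
  have "transpose_mat A = (- 1) \<cdot>\<^sub>m A" by (rule eq_matI) (auto simp: A_def)
  then have "det A = (- 1) ^ m * det A" using det_transpose[OF A] A by simp
  then have "det A = 0" using assms by simp
  moreover have "2 dvd det (qform_matrix m c) - det A"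
    by (rule det_cong_dvd[of _ m]) (auto simp: qform_matrix_def A_def)
  ultimately show ?thesis by simp
qed

lemma Lam_iff:
  "U \<in> Lam m \<longleftrightarrow> U \<in> carrier_mat m m \<and> (\<exists>V\<in>carrier_mat m m. U * V = 1\<^sub>m m \<and> V * U = 1\<^sub>m m)"
proof
  assume U: "U \<in> Lam m"
  then have c: "U \<in> carrier_mat m m" by (simp add: Lam_def)
  from U obtain V where V: "U * V = 1\<^sub>m (dim_row U)" "V * U = 1\<^sub>m (dim_row V)"
    by (auto simp: Lam_def invertible_mat_def inverts_mat_def)
  have "dim_col V = m" using arg_cong[OF V(1), of dim_col] c by simp
  moreover have "dim_row V = m" using arg_cong[OF V(2), of dim_col] c by simp
  ultimately show "U \<in> carrier_mat m m \<and> (\<exists>V\<in>carrier_mat m m. U * V = 1\<^sub>m m \<and> V * U = 1\<^sub>m m)"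
    using c V by (intro conjI bexI[of _ V]) auto
next
  assume "U \<in> carrier_mat m m \<and> (\<exists>V\<in>carrier_mat m m. U * V = 1\<^sub>m m \<and> V * U = 1\<^sub>m m)"
  then show "U \<in> Lam m" by (auto simp: Lam_def invertible_mat_def inverts_mat_def)
qed

lemma Lam_mult: assumes "U \<in> Lam m" "V \<in> Lam m" shows "U * V \<in> Lam m"
proof -
  obtain U' V' where i: "U' \<in> carrier_mat m m" "U * U' = 1\<^sub>m m" "U' * U = 1\<^sub>m m"
     "V' \<in> carrier_mat m m" "V * V' = 1\<^sub>m m" "V' * V = 1\<^sub>m m"
    using assms unfolding Lam_iff by blast
  have c: "U \<in> carrier_mat m m" "V \<in> carrier_mat m m" using assms by (auto simp: Lam_iff)
  have key: "(A * C) * (C' * A') = 1\<^sub>m m"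
    if "A \<in> carrier_mat m m" "C \<in> carrier_mat m m" "A' \<in> carrier_mat m m" "C' \<in> carrier_mat m m"
      "A * A' = 1\<^sub>m m" "C * C' = 1\<^sub>m m" for A C A' C' :: "int mat"
  proof -
    have "(A * C) * (C' * A') = A * (C * (C' * A'))" using that by (intro assoc_mult_mat) auto
    also have "C * (C' * A') = (C * C') * A'" using that by (intro assoc_mult_mat[symmetric]) auto
    also have "\<dots> = A'" using that by simp
    finally show ?thesis using that by simp
  qed
  have "U * V \<in> carrier_mat m m" "V' * U' \<in> carrier_mat m m" using c i by auto
  then show ?thesis unfolding Lam_iff using key[OF c i(1,4,2,5)] key[OF i(4,1) c(2,1) i(6,3)] by blast
qed

lemma Lam_inverse: assumes "U \<in> Lam m" obtains V where "V \<in> Lam m" "U * V = 1\<^sub>m m" "V * U = 1\<^sub>m m"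
proof -
  obtain V where V: "V \<in> carrier_mat m m" "U * V = 1\<^sub>m m" "V * U = 1\<^sub>m m"
    using assms unfolding Lam_iff by blast
  moreover have "V \<in> Lam m" using V assms by (auto simp: Lam_iff)
  ultimately show ?thesis using that by blast
qed

lemma Lam_one: "1\<^sub>m m \<in> Lam m"
  unfolding Lam_iff by (intro conjI bexI[of _ "1\<^sub>m m"]) auto

lemma Lam_of_det: assumes T: "T \<in> carrier_mat m m" and d: "det T * s = 1" shows "T \<in> Lam m"
proof -
  note adj = adj_mat[OF T]
  have "T * (s \<cdot>\<^sub>m adj_mat T) = s \<cdot>\<^sub>m (det T \<cdot>\<^sub>m 1\<^sub>m m)"
    using mult_smult_distrib[OF T adj(1)] adj(2) by simp
  moreover have "(s \<cdot>\<^sub>m adj_mat T) * T = s \<cdot>\<^sub>m (det T \<cdot>\<^sub>m 1\<^sub>m m)"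
    using mult_smult_assoc_mat[OF adj(1) T] adj(3) by simp
  moreover have "s \<cdot>\<^sub>m (det T \<cdot>\<^sub>m 1\<^sub>m m) = 1\<^sub>m m"
    using d by (intro eq_matI) (auto simp: mult.commute)
  ultimately show ?thesis unfolding Lam_iff using T adj(1)
    by (intro conjI bexI[of _ "s \<cdot>\<^sub>m adj_mat T"]) auto
qed

lemma Lam_det_nz: assumes "U \<in> Lam m" shows "det U \<noteq> 0"
proof -
  obtain V where V: "V \<in> carrier_mat m m" "U * V = 1\<^sub>m m" and U: "U \<in> carrier_mat m m"
    using assms unfolding Lam_iff by blast
  have "det U * det V = 1" using det_mult[OF U V(1)] V(2) by simp
  then show ?thesis by auto
qed

text \<open>The entries of index at least \<open>m\<close> are left free, as in \<open>Lt\<close>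
  and \<open>Lat\<close>, so that these sets can be compared by equality.\<close>

definition mat_lattice :: "nat \<Rightarrow> int mat \<Rightarrow> ivec set" where
  "mat_lattice m M = {x. \<exists>t\<in>carrier_vec m. \<forall>i<m. x i = (M *\<^sub>v t) $ i}"

lemma mat_lattice_mult:
  assumes "A \<in> carrier_mat m m" "C \<in> carrier_mat m m"
  shows "mat_lattice m (A * C) \<subseteq> mat_lattice m A"
proof
  fix x assume "x \<in> mat_lattice m (A * C)"
  then obtain t where t: "t \<in> carrier_vec m" "\<forall>i<m. x i = (A * C *\<^sub>v t) $ i" by (auto simp: mat_lattice_def)
  moreover have "A * C *\<^sub>v t = A *\<^sub>v (C *\<^sub>v t)" using assms t(1) by (rule assoc_mult_mat_vec)
  moreover have "C *\<^sub>v t \<in> carrier_vec m" using assms(2) t(1) by simp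
  ultimately show "x \<in> mat_lattice m A" unfolding mat_lattice_def by auto
qed

lemma mat_lattice_coset:
  assumes M: "M \<in> carrier_mat m m" and U: "U \<in> Lam m"
  shows "mat_lattice m (M * U) = mat_lattice m M"
proof
  have c: "U \<in> carrier_mat m m" using U by (simp add: Lam_iff)
  show "mat_lattice m (M * U) \<subseteq> mat_lattice m M" by (rule mat_lattice_mult[OF M c])
  obtain V where V: "V \<in> Lam m" "U * V = 1\<^sub>m m" using Lam_inverse[OF U] by blast
  then have cV: "V \<in> carrier_mat m m" by (simp add: Lam_iff)
  have "(M * U) * V = M" using assoc_mult_mat[OF M c cV] V(2) M by simp
  then show "mat_lattice m M \<subseteq> mat_lattice m (M * U)"
    using mat_lattice_mult[of "M * U" m V] M c cV by simp
qed

lemma column_in_mat_lattice: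
  assumes "A \<in> carrier_mat m m" "j < m"
  shows "(\<lambda>i. A $$ (i, j)) \<in> mat_lattice m A"
proof -
  have "A *\<^sub>v unit_vec m j = col A j" using assms by (intro eq_vecI) auto
  then show ?thesis unfolding mat_lattice_def using assms
    by (intro CollectI bexI[of _ "unit_vec m j"]) auto
qed

lemma mat_lattice_subset_factor:
  assumes A: "A \<in> carrier_mat m m" and M: "M \<in> carrier_mat m m" and s: "mat_lattice m A \<subseteq> mat_lattice m M"
  shows "\<exists>T\<in>carrier_mat m m. A = M * T"
proof -
  have "\<exists>t\<in>carrier_vec m. \<forall>i<m. A $$ (i, j) = (M *\<^sub>v t) $ i" if "j < m" for j
  proof -
    have "(\<lambda>i. A $$ (i, j)) \<in> mat_lattice m M" using column_in_mat_lattice[OF A that] s by blast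
    then show ?thesis by (simp add: mat_lattice_def)
  qed
  then have "\<forall>j. \<exists>t. j < m \<longrightarrow> t \<in> carrier_vec m \<and> (\<forall>i<m. A $$ (i, j) = (M *\<^sub>v t) $ i)" by blast
  then obtain t where t': "\<forall>j. j < m \<longrightarrow> t j \<in> carrier_vec m \<and> (\<forall>i<m. A $$ (i, j) = (M *\<^sub>v t j) $ i)"
    by (rule choice[THEN exE]) blast
  have t: "t j \<in> carrier_vec m" "i < m \<Longrightarrow> A $$ (i, j) = (M *\<^sub>v t j) $ i" if "j < m" for i j
    using t' that by blast+
  define T where "T = mat m m (\<lambda>(i, j). t j $ i)"
  have "A = M * T"
  proof (rule eq_matI)
    fix i j assume "i < dim_row (M * T)" "j < dim_col (M * T)"
    then have ij: "i < m" "j < m" using M by (auto simp: T_def)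
    have "col T j = t j" using t(1)[OF ij(2)] ij by (intro eq_vecI) (auto simp: T_def)
    then show "A $$ (i, j) = (M * T) $$ (i, j)" using t(2)[OF ij(2,1)] ij M by (simp add: T_def)
  qed (use A M in \<open>auto simp: T_def\<close>)
  then show ?thesis by (intro bexI[of _ T]) (auto simp: T_def)
qed

text \<open>Factoring both ways gives \<open>det T * det S = 1\<close> once the nonzero
  \<open>det M\<close> is cancelled, so the factor is unimodular.\<close>

lemma mat_lattice_eq_factor:
  assumes A: "A \<in> carrier_mat m m" and M: "M \<in> carrier_mat m m" and d: "det M \<noteq> 0"
    and e: "mat_lattice m A = mat_lattice m M"
  shows "\<exists>U\<in>Lam m. A = M * U"
proof -
  obtain T where T: "T \<in> carrier_mat m m" "A = M * T" using mat_lattice_subset_factor[OF A M] e by blast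
  obtain S where S: "S \<in> carrier_mat m m" "M = A * S" using mat_lattice_subset_factor[OF M A] e by blast
  have "det A = det M * det T" using det_mult[OF M T(1)] by (simp flip: T(2))
  moreover have "det M = det A * det S" using det_mult[OF A S(1)] by (simp flip: S(2))
  ultimately have "det M = det M * det T * det S" by simp
  then have "det M * (det T * det S) = det M * 1" by (simp add: mult.assoc)
  then have "det T * det S = 1" using d mult_left_cancel by blast
  then show ?thesis using Lam_of_det[OF T(1)] T(2) by blast
qed

lemma left_coset_eq_iff:
  assumes A: "A \<in> carrier_mat m m" and M: "M \<in> carrier_mat m m" and d: "det M \<noteq> 0"
  shows "left_coset m A = left_coset m M \<longleftrightarrow> mat_lattice m A = mat_lattice m M"
proof
  assume e: "left_coset m A = left_coset m M"
  have "A * 1\<^sub>m m \<in> left_coset m A" unfolding left_coset_def using Lam_one by blast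
  then obtain U where "U \<in> Lam m" "A = M * U" using e A by (auto simp: left_coset_def)
  then show "mat_lattice m A = mat_lattice m M" using mat_lattice_coset[OF M] by simp
next
  assume "mat_lattice m A = mat_lattice m M"
  then obtain U where U: "U \<in> Lam m" "A = M * U" using mat_lattice_eq_factor[OF A M d] by blast
  obtain V where V: "V \<in> Lam m" "U * V = 1\<^sub>m m" using Lam_inverse[OF U(1)] by blast
  have c: "U \<in> carrier_mat m m" "V \<in> carrier_mat m m" using U V by (auto simp: Lam_iff)
  show "left_coset m A = left_coset m M"
  proof (intro equalityI subsetI)
    fix X assume "X \<in> left_coset m A"
    then obtain W where W: "W \<in> Lam m" "X = M * U * W" by (auto simp: left_coset_def U(2))
    then have "X = M * (U * W)" using assoc_mult_mat[OF M c(1)] by (auto simp: Lam_iff)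
    then show "X \<in> left_coset m M" unfolding left_coset_def using Lam_mult[OF U(1) W(1)] by blast
  next
    fix X assume "X \<in> left_coset m M"
    then obtain W where W: "W \<in> Lam m" "X = M * W" by (auto simp: left_coset_def)
    have cW: "W \<in> carrier_mat m m" using W by (simp add: Lam_iff)
    have "A * (V * W) = M * (U * (V * W))" unfolding U(2) using M c cW by (intro assoc_mult_mat) auto
    also have "U * (V * W) = (U * V) * W" using c cW by (intro assoc_mult_mat[symmetric]) auto
    also have "\<dots> = W" using V(2) cW by simp
    finally have "X = A * (V * W)" using W(2) by simp
    then show "X \<in> left_coset m A" unfolding left_coset_def using Lam_mult[OF V(1) W(1)] by blast
  qed
qed

lemma D_mat_det: assumes "p > 0" shows "det (D_mat m p d) \<noteq> 0"
proof -
  have "det (D_mat m p d) = prod_list (diag_mat (D_mat m p d))"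
    by (rule det_upper_triangular[of _ m]) (auto simp: D_mat_def mat_diag_def)
  also have "\<dots> \<noteq> 0" using assms by (auto simp: diag_mat_def D_mat_def mat_diag_def prod_list_zero_iff)
  finally show ?thesis .
qed

lemma double_coset_D:
  assumes M: "M \<in> double_coset m (D_mat m p d)" and p: "p > 0"
  shows "M \<in> carrier_mat m m" "det M \<noteq> 0"
    "\<exists>U\<in>Lam m. mat_lattice m M = mat_lattice m (U * D_mat m p d)"
proof -
  obtain U V where UV: "U \<in> Lam m" "V \<in> Lam m" "M = U * D_mat m p d * V"
    using M by (auto simp: double_coset_def)
  have c: "U \<in> carrier_mat m m" "V \<in> carrier_mat m m" "D_mat m p d \<in> carrier_mat m m"
    using UV by (auto simp: Lam_iff D_mat_def)
  have c2: "U * D_mat m p d \<in> carrier_mat m m" using c by simp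
  show "M \<in> carrier_mat m m" using c UV(3) by simp
  show "det M \<noteq> 0"
    unfolding UV(3) det_mult[OF c2 c(2)] det_mult[OF c(1) c(3)]
    using Lam_det_nz[OF UV(1)] Lam_det_nz[OF UV(2)] D_mat_det[OF p] by simp
  show "\<exists>U\<in>Lam m. mat_lattice m M = mat_lattice m (U * D_mat m p d)"
    using mat_lattice_coset[OF c2 UV(2)] UV by blast
qed

lemma mat_divides_vec_iff:
  assumes "M \<in> carrier_mat m m" "K \<in> carrier_vec m"
  shows "mat_divides_vec m M K \<longleftrightarrow> ($) K \<in> mat_lattice m M"
proof -
  have "K = M *\<^sub>v L \<longleftrightarrow> (\<forall>i<m. K $ i = (M *\<^sub>v L) $ i)" for L
    using assms by (auto intro!: eq_vecI)
  then show ?thesis by (simp add: mat_divides_vec_def mat_lattice_def)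
qed

lemma isotropic_sum_lattices:
  assumes p: "p > 0" and K: "K \<in> carrier_vec m"
  shows "isotropic_sum m n q (D_mat m p d) K =
    card {L. \<exists>M. M \<in> double_coset m (D_mat m p d) \<and> form_cong_0 m (int n) (form_subst q M) \<and>
      L = mat_lattice m M \<and> ($) K \<in> L}"
    (is "_ = card ?X")
proof -
  let ?G = "\<lambda>M. M \<in> double_coset m (D_mat m p d) \<and> form_cong_0 m (int n) (form_subst q M) \<and> mat_divides_vec m M K"
  let ?S = "{left_coset m M | M. ?G M}"
  \<comment> \<open>The union over a coset assigns a lattice to it without choosing a
    representative, since all members have the same lattice.\<close>
  define h where "h C = (\<Union>M\<in>C. mat_lattice m M)" for C
  have h: "h (left_coset m M) = mat_lattice m M" if "M \<in> carrier_mat m m" for M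
  proof -
    have "M * 1\<^sub>m m \<in> left_coset m M" unfolding left_coset_def using Lam_one by blast
    moreover have "mat_lattice m X = mat_lattice m M" if "X \<in> left_coset m M" for X
      using that mat_lattice_coset[OF \<open>M \<in> carrier_mat m m\<close>] by (auto simp: left_coset_def)
    ultimately show ?thesis unfolding h_def by blast
  qed
  have "inj_on h ?S"
  proof (rule inj_onI)
    fix X Y assume "X \<in> ?S" "Y \<in> ?S" and e: "h X = h Y"
    then obtain M N where MN: "X = left_coset m M" "Y = left_coset m N" "?G M" "?G N" by blast
    then show "X = Y" using e h left_coset_eq_iff double_coset_D p by metis
  qed
  then have "card ?S = card (h ` ?S)" by (rule card_image[symmetric])
  also have "h ` ?S = ?X"
  proof (intro equalityI subsetI)
    fix L assume "L \<in> h ` ?S"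
    then obtain M where M: "?G M" "L = h (left_coset m M)" by blast
    have c: "M \<in> carrier_mat m m" using double_coset_D(1) M(1) p by blast
    show "L \<in> ?X"
      using M h[OF c] mat_divides_vec_iff[OF c K] by blast
  next
    fix L assume "L \<in> ?X"
    then obtain M where M: "M \<in> double_coset m (D_mat m p d)" "form_cong_0 m (int n) (form_subst q M)"
      "L = mat_lattice m M" "($) K \<in> L" by blast
    have c: "M \<in> carrier_mat m m" using double_coset_D(1) M(1) p by blast
    have "?G M" using M mat_divides_vec_iff[OF c K] by blast
    then show "L \<in> h ` ?S" using h[OF c] M(3) by blast
  qed
  finally show ?thesis by (simp add: isotropic_sum_def)
qed

lemma sum_append_list:
  "(\<Sum>j<length (xs @ ys). t j * ((xs @ ys) ! j) i) =
   (\<Sum>j<length xs. t j * (xs ! j) i) + (\<Sum>j<length ys. t (length xs + j) * (ys ! j) i :: int)"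
proof (induction ys rule: rev_induct)
  case Nil
  then show ?case by simp
next
  case (snoc y ys)
  have "(\<Sum>j<length (xs @ ys @ [y]). t j * ((xs @ ys @ [y]) ! j) i) =
     (\<Sum>j<length (xs @ ys). t j * ((xs @ ys @ [y]) ! j) i) + t (length (xs @ ys)) * y i"
    by (simp add: nth_append)
  also have "(\<Sum>j<length (xs @ ys). t j * ((xs @ ys @ [y]) ! j) i) = (\<Sum>j<length (xs @ ys). t j * ((xs @ ys) ! j) i)"
    by (intro sum.cong refl) (auto simp: nth_append)
  also note snoc.IH
  also have "(\<Sum>j<length ys. t (length xs + j) * (ys ! j) i) = (\<Sum>j<length ys. t (length xs + j) * ((ys @ [y]) ! j) i)"
    by (intro sum.cong refl) (simp add: nth_append)
  finally show ?case by simp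
qed

context quad_space
begin

definition mat_of_list :: "ivec list \<Rightarrow> int mat" where
  "mat_of_list us = mat m m (\<lambda>(i, j). (us ! j) i)"

lemma mat_of_list_carrier [simp]: "mat_of_list us \<in> carrier_mat m m"
  by (simp add: mat_of_list_def)

lemma mat_of_list_mult_vec:
  assumes "t \<in> carrier_vec m" "i < m"
  shows "(mat_of_list us *\<^sub>v t) $ i = (\<Sum>j<m. t $ j * (us ! j) i)"
  using assms by (simp add: mat_of_list_def scalar_prod_def atLeast0LessThan mult.commute)

lemma Lam_spans:
  assumes U: "U \<in> Lam m"
  shows "\<exists>us. spans us \<and> U = mat_of_list us"
proof -
  let ?us = "map (\<lambda>j i. U $$ (i, j)) [0..<m]"
  obtain V where V: "V \<in> carrier_mat m m" "U * V = 1\<^sub>m m" and cU: "U \<in> carrier_mat m m"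
    using U unfolding Lam_iff by blast
  have e: "U = mat_of_list ?us" using cU by (intro eq_matI) (auto simp: mat_of_list_def)
  have "spn 0 ?us x" for x
  proof -
    define t where "t = V *\<^sub>v vec m x"
    have ct: "t \<in> carrier_vec m" using V(1) by (simp add: t_def)
    have "U *\<^sub>v t = vec m x" using assoc_mult_mat_vec[OF cU V(1), of "vec m x"] V(2) by (simp add: t_def)
    then have "x i = (\<Sum>j<m. t $ j * (?us ! j) i)" if "i < m" for i
      using mat_of_list_mult_vec[OF ct that, of ?us] that unfolding e[symmetric] by simp
    then show ?thesis unfolding spn_0_iff by (intro exI[of _ "\<lambda>j. t $ j"]) simp
  qed
  then have "spans ?us" by (simp add: spans_def)
  then show ?thesis using e by blast
qed

lemma spans_Lam: assumes s: "spans us" shows "mat_of_list us \<in> Lam m"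
proof -
  have "\<forall>l. \<exists>t. \<forall>i<m. (if i = l then 1 else 0) = (\<Sum>j<m. t j * (us ! j) i)"
  proof
    fix l
    have "spn 0 us (\<lambda>i. if i = l then 1 else 0)" using s by (simp add: spans_def)
    then show "\<exists>t. \<forall>i<m. (if i = l then 1 else 0) = (\<Sum>j<m. t j * (us ! j) i)"
      using s unfolding spn_0_iff spans_def by simp
  qed
  from choice[OF this] obtain t where t: "\<And>l i. i < m \<Longrightarrow> (if i = l then 1 else 0) = (\<Sum>j<m. t l j * (us ! j) i)" by blast
  define T where "T = mat m m (\<lambda>(j, l). t l j)"
  have T: "T \<in> carrier_mat m m" by (simp add: T_def)
  have "mat_of_list us * T = 1\<^sub>m m"
  proof (rule eq_matI)
    fix i l assume "i < dim_row (1\<^sub>m m :: int mat)" "l < dim_col (1\<^sub>m m :: int mat)"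
    then have il: "i < m" "l < m" by auto
    have "(mat_of_list us * T) $$ (i, l) = (\<Sum>j<m. t l j * (us ! j) i)"
      using il by (simp add: mat_of_list_def T_def scalar_prod_def atLeast0LessThan mult.commute)
    then show "(mat_of_list us * T) $$ (i, l) = 1\<^sub>m m $$ (i, l)" using t[OF il(1), of l] il by simp
  qed (auto simp: mat_of_list_def T_def)
  then have "det (mat_of_list us) * det T = 1" using det_mult[OF mat_of_list_carrier[of us] T] by simp
  then show ?thesis by (rule Lam_of_det[OF mat_of_list_carrier])
qed

lemma mat_lattice_D:
  assumes l: "length as = d" "length bs = m - 2 * d" "length cs = d" "2 * d \<le> m" and p: "p = int n"
  shows "mat_lattice m (mat_of_list (as @ bs @ cs) * D_mat m n d) = Lat as bs cs"
proof -
  define w where "w j = (if j < d then 1 else if j < d + (m - 2 * d) then p else p^2)" for j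
  let ?us = "as @ bs @ cs"
  have us: "length ?us = m" using l by simp
  have UD: "mat_of_list ?us * D_mat m n d = mat m m (\<lambda>(i, j). (?us ! j) i * w j)"
    unfolding D_mat_def mat_diag_mult_right[OF mat_of_list_carrier] using p
    by (intro eq_matI) (auto simp: mat_of_list_def w_def)
  have coef: "((mat_of_list ?us * D_mat m n d) *\<^sub>v t) $ i = (\<Sum>j<m. (w j * t $ j) * (?us ! j) i)"
    if "t \<in> carrier_vec m" "i < m" for t i
    unfolding UD using that by (simp add: scalar_prod_def atLeast0LessThan mult_ac)
  have split: "(\<Sum>j<m. (w j * s j) * (?us ! j) i) =
     (\<Sum>j<length as. s j * (as ! j) i) + p * (\<Sum>j<length bs. s (d + j) * (bs ! j) i) +
       p^2 * (\<Sum>j<length cs. s (d + (m - 2 * d) + j) * (cs ! j) i)" for s :: "nat \<Rightarrow> int" and i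
  proof -
    have "(\<Sum>j<m. (w j * s j) * (?us ! j) i) = (\<Sum>j<length as. (w j * s j) * (as ! j) i) +
       ((\<Sum>j<length bs. (w (length as + j) * s (length as + j)) * (bs ! j) i) +
        (\<Sum>j<length cs. (w (length as + (length bs + j)) * s (length as + (length bs + j))) * (cs ! j) i))"
      using sum_append_list[of "\<lambda>j. w j * s j" as "bs @ cs" i]
        sum_append_list[of "\<lambda>j. w (length as + j) * s (length as + j)" bs cs i] us by simp
    also have "(\<Sum>j<length as. (w j * s j) * (as ! j) i) = (\<Sum>j<length as. s j * (as ! j) i)"
      using l by (intro sum.cong) (auto simp: w_def)
    also have "(\<Sum>j<length bs. (w (length as + j) * s (length as + j)) * (bs ! j) i) = p * (\<Sum>j<length bs. s (d + j) * (bs ! j) i)"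
      unfolding sum_distrib_left using l by (intro sum.cong) (auto simp: w_def)
    also have "(\<Sum>j<length cs. (w (length as + (length bs + j)) * s (length as + (length bs + j))) * (cs ! j) i) =
        p^2 * (\<Sum>j<length cs. s (d + (m - 2 * d) + j) * (cs ! j) i)"
      unfolding sum_distrib_left using l by (intro sum.cong) (auto simp: w_def add.assoc)
    finally show ?thesis by simp
  qed
  show ?thesis
  proof (intro equalityI subsetI)
    fix x assume "x \<in> mat_lattice m (mat_of_list ?us * D_mat m n d)"
    then obtain t where t: "t \<in> carrier_vec m" "\<And>i. i < m \<Longrightarrow> x i = ((mat_of_list ?us * D_mat m n d) *\<^sub>v t) $ i"
      by (auto simp: mat_lattice_def)
    show "x \<in> Lat as bs cs"
    proof (rule LatI)
      show "spn 0 as (\<lambda>i. \<Sum>j<length as. t $ j * (as ! j) i)" unfolding spn_0_iff by blast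
      show "spn 0 bs (\<lambda>i. \<Sum>j<length bs. t $ (d + j) * (bs ! j) i)"
        unfolding spn_0_iff by (rule exI[of _ "\<lambda>j. t $ (d + j)"]) simp
      show "spn 0 cs (\<lambda>i. \<Sum>j<length cs. t $ (d + (m - 2 * d) + j) * (cs ! j) i)"
        unfolding spn_0_iff by (rule exI[of _ "\<lambda>j. t $ (d + (m - 2 * d) + j)"]) simp
    next
      fix i assume i: "i < m"
      show "x i = (\<Sum>j<length as. t $ j * (as ! j) i) + p * (\<Sum>j<length bs. t $ (d + j) * (bs ! j) i) +
        p^2 * (\<Sum>j<length cs. t $ (d + (m - 2 * d) + j) * (cs ! j) i)"
        unfolding t(2)[OF i] coef[OF t(1) i] by (rule split)
    qed
  next
    fix x assume "x \<in> Lat as bs cs"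
    then obtain a b c where abc: "spn 0 as a" "spn 0 bs b" "spn 0 cs c" "\<And>i. i < m \<Longrightarrow> x i = a i + p * b i + p^2 * c i"
      unfolding Lat_def by blast
    obtain ta where ta: "\<And>i. i < m \<Longrightarrow> a i = (\<Sum>j<length as. ta j * (as ! j) i)" using abc(1) unfolding spn_0_iff by blast
    obtain tb where tb: "\<And>i. i < m \<Longrightarrow> b i = (\<Sum>j<length bs. tb j * (bs ! j) i)" using abc(2) unfolding spn_0_iff by blast
    obtain tc where tc: "\<And>i. i < m \<Longrightarrow> c i = (\<Sum>j<length cs. tc j * (cs ! j) i)" using abc(3) unfolding spn_0_iff by blast
    define s where "s j = (if j < d then ta j else if j < d + (m - 2 * d) then tb (j - d) else tc (j - (d + (m - 2 * d))))" for j
    have "x i = ((mat_of_list ?us * D_mat m n d) *\<^sub>v vec m s) $ i" if i: "i < m" for i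
    proof -
      have "((mat_of_list ?us * D_mat m n d) *\<^sub>v vec m s) $ i = (\<Sum>j<m. (w j * s j) * (?us ! j) i)"
        using coef[of "vec m s" i] i by simp
      also have "\<dots> = (\<Sum>j<length as. s j * (as ! j) i) + p * (\<Sum>j<length bs. s (d + j) * (bs ! j) i) +
         p^2 * (\<Sum>j<length cs. s (d + (m - 2 * d) + j) * (cs ! j) i)" by (rule split)
      also have "(\<Sum>j<length as. s j * (as ! j) i) = a i"
        unfolding ta[OF i] using l by (intro sum.cong) (auto simp: s_def)
      also have "(\<Sum>j<length bs. s (d + j) * (bs ! j) i) = b i"
        unfolding tb[OF i] using l by (intro sum.cong) (auto simp: s_def)
      also have "(\<Sum>j<length cs. s (d + (m - 2 * d) + j) * (cs ! j) i) = c i"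
        unfolding tc[OF i] using l by (intro sum.cong) (auto simp: s_def)
      finally show ?thesis using abc(4)[OF i] by simp
    qed
    then show "x \<in> mat_lattice m (mat_of_list ?us * D_mat m n d)"
      unfolding mat_lattice_def by (intro CollectI bexI[of _ "vec m s"]) auto
  qed
qed

text \<open>From left to right the columns of \<open>U\<close> form a basis to which
  \<open>core_lattice\<close> applies; from right to left \<open>exists_basis\<close> supplies the
  matrix.\<close>

lemma lattices_eq_mat_lattices:
  assumes d: "2 * d \<le> m" and p: "p = int n"
  shows "{L. \<exists>M. M \<in> double_coset m (D_mat m n d) \<and> (\<forall>y\<in>mat_lattice m M. p^2 dvd B y y) \<and> L = mat_lattice m M} = lattices d"
proof (intro equalityI subsetI)
  fix L assume "L \<in> {L. \<exists>M. M \<in> double_coset m (D_mat m n d) \<and> (\<forall>y\<in>mat_lattice m M. p^2 dvd B y y) \<and> L = mat_lattice m M}"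
  then obtain M where M: "M \<in> double_coset m (D_mat m n d)" "\<And>y. y \<in> L \<Longrightarrow> p^2 dvd B y y" "L = mat_lattice m M" by blast
  have n: "n > 0" using p p_pos by simp
  obtain U where U: "U \<in> Lam m" "L = mat_lattice m (U * D_mat m n d)" using double_coset_D(3)[OF M(1) n] M(3) by blast
  obtain us where us: "spans us" "U = mat_of_list us" using Lam_spans[OF U(1)] by blast
  define as where "as = take d us"
  define bs where "bs = take (m - 2 * d) (drop d us)"
  define cs where "cs = drop (m - 2 * d) (drop d us)"
  have e: "us = as @ bs @ cs" by (simp only: as_def bs_def cs_def append_take_drop_id)
  have lu: "length us = m" using us(1) by (simp add: spans_def)
  have l: "length as = d" "length bs = m - 2 * d" "length cs = d"
    using lu d by (auto simp: as_def bs_def cs_def)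
  have L: "L = Lat as bs cs" using mat_lattice_D[OF l d p] U(2) us(2) e by simp
  have s: "spans (as @ bs @ cs)" using us(1) e by simp
  have lac: "length as = length cs" using l by simp
  have iso: "p^2 dvd B y y" if "y \<in> Lat as bs cs" for y using M(2) that L by simp
  have core: "frame [] [] (map (red (p^2)) as)" "Lat as bs cs = Lt (map (red (p^2)) as)"
    using core_lattice[OF s lac] iso by blast+
  have "length (map (red (p^2)) as) = d" using l by simp
  then show "L \<in> lattices d" unfolding L core(2) lattices_def using core(1) by blast
next
  fix L assume "L \<in> lattices d"
  then obtain xs where xs: "length xs = d" "frame [] [] xs" "L = Lt xs" by (auto simp: lattices_def)
  obtain as bs cs where l: "length as = d" "length bs = m - 2 * d" "length cs = d" and s: "spans (as @ bs @ cs)"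
    and L: "Lat as bs cs = Lt xs" using exists_basis[OF xs(2,1) d] by blast
  define M where "M = mat_of_list (as @ bs @ cs) * D_mat m n d"
  have "D_mat m n d \<in> carrier_mat m m" by (simp add: D_mat_def)
  then have "M \<in> carrier_mat m m" unfolding M_def by (intro mult_carrier_mat[OF mat_of_list_carrier])
  then have M1: "M = mat_of_list (as @ bs @ cs) * D_mat m n d * 1\<^sub>m m"
    unfolding M_def[symmetric] by (rule right_mult_one_mat[symmetric])
  have dc: "M \<in> double_coset m (D_mat m n d)"
    unfolding double_coset_def by (rule CollectI, rule exI, rule exI, intro conjI, rule M1, rule spans_Lam[OF s], rule Lam_one)
  have ml: "L = mat_lattice m M" unfolding M_def mat_lattice_D[OF l d p] L xs(3) ..
  have "\<forall>y\<in>mat_lattice m M. p^2 dvd B y y" unfolding ml[symmetric] xs(3) using Lt_pair[OF xs(2)] by blast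
  with dc ml show "L \<in> {L. \<exists>M. M \<in> double_coset m (D_mat m n d) \<and> (\<forall>y\<in>mat_lattice m M. p^2 dvd B y y) \<and> L = mat_lattice m M}"
    by blast
qed

lemma B_sum_left:
  fixes n :: nat
  shows "B (\<lambda>a. \<Sum>j<n. t j * f j a) z = (\<Sum>j<n. t j * B (f j) z)"
proof (induction n)
  case (Suc n)
  have "(\<lambda>a. \<Sum>j<Suc n. t j * f j a) = axpy (\<lambda>a. \<Sum>j<n. t j * f j a) (t n) (f n)" by auto
  then show ?case using Suc by simp
qed simp

lemma B_sum_right:
  fixes n :: nat
  shows "B z (\<lambda>a. \<Sum>j<n. t j * f j a) = (\<Sum>j<n. t j * B z (f j))"
  using B_sum_left[where n = n and t = t and f = f and z = z] by (simp add: B_sym[of z])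

lemma B_eq: "(\<And>i. i < m \<Longrightarrow> x i = x' i) \<Longrightarrow> (\<And>i. i < m \<Longrightarrow> y i = y' i) \<Longrightarrow> B x y = B x' y'"
  unfolding B_def by (intro sum.cong) auto

lemma mat_lattice_axpy:
  assumes M: "M \<in> carrier_mat m m" and xy: "x \<in> mat_lattice m M" "y \<in> mat_lattice m M"
  shows "axpy x r y \<in> mat_lattice m M"
proof -
  obtain t s where t: "t \<in> carrier_vec m" "\<And>i. i < m \<Longrightarrow> x i = (M *\<^sub>v t) $ i"
    and s: "s \<in> carrier_vec m" "\<And>i. i < m \<Longrightarrow> y i = (M *\<^sub>v s) $ i"
    using xy by (auto simp: mat_lattice_def)
  have "axpy x r y i = (M *\<^sub>v (t + r \<cdot>\<^sub>v s)) $ i" if i: "i < m" for i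
  proof -
    have "(M *\<^sub>v (t + r \<cdot>\<^sub>v s)) $ i = (\<Sum>j<m. M $$ (i, j) * t $ j + r * (M $$ (i, j) * s $ j))"
      using M t(1) s(1) i by (simp add: scalar_prod_def atLeast0LessThan algebra_simps sum.distrib)
    also have "\<dots> = (M *\<^sub>v t) $ i + r * (M *\<^sub>v s) $ i"
      using M t(1) s(1) i by (simp add: scalar_prod_def atLeast0LessThan sum.distrib sum_distrib_left)
    finally show ?thesis using t(2)[OF i] s(2)[OF i] by simp
  qed
  moreover have "t + r \<cdot>\<^sub>v s \<in> carrier_vec m" using t(1) s(1) by simp
  ultimately show ?thesis unfolding mat_lattice_def by (intro CollectI bexI[of _ "t + r \<cdot>\<^sub>v s"]) simp_all
qed

text \<open>The coefficients of the substituted form are the values of \<open>B\<close> at pairs of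
  distinct columns of \<open>M\<close> and half of those at equal columns. Polarization controls
  both, as 2 is a unit modulo \<open>p^2\<close>.\<close>

lemma form_cong_iff:
  assumes q: "\<And>Y. Y \<in> carrier_vec m \<Longrightarrow> q Y = qform m c Y"
    and Bq: "\<And>Y. Y \<in> carrier_vec m \<Longrightarrow> 2 * qform m c Y = B (($) Y) (($) Y)"
    and M: "M \<in> carrier_mat m m"
  shows "form_cong_0 m (p^2) (form_subst q M) \<longleftrightarrow> (\<forall>y\<in>mat_lattice m M. p^2 dvd B y y)"
proof
  assume "form_cong_0 m (p^2) (form_subst q M)"
  then obtain c' where c': "\<And>Y. Y \<in> carrier_vec m \<Longrightarrow> form_subst q M Y = qform m c' Y"
    "\<And>i j. i \<le> j \<Longrightarrow> j < m \<Longrightarrow> p^2 dvd c' i j" by (auto simp: form_cong_0_def)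
  show "\<forall>y\<in>mat_lattice m M. p^2 dvd B y y"
  proof
    fix y assume "y \<in> mat_lattice m M"
    then obtain t where t: "t \<in> carrier_vec m" "\<And>i. i < m \<Longrightarrow> y i = (M *\<^sub>v t) $ i" by (auto simp: mat_lattice_def)
    have Mt: "M *\<^sub>v t \<in> carrier_vec m" using M t(1) by simp
    have "p^2 dvd qform m c' t" unfolding qform_def by (intro dvd_sum) (auto intro!: dvd_mult2 c'(2))
    also have "qform m c' t = qform m c (M *\<^sub>v t)" using c'(1)[OF t(1)] q[OF Mt] by (simp add: form_subst_def)
    finally have "p^2 dvd 2 * qform m c (M *\<^sub>v t)" by simp
    also have "2 * qform m c (M *\<^sub>v t) = B y y" unfolding Bq[OF Mt] using t(2) by (intro B_eq) auto
    finally show "p^2 dvd B y y" .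
  qed
next
  assume iso: "\<forall>y\<in>mat_lattice m M. p^2 dvd B y y"
  define f where "f j = (\<lambda>i. M $$ (i, j))" for j
  have fL: "f j \<in> mat_lattice m M" if "j < m" for j unfolding f_def by (rule column_in_mat_lattice[OF M that])
  have fB: "p^2 dvd B (f i) (f j)" if ij: "i < m" "j < m" for i j
  proof (rule p2_dvd_2)
    have "2 * B (f i) (f j) = B (axpy (f i) 1 (f j)) (axpy (f i) 1 (f j)) - B (f i) (f i) - B (f j) (f j)"
      by (simp add: B_sym[of "f j" "f i"])
    also have "p^2 dvd \<dots>"
      using iso fL ij mat_lattice_axpy[OF M fL[OF ij(1)] fL[OF ij(2)], of 1] by (intro dvd_diff) auto
    finally show "p^2 dvd 2 * B (f i) (f j)" .
  qed
  \<comment> \<open>The division is exact: \<open>B (f i) (f i)\<close> is twice a value of the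
    form, see \<open>ev\<close>.\<close>
  define c' where "c' i j = (if i = j then B (f i) (f i) div 2 else B (f i) (f j))" for i j
  have ev: "2 * (B (f i) (f i) div 2) = B (f i) (f i)" if "i < m" for i
  proof -
    have "2 * qform m c (vec m (f i)) = B (f i) (f i)"
      unfolding Bq[OF vec_carrier] by (intro B_eq) auto
    then have "2 dvd B (f i) (f i)" by (metis dvd_triv_left)
    then show ?thesis by simp
  qed
  have "form_subst q M Y = qform m c' Y" if Y: "Y \<in> carrier_vec m" for Y
  proof -
    have MY: "M *\<^sub>v Y \<in> carrier_vec m" using M Y by simp
    have "2 * qform m c (M *\<^sub>v Y) = B (($) (M *\<^sub>v Y)) (($) (M *\<^sub>v Y))" by (rule Bq[OF MY])
    also have "\<dots> = B (\<lambda>a. \<Sum>j<m. Y $ j * f j a) (\<lambda>a. \<Sum>j<m. Y $ j * f j a)"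
      using M Y by (intro B_eq) (simp_all add: f_def scalar_prod_def atLeast0LessThan mult.commute)
    also have "\<dots> = (\<Sum>i<m. \<Sum>j<m. Y $ i * B (f i) (f j) * Y $ j)"
      unfolding B_sum_left unfolding B_sum_right by (simp add: sum_distrib_left mult_ac)
    also have "\<dots> = (\<Sum>i<m. \<Sum>j<m. Y $ i * qform_matrix m c' $$ (i, j) * Y $ j)"
    proof (intro sum.cong refl)
      fix i j assume "i \<in> {..<m}" "j \<in> {..<m}"
      then have "qform_matrix m c' $$ (i, j) = B (f i) (f j)"
        using ev by (auto simp: qform_matrix_def c'_def B_sym)
      then show "Y $ i * B (f i) (f j) * Y $ j = Y $ i * qform_matrix m c' $$ (i, j) * Y $ j" by simp
    qed
    also have "\<dots> = Y \<bullet> (qform_matrix m c' *\<^sub>v Y)"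
      using Y by (simp add: scalar_prod_def qform_matrix_def atLeast0LessThan sum_distrib_left mult_ac)
    also have "\<dots> = 2 * qform m c' Y" by (rule qform_gram[OF Y, symmetric])
    finally show ?thesis using q[OF MY] by (simp add: form_subst_def)
  qed
  moreover have "p^2 dvd c' i j" if "i \<le> j" "j < m" for i j
  proof (cases "i = j")
    case True
    have "p^2 dvd 2 * (B (f i) (f i) div 2)" using fB[of i i] ev[of i] that True by simp
    then have "p^2 dvd B (f i) (f i) div 2" by (rule p2_dvd_2)
    then show ?thesis using True by (simp add: c'_def)
  next
    case False then show ?thesis using fB that by (simp add: c'_def)
  qed
  ultimately show "form_cong_0 m (p^2) (form_subst q M)" unfolding form_cong_0_def by blast
qed

end

lemma delta_scaled:
  assumes "n > 0" "K \<in> carrier_vec m"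
  shows "delta ((1 / real n) \<cdot>\<^sub>v map_vec real_of_int K) = of_bool (\<forall>i<m. int n dvd K $ i)"
proof -
  have "(1 / real n) * real_of_int x \<in> \<int> \<longleftrightarrow> int n dvd x" for x
  proof
    assume "(1 / real n) * real_of_int x \<in> \<int>"
    then obtain z where "(1 / real n) * real_of_int x = real_of_int z" by (auto elim: Ints_cases)
    then have "real_of_int x = real_of_int (int n * z)" using assms(1) by (simp add: field_simps)
    then have "x = int n * z" by (simp only: of_int_eq_iff)
    then show "int n dvd x" by simp
  next
    assume "int n dvd x"
    then obtain z where "x = int n * z" by blast
    then have "(1 / real n) * real_of_int x = real_of_int z" using assms(1) by simp
    then show "(1 / real n) * real_of_int x \<in> \<int>" by simp
  qed
  then show ?thesis using assms(2) by (simp add: delta_def)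
qed

theorem theorem1p9:
  fixes m k d p :: nat and q :: "int vec \<Rightarrow> int" and Q :: "int mat" and K :: "int vec"
  assumes "m = 2 * k + 1" and "m \<ge> 3"
    and "integral_form_with_matrix m q Q" and "det Q \<noteq> 0"
    and "prime p" and "\<not> int p dvd det Q"
    and "1 \<le> d" and "d \<le> k"
    and "K \<in> carrier_vec m" and "[q K = 0] (mod (int p ^ 2))"
  shows "real (isotropic_sum m (p ^ 2) q (D_mat m p d) K) =
    alpha p k d *
      (1 + (real_of_int (eps p q K * chi p k Q) * real p ^ (k - 1) + kappa p m d)
             * delta ((1 / real p) \<cdot>\<^sub>v map_vec real_of_int K)
         + real p ^ (m - 2) * delta ((1 / real p ^ 2) \<cdot>\<^sub>v map_vec real_of_int K))"
proof -
  obtain c where c: "\<And>Y. Y \<in> carrier_vec m \<Longrightarrow> q Y = qform m c Y" "Q = qform_matrix m c"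
    using assms(3) by (auto simp: integral_form_with_matrix_def)
  define G where "G i j = (if i = j then 2 * c i i else if i < j then c i j else c j i)" for i j
  have QG: "mat m m (\<lambda>(i, j). G i j) = Q" by (simp add: c(2) qform_matrix_def G_def)
  have "even (det Q)" unfolding c(2) by (rule det_even_of_odd_dim) (simp add: assms(1))
  then have "p \<noteq> 2" using assms(6) by auto
  then have p2: "p > 2" using assms(5) prime_ge_2_nat[of p] by simp
  interpret quad_space m "int p" G
    by unfold_locales (use assms(5,6) p2 QG in \<open>auto simp: G_def\<close>)
  have Bq: "2 * qform m c Y = B (($) Y) (($) Y)" if Y: "Y \<in> carrier_vec m" for Y
  proof -
    have "2 * qform m c Y = Y \<bullet> (qform_matrix m c *\<^sub>v Y)" by (rule qform_gram[OF Y])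
    also have "\<dots> = (\<Sum>i<m. \<Sum>j<m. G i j * Y $ i * Y $ j)"
      using Y by (simp add: scalar_prod_def qform_matrix_def G_def atLeast0LessThan sum_distrib_left mult_ac)
    finally show ?thesis by (simp add: B_def)
  qed
  have p0: "p > 0" and d2: "2 * d \<le> m" using p2 assms(1,8) by auto
  have "isotropic_sum m (p ^ 2) q (D_mat m p d) K =
      card {L. \<exists>M. M \<in> double_coset m (D_mat m p d) \<and> form_cong_0 m (int (p ^ 2)) (form_subst q M) \<and>
        L = mat_lattice m M \<and> ($) K \<in> L}"
    (is "_ = card ?X")
    by (rule isotropic_sum_lattices[OF p0 assms(9)])
  also have "?X = {L \<in> lattices d. ($) K \<in> L}"
  proof -
    have "form_cong_0 m (int (p ^ 2)) (form_subst q M) \<longleftrightarrow> (\<forall>y\<in>mat_lattice m M. (int p)^2 dvd B y y)"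
      if "M \<in> double_coset m (D_mat m p d)" for M
      using form_cong_iff[OF c(1) Bq double_coset_D(1)[OF that p0]] by simp
    then show ?thesis unfolding lattices_eq_mat_lattices[OF d2 refl, symmetric] by blast
  qed
  finally have iso: "isotropic_sum m (p ^ 2) q (D_mat m p d) K = card {L \<in> lattices d. ($) K \<in> L}" .
  have BK: "(int p)^2 dvd B (($) K) (($) K)"
    using assms(10) c(1)[OF assms(9)] Bq[OF assms(9)] by (metis cong_0_iff dvd_mult)
  define u where "u = (\<lambda>i. K $ i div int p)"
  \<comment> \<open>The factor 2 in \<open>eps\<close> is the one by which \<open>B\<close> exceeds
    the form, so the symbol is that of \<open>B u u\<close>.\<close>
  have "2 * q (map_vec (\<lambda>x. x div int p) K) = B u u"
  proof -
    have Kc: "map_vec (\<lambda>x. x div int p) K \<in> carrier_vec m" using assms(9) by simp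
    show ?thesis unfolding c(1)[OF Kc] Bq[OF Kc] using assms(9) by (intro B_eq) (auto simp: u_def)
  qed
  then have eps: "eps p q K = Legendre (B u u) (int p)" by (simp add: eps_def)
  have "delta ((1 / real p) \<cdot>\<^sub>v map_vec real_of_int K) = of_bool (\<forall>i<m. int p dvd K $ i)"
    by (rule delta_scaled[OF p0 assms(9)])
  moreover have "delta ((1 / real p ^ 2) \<cdot>\<^sub>v map_vec real_of_int K) = of_bool (\<forall>i<m. (int p)^2 dvd K $ i)"
    using delta_scaled[of "p ^ 2" K m] p0 assms(9) by simp
  ultimately show ?thesis
    using count_lattices[OF assms(1,7,8) BK] unfolding iso eps chi_def u_def QG by simp
qed

end
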